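(* Let $H_1,H_2$ be ordered graphs without isolated vertices and with $m_1,m_2$ edges, respectively. Then \[ r_<(H_1, H_2) \leq e^{10^8 (m_1m_2)^{1/4} (\log \log (m_1 + m_2))^{3/2}}. \]
   Context: An ordered graph on $n$ vertices is a graph on vertex set $\{1,\dots,n\}$ with its natural order. An ordered graph $G$ contains an ordered graph $H$ on $[n]$ if there is a map $\phi:V(H)\to V(G)$ with $\phi(i)<\phi(j)$ for $i<j$ and $\phi(i)\phi(j)\in E(G)$ whenever $ij\in E(H)$. For ordered graphs $H_1,H_2$, $r_<(H_1,H_2)$ is the minimum integer $N$ such that every red-blue coloring of the edges of the complete ordered graph on $[N]$ contains a red ordered copy of $H_1$ or a blue ordered copy of $H_2$. Logarithms are natural. *)

theory Defs
  imports Complex_Main "HOL-Library.Ramsey"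
begin

datatype ograph = OGraph (order: nat) (edges: "nat set set")

abbreviation verts :: "ograph \<Rightarrow> nat set" where
  "verts G \<equiv> {1..order G}"

definition ordered_graph :: "ograph \<Rightarrow> bool" where
  "ordered_graph G \<longleftrightarrow> edges G \<subseteq> nsets (verts G) 2"

definition no_isolated_vertices :: "ograph \<Rightarrow> bool" where
  "no_isolated_vertices G \<longleftrightarrow> (\<forall>v\<in>verts G. \<exists>e\<in>edges G. v \<in> e)"

definition contains_ordered :: "ograph \<Rightarrow> ograph \<Rightarrow> bool" where
  "contains_ordered G H \<longleftrightarrow>
     (\<exists>\<phi>. \<phi> ` verts H \<subseteq> verts G \<and> strict_mono_on (verts H) \<phi> \<and>
       (\<forall>i\<in>verts H. \<forall>j\<in>verts H. {i, j} \<in> edges H \<longrightarrow> {\<phi> i, \<phi> j} \<in> edges G))"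

datatype colour = Red | Blue

definition colour_class :: "nat \<Rightarrow> (nat set \<Rightarrow> colour) \<Rightarrow> colour \<Rightarrow> ograph" where
  "colour_class N \<chi> c = OGraph N {e \<in> nsets {1..N} 2. \<chi> e = c}"

definition ordered_ramsey :: "ograph \<Rightarrow> ograph \<Rightarrow> nat" where
  "ordered_ramsey H1 H2 = (LEAST N. \<forall>\<chi>.
     contains_ordered (colour_class N \<chi> Red) H1 \<or> contains_ordered (colour_class N \<chi> Blue) H2)"

end

theory Submission
  imports Defs
begin

text \<open>
  Embedding an ordered graph greedily in one colour either succeeds or stops at a pair of large
  sets, one entirely before the other, between which that colour has tiny density. The failure is
  as useful as the success. Almost everything between the two sets has the other colour, so a
  clique in that colour can be nearly doubled, and a graph whose vertices are cut into an initial
  and a final segment, each spanning at most half of its edges, can be embedded by placing one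
  segment in each set.

  The greedy embedding costs a factor exponential in the degrees. To avoid this for the few
  vertices of high degree, they are placed in a clique first: if every set of \<open>M\<close> vertices
  contains a clique, then supersaturation gives a clique such that each of its vertices is joined
  to a large set near every other one, and the vertices of low degree are embedded greedily into
  these sets.

  If there is no red \<open>H\<^sub>1\<close> and no blue \<open>H\<^sub>2\<close>, with \<open>a \<ge> b\<close> edges, then alternating these steps
  produces red cliques: first from the absence of a blue copy of a graph alone, then, starting
  from size about \<open>(ab)\<^sup>1\<^sup>/\<^sup>4\<close>, by growing the clique by a factor \<open>3/2\<close> in each of
  \<open>O(log log (a + b))\<close> rounds. Placing the vertices of \<open>H\<^sub>1\<close> of high degree in such a clique
  gives a sparse red pair, whence \<open>H\<^sub>2\<close> can be replaced by a graph with half as many edges. If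
  \<open>b\<close> is much smaller than \<open>a\<close>, a plain greedy embedding of \<open>H\<^sub>2\<close> halves \<open>H\<^sub>1\<close> instead. The
  exponent decreases geometrically, so the costs of all halvings add up to a constant multiple of
  the first one.
\<close>

section \<open>Ordered copies, cliques and sparse pairs\<close>

definition ordered_edges :: "('a::linorder \<times> 'a) set \<Rightarrow> bool" where
  "ordered_edges E \<longleftrightarrow> finite E \<and> (\<forall>(u, v)\<in>E. u < v)"

definition nbrs :: "('a \<times> 'a) set \<Rightarrow> 'a \<Rightarrow> 'a set" where
  "nbrs E u = {v. (u, v) \<in> E \<or> (v, u) \<in> E}"

definition embedding ::
    "('b::linorder \<Rightarrow> 'b \<Rightarrow> bool) \<Rightarrow> 'a::linorder set \<Rightarrow> ('a \<times> 'a) set \<Rightarrow> 'b set \<Rightarrow> ('a \<Rightarrow> 'b) \<Rightarrow> bool" where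
  "embedding c W E V \<phi> \<longleftrightarrow> strict_mono_on W \<phi> \<and> \<phi> ` W \<subseteq> V \<and> (\<forall>(u, v)\<in>E. c (\<phi> u) (\<phi> v))"

definition copy ::
    "('b::linorder \<Rightarrow> 'b \<Rightarrow> bool) \<Rightarrow> 'a::linorder set \<Rightarrow> ('a \<times> 'a) set \<Rightarrow> 'b set \<Rightarrow> bool" where
  "copy c W E V \<longleftrightarrow> (\<exists>\<phi>. embedding c W E V \<phi>)"

definition arrows ::
    "('b::linorder \<Rightarrow> 'b \<Rightarrow> bool) \<Rightarrow> ('a::linorder \<times> 'a) set \<Rightarrow> ('a \<times> 'a) set \<Rightarrow> 'b set \<Rightarrow> bool" where
  "arrows c E1 E2 V \<longleftrightarrow> copy (- c) (Field E1) E1 V \<or> copy c (Field E2) E2 V"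

lemma arrows_Compl: "arrows (- c) E2 E1 = arrows c E1 E2"
  unfolding arrows_def by (auto simp: fun_eq_iff[of "\<lambda>V. _ V"])

definition has_clique :: "('b \<Rightarrow> 'b \<Rightarrow> bool) \<Rightarrow> nat \<Rightarrow> 'b set \<Rightarrow> bool" where
  "has_clique c k V \<longleftrightarrow> (\<exists>X\<subseteq>V. finite X \<and> card X = k \<and> pairwise c X)"

definition separated :: "'b::linorder set \<Rightarrow> 'b set \<Rightarrow> bool" where
  "separated A B \<longleftrightarrow> (\<forall>a\<in>A. \<forall>b\<in>B. a < b)"

definition sparse_between :: "('b \<Rightarrow> 'b \<Rightarrow> bool) \<Rightarrow> real \<Rightarrow> 'b set \<Rightarrow> 'b set \<Rightarrow> bool" where
  "sparse_between c \<epsilon> A B \<longleftrightarrow> (\<forall>a\<in>A. real (card {b\<in>B. c a b}) \<le> \<epsilon> * real (card B))"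

text \<open>When the greedy embedding stops, a candidate set of size \<open>t\<close> is covered by at most \<open>n\<close> sets
  of bad vertices; \<open>A\<close> is the largest of them, which is why it is only required to have \<open>t / n\<close>
  elements.\<close>

definition sparse_pair :: "('b::linorder \<Rightarrow> 'b \<Rightarrow> bool) \<Rightarrow> real \<Rightarrow> nat \<Rightarrow> real \<Rightarrow> 'b set \<Rightarrow> bool" where
  "sparse_pair c \<epsilon> n t V \<longleftrightarrow> (\<exists>A\<subseteq>V. \<exists>B\<subseteq>V. (separated A B \<or> separated B A)
     \<and> t \<le> real n * real (card A) \<and> t \<le> real (card B) \<and> sparse_between c \<epsilon> A B)"

definition on_large_subsets :: "'b set \<Rightarrow> real \<Rightarrow> ('b set \<Rightarrow> bool) \<Rightarrow> bool" where
  "on_large_subsets V r P \<longleftrightarrow> (\<forall>X\<subseteq>V. r \<le> real (card X) \<longrightarrow> P X)"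

lemma symp_Compl: "symp c \<Longrightarrow> symp (- c)"
  by (auto simp: symp_def)

lemma ordered_edges_finite_Field: "ordered_edges E \<Longrightarrow> finite (Field E)"
  unfolding ordered_edges_def by (simp add: finite_Field)

lemma ordered_edges_irrefl: "ordered_edges E \<Longrightarrow> irrefl E"
  unfolding ordered_edges_def irrefl_def by fastforce

lemma ordered_edges_subset: "ordered_edges E \<Longrightarrow> E' \<subseteq> E \<Longrightarrow> ordered_edges E'"
  unfolding ordered_edges_def by (auto intro: finite_subset)

lemma nbrs_subset_Field: "nbrs E u \<subseteq> Field E"
  unfolding nbrs_def Field_def by auto

lemma finite_nbrs: "finite E \<Longrightarrow> finite (nbrs E u)"
  by (rule finite_subset[OF nbrs_subset_Field finite_Field])

lemma separated_mono: "separated A B \<Longrightarrow> A' \<subseteq> A \<Longrightarrow> B' \<subseteq> B \<Longrightarrow> separated A' B'"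
  unfolding separated_def by blast

lemma separated_imp_disjoint: "separated A B \<Longrightarrow> A \<inter> B = {}"
  unfolding separated_def by blast

lemma embeddingI:
  assumes "\<And>u v. u \<in> W \<Longrightarrow> v \<in> W \<Longrightarrow> u < v \<Longrightarrow> \<phi> u < \<phi> v" "\<And>u. u \<in> W \<Longrightarrow> \<phi> u \<in> V"
    "\<And>u v. (u, v) \<in> E \<Longrightarrow> c (\<phi> u) (\<phi> v)"
  shows "embedding c W E V \<phi>"
  using assms by (auto simp: embedding_def strict_mono_on_def)

lemma embeddingD:
  assumes "embedding c W E V \<phi>"
  shows "u \<in> W \<Longrightarrow> v \<in> W \<Longrightarrow> u < v \<Longrightarrow> \<phi> u < \<phi> v" "u \<in> W \<Longrightarrow> \<phi> u \<in> V"
    "(u, v) \<in> E \<Longrightarrow> c (\<phi> u) (\<phi> v)"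
  using assms by (auto simp: embedding_def strict_mono_on_def)

lemma copy_mono: "copy c W E V \<Longrightarrow> V \<subseteq> V' \<Longrightarrow> copy c W E V'"
  unfolding copy_def embedding_def by blast

lemma has_clique_mono: "has_clique c k V \<Longrightarrow> V \<subseteq> V' \<Longrightarrow> has_clique c k V'"
  unfolding has_clique_def by blast

lemma has_clique_le:
  assumes "has_clique c k V" "j \<le> k" shows "has_clique c j V"
proof -
  obtain X where X: "X \<subseteq> V" "card X = k" "pairwise c X"
    using assms(1) unfolding has_clique_def by blast
  obtain Y where Y: "Y \<subseteq> X" "card Y = j" "finite Y"
    using obtain_subset_with_card_n[of j X] X(2) assms(2) by blast
  have "pairwise c Y" by (rule pairwise_subset[OF X(3) Y(1)])
  moreover have "Y \<subseteq> V" using X(1) Y(1) by blast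
  ultimately show ?thesis unfolding has_clique_def using Y(2,3) by blast
qed

lemma has_clique_at_most_1:
  assumes "k \<le> 1" "k \<le> card X" shows "has_clique c k X"
proof -
  obtain Y where Y: "Y \<subseteq> X" "card Y = k" "finite Y" using obtain_subset_with_card_n[OF assms(2)] .
  then have "\<exists>y. Y \<subseteq> {y}" using assms(1) by (auto simp: le_Suc_eq card_1_singleton_iff)
  then have "pairwise c Y" by (auto simp: pairwise_def)
  then show ?thesis unfolding has_clique_def using Y by blast
qed

lemma on_large_subsetsD: "on_large_subsets V r P \<Longrightarrow> X \<subseteq> V \<Longrightarrow> r \<le> real (card X) \<Longrightarrow> P X"
  unfolding on_large_subsets_def by blast

lemma on_large_subsets_mono:
  assumes "on_large_subsets V r P" "X \<subseteq> V" "r \<le> r'" "\<And>Y. Y \<subseteq> X \<Longrightarrow> P Y \<Longrightarrow> Q Y"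
  shows "on_large_subsets X r' Q"
  using assms unfolding on_large_subsets_def by (meson order_trans)

section \<open>The greedy embedding\<close>

lemma ex_vertex_with_large_degrees:
  fixes \<epsilon> t :: real
  assumes fin: "finite F" "finite X" and cF: "card F \<le> n" and t: "0 < t" "t \<le> real (card X)"
    and dense: "\<And>u A. u \<in> F \<Longrightarrow> A \<subseteq> X \<Longrightarrow> t \<le> real n * real (card A) \<Longrightarrow> \<not> sparse_between c \<epsilon> A (C u)"
  obtains x where "x \<in> X" "\<And>u. u \<in> F \<Longrightarrow> \<epsilon> * real (card (C u)) < real (card {y\<in>C u. c x y})"
proof -
  define bad where "bad u = {x\<in>X. real (card {y\<in>C u. c x y}) \<le> \<epsilon> * real (card (C u))}" for u
  have few_bad: "real n * real (card (bad u)) < t" if "u \<in> F" for u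
  proof -
    have "sparse_between c \<epsilon> (bad u) (C u)" unfolding sparse_between_def bad_def by blast
    then show ?thesis using dense[OF that, of "bad u"] unfolding bad_def by fastforce
  qed
  have "\<not> X \<subseteq> (\<Union>u\<in>F. bad u)"
  proof
    assume cover: "X \<subseteq> (\<Union>u\<in>F. bad u)"
    then have "F \<noteq> {}" using t by auto
    have "card X \<le> card (\<Union>u\<in>F. bad u)"
      using cover fin by (intro card_mono) (auto simp: bad_def)
    also have "\<dots> \<le> (\<Sum>u\<in>F. card (bad u))" by (rule card_UN_le[OF fin(1)])
    finally have "real n * real (card X) \<le> real n * real (\<Sum>u\<in>F. card (bad u))"
      by (simp only: mult_left_mono of_nat_le_iff of_nat_0_le_iff)
    also have "\<dots> = (\<Sum>u\<in>F. real n * real (card (bad u)))" by (simp add: sum_distrib_left)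
    also have "\<dots> < (\<Sum>u\<in>F. t)" using few_bad fin(1) \<open>F \<noteq> {}\<close> by (intro sum_strict_mono) auto
    also have "\<dots> = real (card F) * t" by simp
    also have "\<dots> \<le> real n * real (card X)" using cF t by (intro mult_mono) auto
    finally show False by simp
  qed
  then show thesis using that unfolding bad_def by force
qed

definition back_degree :: "('a \<times> 'a) set \<Rightarrow> 'a list \<Rightarrow> 'a \<Rightarrow> nat" where
  "back_degree E ws u = card (nbrs E u \<inter> set (takeWhile (\<lambda>v. v \<noteq> u) ws))"

lemma back_degree_Cons:
  assumes "v \<notin> set ws" "u \<noteq> v"
  shows "back_degree E (v # ws) u = (if v \<in> nbrs E u then 1 else 0) + back_degree E ws u"
proof -
  have "v \<notin> set (takeWhile (\<lambda>v. v \<noteq> u) ws)" using assms(1) by (auto dest: set_takeWhileD)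
  then show ?thesis using assms(2) unfolding back_degree_def by simp
qed

lemma back_degree_le_card_nbrs:
  assumes "finite E" shows "back_degree E ws u \<le> card (nbrs E u)"
  unfolding back_degree_def by (intro card_mono finite_nbrs assms) auto

lemma back_degree_budget:
  fixes \<epsilon> a b :: real
  assumes "v \<notin> set ws" "u \<noteq> v" "0 \<le> \<epsilon>" "(if v \<in> nbrs E u then \<epsilon> * a else a) \<le> b"
  shows "a * \<epsilon> ^ back_degree E (v # ws) u \<le> b * \<epsilon> ^ back_degree E ws u"
proof -
  have "a * \<epsilon> ^ back_degree E (v # ws) u = (if v \<in> nbrs E u then \<epsilon> * a else a) * \<epsilon> ^ back_degree E ws u"
    by (simp add: back_degree_Cons[OF assms(1,2)] mult_ac)
  also have "\<dots> \<le> b * \<epsilon> ^ back_degree E ws u" using assms(3,4) by (intro mult_right_mono) auto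
  finally show ?thesis .
qed

definition candidate_embedding ::
    "('b \<Rightarrow> 'b \<Rightarrow> bool) \<Rightarrow> ('a \<times> 'a) set \<Rightarrow> ('a \<Rightarrow> 'b set) \<Rightarrow> 'a set \<Rightarrow> ('a \<Rightarrow> 'b) \<Rightarrow> bool" where
  "candidate_embedding c E C S \<phi> \<longleftrightarrow>
    (\<forall>u\<in>S. \<phi> u \<in> C u) \<and> (\<forall>(u, v)\<in>E. u \<in> S \<longrightarrow> v \<in> S \<longrightarrow> c (\<phi> u) (\<phi> v))"

lemma candidate_embedding_insert:
  assumes c: "symp c" and E: "irrefl E" and v: "v \<notin> S" "x \<in> C v"
    and \<phi>: "candidate_embedding c E (\<lambda>u. if v \<in> nbrs E u then {y\<in>C u. c x y} else C u) S \<phi>"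
  shows "candidate_embedding c E C (insert v S) (\<phi>(v := x))"
proof -
  have in_C: "\<phi> u \<in> C u" if "u \<in> S" for u
    using \<phi> that unfolding candidate_embedding_def by (auto split: if_splits)
  have "c x (\<phi> u)" if "u \<in> S" "v \<in> nbrs E u" for u
    using \<phi> that unfolding candidate_embedding_def by (auto split: if_splits)
  then have joined: "c x (\<phi> u)" "c (\<phi> u) x" if "u \<in> S" "v \<in> nbrs E u" for u
    using sympD[OF c] that by blast+
  have "c (\<phi> u) (\<phi> w)" if "(u, w) \<in> E" "u \<in> S" "w \<in> S" for u w
    using \<phi> that unfolding candidate_embedding_def by blast
  then have "c ((\<phi>(v := x)) u) ((\<phi>(v := x)) w)"
    if "(u, w) \<in> E" "u \<in> insert v S" "w \<in> insert v S" for u w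
    using that E joined unfolding irrefl_def nbrs_def by (cases "u = v"; cases "w = v") auto
  moreover have "(\<phi>(v := x)) u \<in> C u" if "u \<in> insert v S" for u using that v(2) in_C by auto
  ultimately show ?thesis unfolding candidate_embedding_def by blast
qed

lemma greedy_embedding:
  fixes \<epsilon> t :: real and C :: "'a \<Rightarrow> 'b set"
  assumes c: "symp c" and E: "irrefl E" and \<epsilon>: "0 < \<epsilon>" "\<epsilon> \<le> 1" and t: "0 < t"
    and ws: "distinct ws" "length ws \<le> n"
    and fin: "\<And>u. u \<in> set ws \<Longrightarrow> finite (C u)"
    and large: "\<And>u. u \<in> set ws \<Longrightarrow> t \<le> real (card (C u)) * \<epsilon> ^ back_degree E ws u"
    and dense: "\<And>u v A B. u \<in> set ws \<Longrightarrow> v \<in> set ws \<Longrightarrow> u \<noteq> v \<Longrightarrow> A \<subseteq> C u \<Longrightarrow> B \<subseteq> C v \<Longrightarrow>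
      t \<le> real n * real (card A) \<Longrightarrow> t \<le> real (card B) \<Longrightarrow> \<not> sparse_between c \<epsilon> A B"
  shows "\<exists>\<phi>. candidate_embedding c E C (set ws) \<phi>"
  using ws fin large dense
proof (induction ws arbitrary: C)
  case Nil
  then show ?case by (simp add: candidate_embedding_def)
next
  case (Cons v ws)
  note large = Cons.prems(4) and dense = Cons.prems(5)
  have v: "v \<notin> set ws" "distinct ws" using Cons.prems(1) by auto
  have C_ge: "t \<le> real (card (C u))" if "u \<in> set (v # ws)" for u
    using \<epsilon> by (intro order_trans[OF large[OF that] mult_left_le] power_le_one) auto
  let ?F = "{u \<in> set ws. v \<in> nbrs E u}"
  have "card ?F \<le> n" using Cons.prems(2) card_mono[of "set ws" ?F] card_length[of ws] by auto
  then obtain x where x: "x \<in> C v"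
      "\<And>u. u \<in> ?F \<Longrightarrow> \<epsilon> * real (card (C u)) < real (card {y\<in>C u. c x y})"
  proof (rule ex_vertex_with_large_degrees[rotated 2])
    show "t \<le> real (card (C v))" "finite (C v)" using C_ge Cons.prems(3) by auto
    show "\<not> sparse_between c \<epsilon> A (C u)"
      if "u \<in> ?F" "A \<subseteq> C v" "t \<le> real n * real (card A)" for u A
      using dense[of v u A "C u"] that v(1) C_ge by auto
  qed (use t in auto)
  define C' where "C' u = (if v \<in> nbrs E u then {y\<in>C u. c x y} else C u)" for u
  have C'_subset: "C' u \<subseteq> C u" for u unfolding C'_def by auto
  have "\<exists>\<phi>. candidate_embedding c E C' (set ws) \<phi>"
  proof (rule Cons.IH[OF v(2)])
    show "length ws \<le> n" using Cons.prems(2) by simp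
    show "finite (C' u)" if "u \<in> set ws" for u
      using Cons.prems(3) finite_subset[OF C'_subset] that by auto
    show "t \<le> real (card (C' u)) * \<epsilon> ^ back_degree E ws u" if u: "u \<in> set ws" for u
    proof -
      have "(if v \<in> nbrs E u then \<epsilon> * real (card (C u)) else real (card (C u))) \<le> real (card (C' u))"
        using x(2)[of u] u unfolding C'_def by (simp add: less_imp_le)
      from back_degree_budget[OF v(1) _ _ this]
      have "real (card (C u)) * \<epsilon> ^ back_degree E (v # ws) u \<le> real (card (C' u)) * \<epsilon> ^ back_degree E ws u"
        using u v(1) \<epsilon>(1) by auto
      then show ?thesis using large[of u] u by simp
    qed
    show "\<not> sparse_between c \<epsilon> A B"
      if "u \<in> set ws" "w \<in> set ws" "u \<noteq> w" "A \<subseteq> C' u" "B \<subseteq> C' w"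
        "t \<le> real n * real (card A)" "t \<le> real (card B)" for u w A B
      using dense[of u w A B] that C'_subset by force
  qed
  then obtain \<phi> where "candidate_embedding c E C' (set ws) \<phi>" by blast
  then show ?case
    using candidate_embedding_insert[OF c E v(1), of x C \<phi>] x(1) unfolding C'_def[abs_def] by auto
qed

lemma greedy_ordered_embedding:
  fixes \<epsilon> t :: real and C :: "'a::linorder \<Rightarrow> 'b::linorder set"
  assumes c: "symp c" and E: "irrefl E" and \<epsilon>: "0 < \<epsilon>" "\<epsilon> \<le> 1" and t: "0 < t"
    and ws: "distinct ws" "length ws \<le> n"
    and C: "\<And>u. u \<in> set ws \<Longrightarrow> C u \<subseteq> V" "finite V"
      "\<And>u v. u \<in> set ws \<Longrightarrow> v \<in> set ws \<Longrightarrow> u < v \<Longrightarrow> separated (C u) (C v)"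
    and large: "\<And>u. u \<in> set ws \<Longrightarrow> t \<le> real (card (C u)) * \<epsilon> ^ back_degree E ws u"
    and no_pair: "\<not> sparse_pair c \<epsilon> n t V"
  obtains \<phi> where "strict_mono_on (set ws) \<phi>" "candidate_embedding c E C (set ws) \<phi>"
proof -
  have "\<exists>\<phi>. candidate_embedding c E C (set ws) \<phi>"
  proof (rule greedy_embedding[OF c E \<epsilon> t ws _ large])
    show "finite (C u)" if "u \<in> set ws" for u by (rule finite_subset[OF C(1)[OF that] C(2)])
    show "\<not> sparse_between c \<epsilon> A B" if "u \<in> set ws" "v \<in> set ws" "u \<noteq> v" "A \<subseteq> C u" "B \<subseteq> C v"
      "t \<le> real n * real (card A)" "t \<le> real (card B)" for u v A B
    proof -
      have "separated A B \<or> separated B A"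
        using C(3)[of u v] C(3)[of v u] that(1-5) separated_mono by (metis neq_iff)
      moreover have "A \<subseteq> V" "B \<subseteq> V" using C(1) that(1,2,4,5) by blast+
      ultimately show ?thesis using no_pair that(6,7) unfolding sparse_pair_def by blast
    qed
  qed
  then obtain \<phi> where \<phi>: "candidate_embedding c E C (set ws) \<phi>" by blast
  then have "strict_mono_on (set ws) \<phi>"
    using C(3) unfolding candidate_embedding_def strict_mono_on_def separated_def by blast
  then show thesis using \<phi> by (rule that)
qed

lemma sum_card_Image_le:
  assumes "finite E" "finite B" shows "(\<Sum>v\<in>B. card (E `` {v})) \<le> card E"
proof -
  have "(\<Sum>v\<in>B. card (E `` {v})) = card (SIGMA v:B. E `` {v})"
    using assms by (simp add: finite_Image)
  also have "\<dots> \<le> card E" using assms by (intro card_mono) auto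
  finally show ?thesis .
qed

lemma sum_degrees_le:
  assumes "finite E" "finite B" shows "(\<Sum>v\<in>B. card (nbrs E v)) \<le> 2 * card E"
proof -
  have "nbrs E v = E `` {v} \<union> E\<inverse> `` {v}" for v unfolding nbrs_def by auto
  then have "(\<Sum>v\<in>B. card (nbrs E v)) \<le> (\<Sum>v\<in>B. card (E `` {v}) + card (E\<inverse> `` {v}))"
    by (simp add: card_Un_le sum_mono)
  also have "\<dots> \<le> card E + card (E\<inverse>)"
    using assms
    by (auto simp: sum.distrib simp del: card_inverse intro!: add_mono sum_card_Image_le)
  finally show ?thesis by (simp add: card_inverse)
qed

lemma card_Field_le:
  assumes "finite E" shows "card (Field E) \<le> 2 * card E"
proof -
  have "card (Field E) \<le> card (Domain E) + card (Range E)" unfolding Field_def by (rule card_Un_le)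
  also have "\<dots> \<le> card E + card E"
    unfolding Domain_fst Range_snd by (intro add_mono card_image_le assms)
  finally show ?thesis by simp
qed

lemma degeneracy_order:
  assumes W: "finite W" and E: "finite E" and d: "2 * card E \<le> d * d"
  obtains ws
    where "distinct ws" "set ws = (W :: 'a::linorder set)" "\<And>u. u \<in> W \<Longrightarrow> back_degree E ws u \<le> d"
proof -
  let ?deg = "\<lambda>v. card (nbrs E v)"
  define ws where "ws = sort_key (\<lambda>v. - int (?deg v)) (sorted_list_of_set W)"
  have ws: "distinct ws" "set ws = W" unfolding ws_def using W by simp_all
  have "sorted (map (\<lambda>v. - int (?deg v)) ws)" unfolding ws_def by simp
  then have decreasing: "sorted_wrt (\<lambda>v u. ?deg u \<le> ?deg v) ws" by (simp add: sorted_wrt_map)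
  have "back_degree E ws u \<le> d" if u: "u \<in> W" for u
  proof -
    obtain xs ys where split: "ws = xs @ u # ys" "u \<notin> set xs"
      using u ws(2) split_list_first by metis
    let ?B = "nbrs E u \<inter> set xs"
    have "takeWhile (\<lambda>v. v \<noteq> u) ws = xs"
      unfolding split(1) using split(2) by (subst takeWhile_append2) auto
    then have B: "back_degree E ws u = card ?B" unfolding back_degree_def by simp
    have earlier: "?deg u \<le> ?deg v" if "v \<in> ?B" for v
      using that decreasing unfolding split(1) by (auto simp: sorted_wrt_append)
    have "card ?B * card ?B \<le> card ?B * ?deg u"
      by (intro mult_left_mono card_mono finite_nbrs E) auto
    also have "\<dots> = (\<Sum>v\<in>?B. ?deg u)" by simp
    also have "\<dots> \<le> (\<Sum>v\<in>?B. ?deg v)" using earlier by (rule sum_mono)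
    also have "\<dots> \<le> 2 * card E" by (intro sum_degrees_le E) auto
    finally have "card ?B ^ 2 \<le> d ^ 2" using d by (simp add: power2_eq_square)
    then show ?thesis unfolding B by (rule power2_le_imp_le) simp
  qed
  then show thesis using that ws by blast
qed

definition rank :: "'a::linorder set \<Rightarrow> 'a \<Rightarrow> nat" where
  "rank W u = card {w\<in>W. w < u}"

lemma rank_less_card: "finite W \<Longrightarrow> u \<in> W \<Longrightarrow> rank W u < card W"
  unfolding rank_def by (rule psubset_card_mono) auto

lemma rank_strict_mono: "finite W \<Longrightarrow> u \<in> W \<Longrightarrow> u < v \<Longrightarrow> rank W u < rank W v"
  unfolding rank_def by (rule psubset_card_mono) auto

lemma rank_mono: "finite W \<Longrightarrow> u \<le> v \<Longrightarrow> rank W u \<le> rank W v"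
  unfolding rank_def by (rule card_mono) auto

lemma rank_le_card: "finite W \<Longrightarrow> rank W u \<le> card W"
  unfolding rank_def by (rule card_mono) auto

definition chunks :: "nat \<Rightarrow> nat \<Rightarrow> 'b::linorder set \<Rightarrow> (nat \<Rightarrow> 'b set) \<Rightarrow> bool" where
  "chunks n t Y Z \<longleftrightarrow> (\<forall>j<n. Z j \<subseteq> Y \<and> card (Z j) = t) \<and> (\<forall>j<n. \<forall>i<j. separated (Z i) (Z j))"

lemma chunksD:
  assumes "chunks n t Y Z"
  shows "j < n \<Longrightarrow> Z j \<subseteq> Y" "j < n \<Longrightarrow> card (Z j) = t" "i < j \<Longrightarrow> j < n \<Longrightarrow> separated (Z i) (Z j)"
  using assms unfolding chunks_def by blast+

lemma ex_chunks:
  fixes Y :: "'b::wellorder set"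
  assumes "finite Y" "n * t \<le> card Y"
  shows "\<exists>Z. chunks n t Y Z"
proof -
  obtain e where e: "bij_betw e {..<card Y} Y" "strict_mono_on {..<card Y} e"
    using ex_bij_betw_strict_mono_card[OF assms(1)] by blast
  define Z where "Z j = e ` {j * t..<j * t + t}" for j
  have interval: "{j * t..<j * t + t} \<subseteq> {..<card Y}" if "j < n" for j
  proof -
    have "(j + 1) * t \<le> n * t" using that by (intro mult_right_mono) auto
    then show ?thesis using assms(2) by auto
  qed
  have "chunks n t Y Z"
    unfolding chunks_def
  proof (intro conjI allI impI)
    show "Z j \<subseteq> Y" if "j < n" for j
      unfolding Z_def using interval[OF that] bij_betw_imp_surj_on[OF e(1)] by blast
    show "card (Z j) = t" if "j < n" for j
    proof -
      have "inj_on e {j * t..<j * t + t}"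
        using interval[OF that] bij_betw_imp_inj_on[OF e(1)] inj_on_subset by blast
      then show ?thesis unfolding Z_def by (simp add: card_image)
    qed
    show "separated (Z i) (Z j)" if "j < n" "i < j" for i j
      unfolding separated_def Z_def
    proof clarify
      fix p q assume p: "p \<in> {i * t..<i * t + t}" and q: "q \<in> {j * t..<j * t + t}"
      have "(i + 1) * t \<le> j * t" using that(2) by (intro mult_right_mono) auto
      then have "p < q" using p q by auto
      moreover have "p \<in> {..<card Y}" "q \<in> {..<card Y}"
        using interval p q that by (blast intro: less_trans)+
      ultimately show "e p < e q" using e(2) by (simp add: strict_mono_on_def)
    qed
  qed
  then show ?thesis by blast
qed

lemma copy_or_sparse_pair:
  fixes \<epsilon> t :: real and V :: "'b::wellorder set"
  assumes c: "symp c" and E: "ordered_edges E" and W: "finite W" "Field E \<subseteq> W" "card W \<le> n"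
    and d: "2 * card E \<le> d * d" and \<epsilon>: "0 < \<epsilon>" "\<epsilon> \<le> 1" and t: "0 < t" "t \<le> real s * \<epsilon> ^ d"
    and V: "finite V" "n * s \<le> card V"
  shows "copy c W E V \<or> sparse_pair c \<epsilon> n t V"
proof (rule disjCI)
  assume no_pair: "\<not> sparse_pair c \<epsilon> n t V"
  have "finite E" using E unfolding ordered_edges_def by simp
  then obtain ws where ws: "distinct ws" "set ws = W" "\<And>u. u \<in> W \<Longrightarrow> back_degree E ws u \<le> d"
    using degeneracy_order[OF W(1) _ d] by blast
  obtain Z where "chunks n s V Z" using ex_chunks[OF V] by blast
  note Z = chunksD[OF this]
  have rank: "rank W u < n" if "u \<in> W" for u using rank_less_card[OF W(1) that] W(3) by simp
  obtain \<phi> where \<phi>: "strict_mono_on W \<phi>" "candidate_embedding c E (\<lambda>u. Z (rank W u)) W \<phi>"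
  proof (rule greedy_ordered_embedding[OF c ordered_edges_irrefl[OF E] \<epsilon> t(1) ws(1) _ _ V(1) _ _ no_pair,
        where C = "\<lambda>u. Z (rank W u)", unfolded ws(2)])
    show "length ws \<le> n" using ws(1,2) W(3) distinct_card by metis
    show "Z (rank W u) \<subseteq> V" if "u \<in> W" for u using Z(1) rank[OF that] by blast
    show "separated (Z (rank W u)) (Z (rank W v))" if "u \<in> W" "v \<in> W" "u < v" for u v
      using Z(3) rank_strict_mono[OF W(1) that(1,3)] rank[OF that(2)] by blast
    show "t \<le> real (card (Z (rank W u))) * \<epsilon> ^ back_degree E ws u" if "u \<in> W" for u
    proof -
      have "t \<le> real s * \<epsilon> ^ d" by (rule t(2))
      also have "\<dots> \<le> real s * \<epsilon> ^ back_degree E ws u"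
        using ws(3)[OF that] \<epsilon> by (intro mult_left_mono power_decreasing) auto
      finally show ?thesis using Z(2)[OF rank[OF that]] by simp
    qed
  qed blast
  have "\<phi> ` W \<subseteq> V" using \<phi>(2) Z(1) rank unfolding candidate_embedding_def by blast
  moreover have "c (\<phi> u) (\<phi> v)" if "(u, v) \<in> E" for u v
    using \<phi>(2) that W(2) unfolding candidate_embedding_def Field_def by blast
  ultimately show "copy c W E V" using \<phi>(1) unfolding copy_def embedding_def by blast
qed

section \<open>Fat cliques\<close>

text \<open>Count the cliques with exactly one vertex in each block of \<open>Q\<close>. By averaging some \<open>q\<close> blocks
  have many of them. Among the subsets \<open>Q\<close> of these, take one maximising the count multiplied by
  \<open>(M\<^sup>2 / s)\<^bsup>card Q\<^esup>\<close>: maximality bounds the number of cliques with a small link in some block, and a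
  clique all of whose links are large remains.\<close>

lemma ex_marginally_rich_subset:
  fixes N :: "'i set \<Rightarrow> nat"
  assumes Q0: "finite Q0" "s ^ card Q0 \<le> N Q0 * M ^ card Q0" and pos: "0 < s" "1 < M"
    and upper: "\<And>Q. Q \<subseteq> Q0 \<Longrightarrow> N Q \<le> s ^ card Q"
  obtains Q
    where "Q \<subseteq> Q0" "card Q0 \<le> 2 * card Q" "0 < N Q" "\<And>i. i \<in> Q \<Longrightarrow> N (Q - {i}) * s \<le> M\<^sup>2 * N Q"
proof -
  define \<rho> where "\<rho> = real M ^ 2 / real s"
  have \<rho>: "0 < \<rho>" "real s * \<rho> = real M ^ 2" unfolding \<rho>_def using pos by auto
  define \<Psi> where "\<Psi> Q = real (N Q) * \<rho> ^ card Q" for Q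
  obtain Q where Q: "Q \<in> Pow Q0" "\<And>R. R \<in> Pow Q0 \<Longrightarrow> \<Psi> R \<le> \<Psi> Q"
    using obtains_MAX[of "Pow Q0" \<Psi>] Q0(1)
    by (metis Max_ge Pow_not_empty finite_Pow_iff finite_imageI imageI)
  have "real s ^ card Q0 * \<rho> ^ card Q0 \<le> (real (N Q0) * real M ^ card Q0) * \<rho> ^ card Q0"
    using Q0(2) \<rho>(1)
    by (intro mult_right_mono) (simp_all flip: of_nat_power of_nat_mult add: of_nat_le_iff)
  then have "real M ^ card Q0 \<le> \<Psi> Q0"
    unfolding power_mult_distrib[symmetric] \<rho>(2) \<Psi>_def using pos
    by (simp add: power2_eq_square power_mult_distrib mult_ac)
  also have "\<dots> \<le> \<Psi> Q" using Q(2) by blast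
  finally have \<Psi>_ge: "real M ^ card Q0 \<le> \<Psi> Q" .
  show thesis
  proof
    show "Q \<subseteq> Q0" using Q(1) by blast
    have "0 < real M ^ card Q0" using pos by simp
    then have "0 < \<Psi> Q" using \<Psi>_ge by linarith
    then show "0 < N Q" unfolding \<Psi>_def using \<rho>(1) by (simp add: zero_less_mult_iff)
    have "real (N Q) \<le> real s ^ card Q"
      using upper Q(1) by (simp flip: of_nat_power add: of_nat_le_iff)
    then have "\<Psi> Q \<le> real s ^ card Q * \<rho> ^ card Q"
      unfolding \<Psi>_def using \<rho>(1) by (intro mult_right_mono) auto
    also have "\<dots> = real M ^ (2 * card Q)"
      unfolding power_mult_distrib[symmetric] \<rho>(2) by (simp add: power_mult)
    finally have "real M ^ card Q0 \<le> real M ^ (2 * card Q)" using \<Psi>_ge by linarith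
    then show "card Q0 \<le> 2 * card Q" using pos(2) by (subst (asm) power_increasing_iff) auto
    show "N (Q - {i}) * s \<le> M\<^sup>2 * N Q" if "i \<in> Q" for i
    proof -
      have "card Q = Suc (card (Q - {i}))"
        using that Q(1) Q0(1) by (metis PowD card.remove finite_subset)
      moreover have "\<Psi> (Q - {i}) \<le> \<Psi> Q" using Q by blast
      ultimately have "real (N (Q - {i})) \<le> real (N Q) * \<rho>" unfolding \<Psi>_def using \<rho>(1) by simp
      then have "real (N (Q - {i})) * real s \<le> (real (N Q) * \<rho>) * real s"
        by (rule mult_right_mono) simp
      also have "\<dots> = real (M\<^sup>2 * N Q)" using \<rho>(2) by (simp add: mult_ac)
      finally show ?thesis by (simp only: of_nat_le_iff flip: of_nat_mult)
    qed
  qed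
qed

locale equal_blocks =
  fixes c :: "'b \<Rightarrow> 'b \<Rightarrow> bool" and B :: "'i \<Rightarrow> 'b set" and I :: "'i set" and s :: nat
  assumes finite_index: "finite I"
    and card_block: "i \<in> I \<Longrightarrow> card (B i) = s"
    and block_size_pos: "0 < s"
begin

definition clique_transversals :: "'i set \<Rightarrow> ('i \<Rightarrow> 'b) set" where
  "clique_transversals Q = {x \<in> PiE Q B. pairwise (\<lambda>i j. c (x i) (x j)) Q}"

definition link :: "'i set \<Rightarrow> ('i \<Rightarrow> 'b) \<Rightarrow> 'i \<Rightarrow> 'b set" where
  "link Q x i = {y \<in> B i. \<forall>j\<in>Q - {i}. c (x j) y}"

lemma finite_block: "i \<in> I \<Longrightarrow> finite (B i)"
  using card_block block_size_pos card.infinite by fastforce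

lemma finite_subindex: "Q \<subseteq> I \<Longrightarrow> finite Q"
  using finite_index finite_subset by blast

lemma finite_PiE_blocks: "Q \<subseteq> I \<Longrightarrow> finite (PiE Q B)"
  by (intro finite_PiE finite_subindex finite_block) auto

lemma card_PiE_blocks: "Q \<subseteq> I \<Longrightarrow> card (PiE Q B) = s ^ card Q"
  by (simp add: card_PiE finite_subindex card_block subset_iff)

lemma finite_clique_transversals: "Q \<subseteq> I \<Longrightarrow> finite (clique_transversals Q)"
  unfolding clique_transversals_def by (simp add: finite_PiE_blocks)

lemma card_clique_transversals_le: "Q \<subseteq> I \<Longrightarrow> card (clique_transversals Q) \<le> s ^ card Q"
  unfolding card_PiE_blocks[symmetric]
  by (intro card_mono finite_PiE_blocks) (auto simp: clique_transversals_def)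

lemma card_transversals_extending_le:
  assumes Q: "Q \<subseteq> I"
  shows "card {x \<in> PiE I B. restrict x Q \<in> clique_transversals Q}
    \<le> card (clique_transversals Q) * s ^ (card I - card Q)"
proof -
  let ?F = "{x \<in> PiE I B. restrict x Q \<in> clique_transversals Q}"
  let ?h = "\<lambda>x. (restrict x Q, restrict x (I - Q))"
  have "inj_on ?h ?F"
  proof (rule inj_onI)
    fix x y assume xy: "x \<in> ?F" "y \<in> ?F" "?h x = ?h y"
    show "x = y"
    proof (rule PiE_ext[of x I B y])
      show "x \<in> PiE I B" "y \<in> PiE I B" using xy by auto
      show "x i = y i" if "i \<in> I" for i
        using xy(3) that by (cases "i \<in> Q") (auto dest: fun_cong[of _ _ i] simp: restrict_def)
    qed
  qed
  moreover have "?h ` ?F \<subseteq> clique_transversals Q \<times> PiE (I - Q) B" by (auto simp: PiE_def Pi_def)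
  ultimately have "card ?F \<le> card (clique_transversals Q \<times> PiE (I - Q) B)"
    using finite_clique_transversals[OF Q] finite_PiE_blocks[of "I - Q"]
    by (intro card_inj_on_le[of ?h]) auto
  also have "\<dots> = card (clique_transversals Q) * s ^ (card I - card Q)"
    using Q by (simp add: card_cartesian_product card_PiE_blocks card_Diff_subset finite_subindex)
  finally show ?thesis .
qed

lemma ex_many_clique_transversals:
  assumes cliques: "\<And>x. x \<in> PiE I B \<Longrightarrow> \<exists>Q\<subseteq>I. card Q = q \<and> restrict x Q \<in> clique_transversals Q"
  obtains Q where "Q \<subseteq> I" "card Q = q" "s ^ q \<le> card (clique_transversals Q) * card I ^ q"
proof -
  define \<Q> where "\<Q> = {Q. Q \<subseteq> I \<and> card Q = q}"
  have finite_\<Q>: "finite \<Q>" unfolding \<Q>_def using finite_index by simp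
  obtain f where f: "\<And>x. x \<in> PiE I B \<Longrightarrow> f x \<in> \<Q> \<and> restrict x (f x) \<in> clique_transversals (f x)"
    using cliques unfolding \<Q>_def by (metis (mono_tags, lifting) mem_Collect_eq)
  have "card (PiE I B) \<noteq> 0" using card_PiE_blocks[of I] block_size_pos by simp
  then have "PiE I B \<noteq> {}" by (metis card.empty)
  then have "\<Q> \<noteq> {}" using f by blast
  then obtain Q where Q: "Q \<in> \<Q>" "card (PiE I B) \<le> card (f -` {Q} \<inter> PiE I B) * card \<Q>"
    using pigeonhole_card[of f "PiE I B" \<Q>] f finite_\<Q> finite_PiE_blocks[of I] by blast
  then have QI: "Q \<subseteq> I" "card Q = q" unfolding \<Q>_def by auto
  then have "q \<le> card I" using card_mono[OF finite_index] by blast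
  have "s ^ (card I - q) * s ^ q = card (PiE I B)"
    using \<open>q \<le> card I\<close> by (simp add: card_PiE_blocks flip: power_add)
  also have "\<dots> \<le> (card (clique_transversals Q) * s ^ (card I - q)) * card I ^ q"
  proof (rule order_trans[OF Q(2)], rule mult_le_mono)
    have "card (f -` {Q} \<inter> PiE I B) \<le> card {x \<in> PiE I B. restrict x Q \<in> clique_transversals Q}"
      using f finite_PiE_blocks[of I] by (intro card_mono) auto
    also have "\<dots> \<le> card (clique_transversals Q) * s ^ (card I - q)"
      using card_transversals_extending_le[OF QI(1)] QI(2) by simp
    finally show "card (f -` {Q} \<inter> PiE I B) \<le> card (clique_transversals Q) * s ^ (card I - q)" .
    have "card \<Q> = card I choose q" unfolding \<Q>_def by (rule n_subsets[OF finite_index])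
    then show "card \<Q> \<le> card I ^ q" using binomial_le_pow[OF \<open>q \<le> card I\<close>] by simp
  qed
  finally have "s ^ (card I - q) * s ^ q \<le> s ^ (card I - q) * (card (clique_transversals Q) * card I ^ q)"
    by (simp add: mult_ac)
  then show thesis using that[OF QI] block_size_pos by simp
qed

lemma card_transversals_small_link_le:
  assumes Q: "Q \<subseteq> I" "i \<in> Q"
  shows "K * card {x \<in> clique_transversals Q. K * card (link Q x i) < s}
    \<le> card (clique_transversals (Q - {i})) * s"
proof -
  let ?bad = "{x \<in> clique_transversals Q. K * card (link Q x i) < s}"
  let ?Z = "{z \<in> clique_transversals (Q - {i}). K * card (link Q z i) < s}"
  have fin: "finite (clique_transversals (Q - {i}))"
    using Q by (intro finite_clique_transversals) auto
  have finite_link: "finite (link Q z i)" for z unfolding link_def using finite_block Q by auto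
  have "?bad \<subseteq> (\<Union>z\<in>?Z. (\<lambda>y. z(i := y)) ` link Q z i)"
  proof
    fix x assume x: "x \<in> ?bad"
    define z where "z = restrict x (Q - {i})"
    have link_z: "link Q z i = link Q x i" unfolding link_def z_def by auto
    have x_props: "x \<in> PiE Q B" "pairwise (\<lambda>i j. c (x i) (x j)) Q"
      using x unfolding clique_transversals_def by auto
    then have "z \<in> clique_transversals (Q - {i})"
      unfolding clique_transversals_def z_def by (auto simp: PiE_def Pi_def pairwise_def)
    then have "z \<in> ?Z" using x link_z by simp
    moreover have "x i \<in> link Q z i"
      using x_props Q(2) unfolding link_z by (auto simp: link_def PiE_def Pi_def pairwise_def)
    moreover have "x = z(i := x i)"
      using x_props(1) Q(2) unfolding z_def by (auto simp: fun_eq_iff PiE_def extensional_def)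
    ultimately show "x \<in> (\<Union>z\<in>?Z. (\<lambda>y. z(i := y)) ` link Q z i)" by blast
  qed
  then have "card ?bad \<le> card (\<Union>z\<in>?Z. (\<lambda>y. z(i := y)) ` link Q z i)"
    using fin finite_link by (intro card_mono) auto
  also have "\<dots> \<le> (\<Sum>z\<in>?Z. card ((\<lambda>y. z(i := y)) ` link Q z i))" using fin by (intro card_UN_le) simp
  also have "\<dots> \<le> (\<Sum>z\<in>?Z. card (link Q z i))" by (intro sum_mono card_image_le finite_link)
  finally have "K * card ?bad \<le> (\<Sum>z\<in>?Z. K * card (link Q z i))"
    unfolding sum_distrib_left[symmetric] by (rule mult_left_mono) simp
  also have "\<dots> \<le> (\<Sum>z\<in>?Z. s)" by (intro sum_mono) auto
  also have "\<dots> \<le> card (clique_transversals (Q - {i})) * s"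
    using fin by (auto intro!: mult_right_mono card_mono)
  finally show ?thesis .
qed

lemma ex_transversal_large_links:
  assumes Q: "Q \<subseteq> I" "card Q \<le> q" and M: "0 < M" and nonempty: "0 < card (clique_transversals Q)"
    and marginal: "\<And>i. i \<in> Q \<Longrightarrow> card (clique_transversals (Q - {i})) * s \<le> M * card (clique_transversals Q)"
  obtains x where "x \<in> clique_transversals Q" "\<And>i. i \<in> Q \<Longrightarrow> s \<le> 2 * q * M * card (link Q x i)"
proof -
  let ?T = "clique_transversals Q"
  let ?bad = "\<lambda>i. {x \<in> ?T. 2 * q * M * card (link Q x i) < s}"
  have few_bad: "2 * q * card (?bad i) \<le> card ?T" if "i \<in> Q" for i
  proof -
    have "M * (2 * q * card (?bad i)) \<le> card (clique_transversals (Q - {i})) * s"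
      using card_transversals_small_link_le[OF Q(1) that, of "2 * q * M"] by (simp add: mult_ac)
    then have "M * (2 * q * card (?bad i)) \<le> M * card ?T" using marginal[OF that] by linarith
    then show ?thesis using M by simp
  qed
  have "\<not> ?T \<subseteq> (\<Union>i\<in>Q. ?bad i)"
  proof
    assume cover: "?T \<subseteq> (\<Union>i\<in>Q. ?bad i)"
    have "card ?T \<le> card (\<Union>i\<in>Q. ?bad i)"
      using cover Q(1) finite_subindex finite_clique_transversals by (intro card_mono) auto
    also have "\<dots> \<le> (\<Sum>i\<in>Q. card (?bad i))" by (intro card_UN_le finite_subindex Q(1))
    finally have "2 * q * card ?T \<le> (\<Sum>i\<in>Q. 2 * q * card (?bad i))"
      by (simp flip: sum_distrib_left)
    also have "\<dots> \<le> card Q * card ?T" using sum_mono[of Q _ "\<lambda>_. card ?T", OF few_bad] by simp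
    also have "\<dots> \<le> q * card ?T" using Q(2) by simp
    finally have "q = 0" using nonempty by simp
    moreover have "Q \<noteq> {}" using cover nonempty by auto
    ultimately show False using Q finite_subindex by simp
  qed
  then obtain x where "x \<in> ?T" "\<forall>i\<in>Q. x \<notin> ?bad i" by blast
  then show thesis using that[of x] by (auto simp: not_less)
qed

lemma ex_rich_clique_transversal:
  assumes s: "s = 4 * k * (card I)\<^sup>2 * m" and I: "1 < card I"
    and cliques: "\<And>x. x \<in> PiE I B \<Longrightarrow> \<exists>Q\<subseteq>I. card Q = 2 * k \<and> restrict x Q \<in> clique_transversals Q"
  obtains Q x
    where "Q \<subseteq> I" "k \<le> card Q" "x \<in> clique_transversals Q" "\<And>i. i \<in> Q \<Longrightarrow> m \<le> card (link Q x i)"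
proof -
  obtain Q0 where Q0: "Q0 \<subseteq> I" "card Q0 = 2 * k"
      "s ^ card Q0 \<le> card (clique_transversals Q0) * card I ^ card Q0"
    using ex_many_clique_transversals[OF cliques] by auto
  obtain Q where Q: "Q \<subseteq> Q0" "k \<le> card Q" "0 < card (clique_transversals Q)"
      "\<And>i. i \<in> Q \<Longrightarrow> card (clique_transversals (Q - {i})) * s \<le> (card I)\<^sup>2 * card (clique_transversals Q)"
  proof (rule ex_marginally_rich_subset[where N = "\<lambda>Q. card (clique_transversals Q)",
        OF finite_subindex[OF Q0(1)] Q0(3) block_size_pos I])
    show "card (clique_transversals Q) \<le> s ^ card Q" if "Q \<subseteq> Q0" for Q
      using card_clique_transversals_le[of Q] that Q0(1) by blast
  qed (use Q0(2) in auto)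
  have QI: "Q \<subseteq> I" using Q(1) Q0(1) by blast
  have "card Q \<le> 2 * k" "0 < (card I)\<^sup>2"
    using card_mono[OF finite_subindex[OF Q0(1)] Q(1)] Q0(2) I by simp_all
  then obtain x where x: "x \<in> clique_transversals Q"
      "\<And>i. i \<in> Q \<Longrightarrow> s \<le> 2 * (2 * k) * (card I)\<^sup>2 * card (link Q x i)"
    using ex_transversal_large_links[OF QI _ _ Q(3,4)] by blast
  have "m \<le> card (link Q x i)" if "i \<in> Q" for i
    using x(2)[OF that] block_size_pos unfolding s by simp
  then show thesis using that[OF QI Q(2) x(1)] by blast
qed

end

definition fat_clique ::
    "('b::linorder \<Rightarrow> 'b \<Rightarrow> bool) \<Rightarrow> nat \<Rightarrow> nat \<Rightarrow> 'b set \<Rightarrow> (nat \<Rightarrow> 'b) \<Rightarrow> (nat \<Rightarrow> 'b set) \<Rightarrow> bool" where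
  "fat_clique c k m V x Y \<longleftrightarrow> (\<forall>i<k. insert (x i) (Y i) \<subseteq> V \<and> m \<le> card (Y i))
    \<and> (\<forall>j<k. \<forall>i<j. separated (insert (x i) (Y i)) (insert (x j) (Y j)))
    \<and> (\<forall>i<k. \<forall>j<k. i \<noteq> j \<longrightarrow> (\<forall>y\<in>insert (x j) (Y j). c (x i) y))"

lemma fat_cliqueD:
  assumes "fat_clique c k m V x Y"
  shows "i < k \<Longrightarrow> insert (x i) (Y i) \<subseteq> V" "i < k \<Longrightarrow> m \<le> card (Y i)"
    "i < j \<Longrightarrow> j < k \<Longrightarrow> separated (insert (x i) (Y i)) (insert (x j) (Y j))"
    "i < k \<Longrightarrow> j < k \<Longrightarrow> i \<noteq> j \<Longrightarrow> y \<in> insert (x j) (Y j) \<Longrightarrow> c (x i) y"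
  using assms unfolding fat_clique_def by blast+

lemma clique_in_transversal:
  assumes "has_clique c q (x ` I)" "inj_on x I" "x \<in> PiE I B"
  obtains Q where "Q \<subseteq> I" "card Q = q" "restrict x Q \<in> PiE Q B" "pairwise (\<lambda>i j. c (x i) (x j)) Q"
proof -
  obtain X where X: "X \<subseteq> x ` I" "card X = q" "pairwise c X"
    using assms(1) unfolding has_clique_def by blast
  then obtain Q where Q: "Q \<subseteq> I" "X = x ` Q" by (meson subset_imageE)
  have inj: "inj_on x Q" using assms(2) Q(1) inj_on_subset by blast
  show thesis
  proof (rule that[OF Q(1)])
    show "card Q = q" using X(2) card_image[OF inj] unfolding Q(2) by simp
    show "restrict x Q \<in> PiE Q B" using assms(3) Q(1) by (auto simp: PiE_def Pi_def)
    show "pairwise (\<lambda>i j. c (x i) (x j)) Q"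
      using X(3) inj unfolding Q(2) pairwise_image by (auto simp: pairwise_def inj_on_eq_iff)
  qed
qed

lemma fat_clique_of_transversal:
  fixes B :: "nat \<Rightarrow> 'b::linorder set"
  assumes B: "equal_blocks B {..<M} s" "chunks M s V B"
    and Q: "Q \<subseteq> {..<M}" "k \<le> card Q" and x: "x \<in> equal_blocks.clique_transversals c B Q"
    and links: "\<And>i. i \<in> Q \<Longrightarrow> m \<le> card (equal_blocks.link c B Q x i)"
  obtains y Y where "fat_clique c k m V y Y"
proof -
  interpret equal_blocks c B "{..<M}" s by (rule B(1))
  obtain e where e: "bij_betw e {..<card Q} Q" "strict_mono_on {..<card Q} e"
    using ex_bij_betw_strict_mono_card[OF finite_subindex[OF Q(1)]] by blast
  have eQ: "e i \<in> Q" if "i < k" for i using that Q(2) bij_betwE[OF e(1)] by simp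
  have in_block: "insert (x i) (link Q x i) \<subseteq> B i" if "i \<in> Q" for i
    using x that unfolding clique_transversals_def link_def by auto
  have "fat_clique c k m V (x \<circ> e) (link Q x \<circ> e)"
    unfolding fat_clique_def comp_apply
  proof (intro conjI allI impI)
    fix i assume i: "i < k"
    have "e i < M" using eQ[OF i] Q(1) by blast
    then show "insert (x (e i)) (link Q x (e i)) \<subseteq> V"
      using in_block[OF eQ[OF i]] chunksD(1)[OF B(2)] by blast
    show "m \<le> card (link Q x (e i))" by (rule links[OF eQ[OF i]])
  next
    fix i j assume ij: "j < k" "i < j"
    then have "e i < e j" using e(2) Q(2) unfolding strict_mono_on_def by simp
    moreover have "e j < M" using eQ[OF ij(1)] Q(1) by blast
    ultimately show "separated (insert (x (e i)) (link Q x (e i))) (insert (x (e j)) (link Q x (e j)))"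
      using chunksD(3)[OF B(2)] in_block[OF eQ] ij separated_mono by (meson less_trans)
  next
    fix i j assume ij: "i < k" "j < k" "i \<noteq> j"
    then have "e i \<noteq> e j" using bij_betw_imp_inj_on[OF e(1)] Q(2) by (simp add: inj_on_eq_iff)
    then show "\<forall>y\<in>insert (x (e j)) (link Q x (e j)). c (x (e i)) y"
      using x eQ ij(1,2) unfolding clique_transversals_def link_def pairwise_def by auto
  qed
  then show thesis by (rule that)
qed

lemma ex_fat_clique:
  fixes V :: "'b::wellorder set"
  assumes V: "finite V" "M * (4 * k * M\<^sup>2 * m) \<le> card V" and pos: "0 < k" "0 < m" "1 < M"
    and cliques: "\<And>X. X \<subseteq> V \<Longrightarrow> card X = M \<Longrightarrow> has_clique c (2 * k) X"
  obtains x Y where "fat_clique c k m V x Y"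
proof -
  define s where "s = 4 * k * M\<^sup>2 * m"
  obtain B where chunks: "chunks M s V B"
    using ex_chunks[OF V(1), of M s] V(2) unfolding s_def by blast
  note B = chunksD[OF chunks]
  interpret equal_blocks c B "{..<M}" s by standard (use B(2) pos in \<open>auto simp: s_def\<close>)
  have transversals: "\<exists>Q\<subseteq>{..<M}. card Q = 2 * k \<and> restrict x Q \<in> clique_transversals Q"
    if x: "x \<in> PiE {..<M} B" for x
  proof -
    have "x i < x j" if "i < j" "j < M" for i j
      using B(3)[OF that] x that unfolding separated_def by (auto simp: PiE_def Pi_def)
    then have inj: "inj_on x {..<M}" by (intro linorder_inj_onI') (metis lessThan_iff less_irrefl)
    have "x ` {..<M} \<subseteq> V" using x B(1) by (fastforce simp: PiE_def Pi_def)
    then have "has_clique c (2 * k) (x ` {..<M})" using cliques card_image[OF inj] by simp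
    then obtain Q where "Q \<subseteq> {..<M}" "card Q = 2 * k" "restrict x Q \<in> PiE Q B"
      "pairwise (\<lambda>i j. c (x i) (x j)) Q" by (rule clique_in_transversal[OF _ inj x])
    then show ?thesis unfolding clique_transversals_def by (auto simp: pairwise_def)
  qed
  obtain Q x where Q: "Q \<subseteq> {..<M}" "k \<le> card Q" "x \<in> clique_transversals Q"
      "\<And>i. i \<in> Q \<Longrightarrow> m \<le> card (link Q x i)"
    using ex_rich_clique_transversal[OF _ _ transversals, of m] pos(3) unfolding s_def by auto
  show thesis
    using fat_clique_of_transversal[OF equal_blocks_axioms chunks Q] that by blast
qed

text \<open>Clique vertices in every other position host \<open>S\<close>; the sets \<open>Y\<close> in between are cut into
  chunks for the remaining vertices, so that any interleaving of the two kinds of vertices can be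
  realised.\<close>

definition slot :: "'a::linorder set \<Rightarrow> 'a \<Rightarrow> nat" where
  "slot S u = 2 * rank S u + (if u \<in> S then 1 else 0)"

lemma slot_less: "finite S \<Longrightarrow> slot S u < 2 * card S + 1"
  using rank_less_card[of S u] rank_le_card[of S u] unfolding slot_def by (cases "u \<in> S") auto

lemma slot_strict_mono: "finite S \<Longrightarrow> u < v \<Longrightarrow> u \<in> S \<or> v \<in> S \<Longrightarrow> slot S u < slot S v"
  using rank_mono[of S u v] rank_strict_mono[of S u v]
  unfolding slot_def by (cases "u \<in> S") (auto simp: less_imp_le less_Suc_eq_le)

lemma slot_mono:
  assumes "finite S" "u \<le> v" shows "slot S u \<le> slot S v"
proof (cases "u = v \<or> u \<in> S \<or> v \<in> S")
  case True
  then show ?thesis using slot_strict_mono[OF assms(1), of u v] assms(2) by (auto simp: le_less)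
next
  case False
  then show ?thesis using rank_mono[OF assms] unfolding slot_def by simp
qed

lemma copy_in_fat_clique:
  assumes c: "symp c" and E: "ordered_edges E" "Field E \<subseteq> W" and S: "finite S" "S \<subseteq> W"
    and fat: "fat_clique c (2 * card S + 1) m V x Y"
    and \<phi>: "strict_mono_on (W - S) \<phi>" "candidate_embedding c E (\<lambda>u. Y (slot S u)) (W - S) \<phi>"
  shows "copy c W E V"
proof -
  define \<psi> where "\<psi> u = (if u \<in> S then x (slot S u) else \<phi> u)" for u
  have \<psi>: "\<psi> u \<in> insert (x (slot S u)) (Y (slot S u))" if "u \<in> W" for u
    using \<phi>(2) that unfolding \<psi>_def candidate_embedding_def by auto
  have slot: "slot S u < 2 * card S + 1" for u by (rule slot_less[OF S(1)])
  have "embedding c W E V \<psi>"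
  proof (rule embeddingI)
    show "\<psi> u \<in> V" if "u \<in> W" for u using \<psi>[OF that] fat_cliqueD(1)[OF fat slot] by blast
    show "\<psi> u < \<psi> v" if uv: "u \<in> W" "v \<in> W" "u < v" for u v
    proof (cases "slot S u < slot S v")
      case True
      from fat_cliqueD(3)[OF fat this slot] show ?thesis
        using \<psi>[OF uv(1)] \<psi>[OF uv(2)] unfolding separated_def by blast
    next
      case False
      then have "u \<notin> S" "v \<notin> S" using slot_strict_mono[OF S(1) uv(3)] by auto
      then show ?thesis using \<phi>(1) uv unfolding \<psi>_def strict_mono_on_def by simp
    qed
    show "c (\<psi> u) (\<psi> v)" if uv: "(u, v) \<in> E" for u v
    proof -
      have W: "u \<in> W" "v \<in> W" and "u < v"
        using uv E unfolding ordered_edges_def Field_def by auto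
      then have slots: "slot S u \<noteq> slot S v" if "u \<in> S \<or> v \<in> S"
        using slot_strict_mono[OF S(1) _ that] by simp
      have joined: "c (\<psi> a) (\<psi> b)" if "a \<in> S" "b \<in> W" "slot S a \<noteq> slot S b" for a b
        using fat_cliqueD(4)[OF fat slot slot that(3) \<psi>[OF that(2)]] that(1)
        unfolding \<psi>_def[of a] by simp
      consider "u \<in> S" | "v \<in> S" | "u \<notin> S" "v \<notin> S" by blast
      then show ?thesis
      proof cases
        case 1
        then show ?thesis using joined W(2) slots by blast
      next
        case 2
        then have "c (\<psi> v) (\<psi> u)" using joined[OF _ W(1)] slots by metis
        then show ?thesis by (rule sympD[OF c])
      next
        case 3
        then show ?thesis using \<phi>(2) uv W unfolding \<psi>_def candidate_embedding_def by auto
      qed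
    qed
  qed
  then show ?thesis unfolding copy_def by blast
qed

lemma ex_candidates_in_fat_clique:
  fixes V :: "'b::wellorder set"
  assumes W: "finite W" "card W \<le> n" and S: "finite S" and V: "finite V"
    and fat: "fat_clique c (2 * card S + 1) (n * s) V x Y"
  obtains C where "\<And>u. u \<in> W \<Longrightarrow> C u \<subseteq> Y (slot S u)" "\<And>u. u \<in> W \<Longrightarrow> card (C u) = s"
    "\<And>u v. u \<in> W \<Longrightarrow> v \<in> W \<Longrightarrow> u < v \<Longrightarrow> separated (C u) (C v)"
proof -
  have slot: "slot S u < 2 * card S + 1" for u by (rule slot_less[OF S])
  have rank: "rank W u < n" if "u \<in> W" for u using rank_less_card[OF W(1) that] W(2) by simp
  have "\<exists>Z. chunks n s (Y l) Z" if l: "l < 2 * card S + 1" for l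
  proof -
    have "Y l \<subseteq> V" using fat_cliqueD(1)[OF fat l] by blast
    then show ?thesis using V finite_subset by (intro ex_chunks fat_cliqueD(2)[OF fat l]) blast
  qed
  then obtain Z where Z: "\<And>l. l < 2 * card S + 1 \<Longrightarrow> chunks n s (Y l) (Z l)" by metis
  let ?C = "\<lambda>u. Z (slot S u) (rank W u)"
  show thesis
  proof
    show C: "?C u \<subseteq> Y (slot S u)" "card (?C u) = s" if "u \<in> W" for u
      using chunksD[OF Z[OF slot]] rank[OF that] by blast+
    show "separated (?C u) (?C v)" if uv: "u \<in> W" "v \<in> W" "u < v" for u v
    proof (cases "slot S u = slot S v")
      case True
      then show ?thesis
        using chunksD(3)[OF Z[OF slot] rank_strict_mono[OF W(1) uv(1,3)] rank[OF uv(2)]] by simp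
    next
      case False
      then have "slot S u < slot S v" using slot_mono[OF S less_imp_le[OF uv(3)]] by simp
      then have "separated (insert (x (slot S u)) (Y (slot S u))) (insert (x (slot S v)) (Y (slot S v)))"
        by (rule fat_cliqueD(3)[OF fat _ slot])
      then show ?thesis by (rule separated_mono) (use C uv in auto)
    qed
  qed
qed

lemma copy_or_sparse_pair_if_fat_clique:
  fixes \<epsilon> t :: real and V :: "'b::wellorder set"
  assumes c: "symp c" and E: "ordered_edges E" and W: "finite W" "Field E \<subseteq> W" "card W \<le> n"
    and S: "S \<subseteq> W" "\<And>u. u \<in> W - S \<Longrightarrow> card (nbrs E u) \<le> d"
    and \<epsilon>: "0 < \<epsilon>" "\<epsilon> \<le> 1" and t: "0 < t" "t \<le> real s * \<epsilon> ^ d" and V: "finite V"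
    and fat: "fat_clique c (2 * card S + 1) (n * s) V x Y"
  shows "copy c W E V \<or> sparse_pair c \<epsilon> n t V"
proof (rule disjCI)
  assume no_pair: "\<not> sparse_pair c \<epsilon> n t V"
  have finite_S: "finite S" using S(1) W(1) finite_subset by blast
  obtain C where C: "\<And>u. u \<in> W \<Longrightarrow> C u \<subseteq> Y (slot S u)" "\<And>u. u \<in> W \<Longrightarrow> card (C u) = s"
    "\<And>u v. u \<in> W \<Longrightarrow> v \<in> W \<Longrightarrow> u < v \<Longrightarrow> separated (C u) (C v)"
    using ex_candidates_in_fat_clique[OF W(1,3) finite_S V fat] by blast
  define ws where "ws = sorted_list_of_set (W - S)"
  have ws: "distinct ws" "set ws = W - S" unfolding ws_def using W(1) by simp_all
  obtain \<phi> where \<phi>: "strict_mono_on (W - S) \<phi>" "candidate_embedding c E C (W - S) \<phi>"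
  proof (rule greedy_ordered_embedding[OF c ordered_edges_irrefl[OF E] \<epsilon> t(1) ws(1) _ _ V _ _ no_pair,
        where C = C, unfolded ws(2)])
    have "card (W - S) \<le> card W" using W(1) by (intro card_mono) auto
    then show "length ws \<le> n" using distinct_card[OF ws(1)] ws(2) W(3) by simp
    show "C u \<subseteq> V" if "u \<in> W - S" for u
      using C(1)[of u] fat_cliqueD(1)[OF fat slot_less[OF finite_S], of u] that by blast
    show "separated (C u) (C v)" if "u \<in> W - S" "v \<in> W - S" "u < v" for u v using C(3) that by blast
    show "t \<le> real (card (C u)) * \<epsilon> ^ back_degree E ws u" if u: "u \<in> W - S" for u
    proof -
      have "back_degree E ws u \<le> d"
        using back_degree_le_card_nbrs[of E ws u] S(2)[OF u] E unfolding ordered_edges_def by simp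
      then have "real s * \<epsilon> ^ d \<le> real s * \<epsilon> ^ back_degree E ws u"
        using \<epsilon> by (intro mult_left_mono power_decreasing) auto
      then show ?thesis using t(2) C(2)[of u] u by simp
    qed
  qed blast
  have "candidate_embedding c E (\<lambda>u. Y (slot S u)) (W - S) \<phi>"
    using \<phi>(2) C(1) unfolding candidate_embedding_def by fast
  then show "copy c W E V" by (rule copy_in_fat_clique[OF c E W(2) finite_S S(1) fat \<phi>(1)])
qed

section \<open>Doubling a clique\<close>

lemma erdos_szekeres_clique:
  assumes c: "symp c" and V: "finite V" "(p + q choose p) \<le> card V"
  shows "has_clique c p V \<or> has_clique (- c) q V"
proof -
  let ?N = "p + q choose p"
  obtain v where v: "v ` {..<?N} \<subseteq> V" "inj_on v {..<?N}"
    using card_le_inj[of "{..<?N}" V] V by auto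
  define f where "f e = (if \<exists>i\<in>e. \<exists>j\<in>e. i \<noteq> j \<and> c (v i) (v j) then 0 else 1 :: nat)" for e
  have "partn_lst {..<?N} [p, q] 2" using ramsey2_full[of 2 p q] by (simp add: ES2_choose)
  moreover have "f \<in> nsets {..<?N} 2 \<rightarrow> {..<2}" unfolding f_def by auto
  ultimately obtain i H where "i < length [p, q]" and H: "H \<in> nsets {..<?N} ([p, q] ! i)"
    and mono: "f ` nsets H 2 \<subseteq> {i}" by (rule partn_lstE) simp
  then have i: "i < 2" by simp
  have H_props: "H \<subseteq> {..<?N}" "card H = [p, q] ! i" "finite H" using H by (auto simp: nsets_def)
  then have card: "card (v ` H) = [p, q] ! i" using v(2) by (metis card_image inj_on_subset)
  have "v ` H \<subseteq> V" using H_props(1) v(1) by blast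
  have colour: "f {a, b} = i" if "a \<in> H" "b \<in> H" "a \<noteq> b" for a b
    using mono that by (auto simp: image_subset_iff)
  have "pairwise (if i = 0 then c else - c) (v ` H)"
    unfolding pairwise_image
  proof (rule pairwiseI, rule impI)
    fix a b assume "a \<in> H" "b \<in> H" "a \<noteq> b"
    from colour[OF this] i show "(if i = 0 then c else - c) (v a) (v b)"
      using \<open>a \<noteq> b\<close> sympD[OF c] by (auto simp: f_def split: if_splits)
  qed
  then have "has_clique (if i = 0 then c else - c) ([p, q] ! i) V"
    unfolding has_clique_def using card \<open>v ` H \<subseteq> V\<close> H_props(3) by blast
  then show ?thesis using i by (cases "i = 0") (auto simp: less_2_cases_iff)
qed

lemma card_subsets_card_le:
  assumes "finite X" shows "card {R. R \<subseteq> X \<and> card R \<le> \<rho>} = (\<Sum>i\<le>\<rho>. card X choose i)"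
proof -
  have "{R. R \<subseteq> X \<and> card R \<le> \<rho>} = (\<Union>i\<le>\<rho>. {R. R \<subseteq> X \<and> card R = i})" by auto
  also have "card \<dots> = (\<Sum>i\<le>\<rho>. card {R. R \<subseteq> X \<and> card R = i})"
    using assms by (intro card_UN_disjoint) auto
  finally show ?thesis by (simp add: n_subsets[OF assms])
qed

lemma sparse_between_low_degrees:
  assumes fin: "finite X" "finite B" and sparse: "sparse_between c \<epsilon> X B"
    and \<rho>: "2 * \<epsilon> * real (card X) < real \<rho> + 1"
  shows "real (card B) \<le> 2 * real (card {b\<in>B. card {x\<in>X. c x b} \<le> \<rho>})"
proof -
  let ?B0 = "{b\<in>B. card {x\<in>X. c x b} \<le> \<rho>}"
  have "(real \<rho> + 1) * real (card (B - ?B0)) = (\<Sum>b\<in>B - ?B0. real \<rho> + 1)" by simp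
  also have "\<dots> \<le> (\<Sum>b\<in>B - ?B0. real (card {x\<in>X. c x b}))" by (rule sum_mono) auto
  also have "\<dots> \<le> (\<Sum>b\<in>B. real (card {x\<in>X. c x b}))" using fin by (intro sum_mono2) auto
  also have "\<dots> = (\<Sum>x\<in>X. real (card {b\<in>B. c x b}))"
    using sum_multicount_gen[OF fin(2,1), of "\<lambda>b x. c x b"] by (simp flip: of_nat_sum)
  also have "\<dots> \<le> (\<Sum>x\<in>X. \<epsilon> * real (card B))"
    using sparse unfolding sparse_between_def by (intro sum_mono) auto
  also have "\<dots> = (\<epsilon> * real (card X)) * real (card B)" by simp
  also have "\<dots> \<le> ((real \<rho> + 1) / 2) * real (card B)" using \<rho> by (intro mult_right_mono) auto
  finally have "(real \<rho> + 1) * real (card (B - ?B0)) \<le> (real \<rho> + 1) * (real (card B) / 2)" by simp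
  then have "real (card (B - ?B0)) \<le> real (card B) / 2" by simp
  moreover have "real (card (B - ?B0)) = real (card B) - real (card ?B0)"
    using fin by (simp add: card_Diff_subset card_mono of_nat_diff)
  ultimately show ?thesis by linarith
qed

lemma ex_large_fibre:
  fixes P s :: real
  assumes "f \<in> B \<rightarrow> R" "finite B" "finite R" "R \<noteq> {}" "real (card R) \<le> P" "P * s \<le> real (card B)"
  obtains r where "r \<in> R" "s \<le> real (card {b\<in>B. f b = r})"
proof -
  obtain r where r: "r \<in> R" "card B \<le> card (f -` {r} \<inter> B) * card R"
    using pigeonhole_card[OF assms(1-4)] by blast
  have fibre: "f -` {r} \<inter> B = {b\<in>B. f b = r}" by auto
  have "P * s \<le> real (card B)" by (rule assms(6))
  also have "\<dots> \<le> real (card {b\<in>B. f b = r}) * real (card R)"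
    using r(2) unfolding fibre by (simp flip: of_nat_mult)
  also have "\<dots> \<le> real (card {b\<in>B. f b = r}) * P" using assms(5) by (rule mult_left_mono) simp
  finally have "P * s \<le> P * real (card {b\<in>B. f b = r})" by (simp add: mult.commute)
  moreover have "0 < card R" using assms(3,4) by (simp add: card_gt_0_iff)
  then have "0 < P" using assms(5) by linarith
  ultimately show thesis using that[OF r(1)] by simp
qed

lemma has_clique_Un:
  assumes fin: "finite X" "finite Y" and disjoint: "X \<inter> Y = {}" and sub: "X \<union> Y \<subseteq> V"
    and cliques: "pairwise c X" "pairwise c Y" and cross: "\<And>x y. x \<in> X \<Longrightarrow> y \<in> Y \<Longrightarrow> c x y \<and> c y x"
  shows "has_clique c (card X + card Y) V"
proof -
  have "pairwise c (X \<union> Y)" using cliques cross by (auto simp: pairwise_def)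
  then show ?thesis
    unfolding has_clique_def
    using fin sub card_Un_disjoint[OF fin disjoint] by (intro exI[of _ "X \<union> Y"]) auto
qed

text \<open>Fix a clique \<open>X\<close> in \<open>A\<close> and classify the vertices of \<open>B\<close> by their set of bad neighbours in
  \<open>X\<close>. Half of them have at most \<open>\<rho>\<close>, so some pattern is shared by enough vertices to contain a
  second clique; delete the pattern from \<open>X\<close>.\<close>

lemma clique_doubling:
  fixes \<epsilon> t s P :: real and V :: "'b::linorder set"
  assumes c: "symp c" and V: "finite V" and pair: "sparse_pair c \<epsilon> n t V" "0 < n"
    and cliques: "on_large_subsets V s (has_clique (- c) k)"
    and \<rho>: "2 * \<epsilon> * real k < real \<rho> + 1" and P: "real (\<Sum>i\<le>\<rho>. k choose i) \<le> P"
    and t: "real n * s \<le> t" "2 * P * s \<le> t"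
  shows "has_clique (- c) (2 * k - \<rho>) V"
proof -
  obtain A B where AB: "A \<subseteq> V" "B \<subseteq> V" "separated A B \<or> separated B A" "t \<le> real n * real (card A)"
    "t \<le> real (card B)" "sparse_between c \<epsilon> A B" using pair(1) unfolding sparse_pair_def by blast
  have "finite B" using AB(2) V finite_subset by blast
  have "real n * s \<le> real n * real (card A)" using t(1) AB(4) by linarith
  then have "s \<le> real (card A)" using pair(2) by simp
  then obtain X where X: "X \<subseteq> A" "finite X" "card X = k" "pairwise (- c) X"
    using on_large_subsetsD[OF cliques AB(1)] unfolding has_clique_def by blast
  define bad where "bad b = {x\<in>X. c x b}" for b
  define B0 where "B0 = {b\<in>B. card (bad b) \<le> \<rho>}"
  have "sparse_between c \<epsilon> X B" using AB(6) X(1) unfolding sparse_between_def by blast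
  then have "real (card B) \<le> 2 * real (card B0)"
    unfolding B0_def bad_def using X(2,3) \<rho> \<open>finite B\<close> by (intro sparse_between_low_degrees) auto
  then have "P * s \<le> real (card B0)" using t(2) AB(5) by linarith
  then obtain Q where Q: "Q \<in> {R. R \<subseteq> X \<and> card R \<le> \<rho>}" "s \<le> real (card {b\<in>B0. bad b = Q})"
  proof (rule ex_large_fibre[rotated 5])
    show "bad \<in> B0 \<rightarrow> {R. R \<subseteq> X \<and> card R \<le> \<rho>}" unfolding B0_def bad_def by auto
    show "{R. R \<subseteq> X \<and> card R \<le> \<rho>} \<noteq> {}" by (auto intro: exI[of _ "{}"])
    show "real (card {R. R \<subseteq> X \<and> card R \<le> \<rho>}) \<le> P"
      using P card_subsets_card_le[OF X(2)] X(3) by simp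
  qed (use X(2) \<open>finite B\<close> in \<open>auto simp: B0_def\<close>)
  have "{b\<in>B0. bad b = Q} \<subseteq> V" using AB(2) unfolding B0_def by blast
  then obtain Y where Y: "Y \<subseteq> {b\<in>B0. bad b = Q}" "finite Y" "card Y = k" "pairwise (- c) Y"
    using on_large_subsetsD[OF cliques _ Q(2)] unfolding has_clique_def by blast
  have YB: "Y \<subseteq> B" using Y(1) unfolding B0_def by blast
  have "has_clique (- c) (card (X - Q) + card Y) V"
  proof (rule has_clique_Un)
    show "(X - Q) \<inter> Y = {}" using X(1) YB AB(3) separated_imp_disjoint by blast
    show "X - Q \<union> Y \<subseteq> V" using X(1) YB AB(1,2) by blast
    show "pairwise (- c) (X - Q)" using X(4) by (rule pairwise_subset) blast
    show "(- c) x y \<and> (- c) y x" if "x \<in> X - Q" "y \<in> Y" for x y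
      using that Y(1) sympD[OF c, of y x] unfolding bad_def by auto
  qed (use X(2) Y(2,4) in auto)
  moreover have "2 * k - \<rho> \<le> card (X - Q) + card Y"
  proof -
    have "card X - card Q \<le> card (X - Q)"
      using Q(1) X(2) by (intro diff_card_le_card_Diff) (auto intro: finite_subset)
    moreover have "card Q \<le> \<rho>" using Q(1) by simp
    ultimately show ?thesis using X(3) Y(3) by linarith
  qed
  ultimately show ?thesis by (rule has_clique_le)
qed

section \<open>Placing two halves of a graph in a sparse pair\<close>

lemma split_edges:
  assumes E: "ordered_edges E" and W: "finite W"
  obtains W1 W2 where "W = W1 \<union> W2" "separated W1 W2"
    "2 * card (E \<inter> W1 \<times> W1) \<le> card E" "2 * card (E \<inter> W2 \<times> W2) \<le> card E"
proof -
  define light where "light P \<longleftrightarrow> P \<subseteq> W \<and> separated P (W - P) \<and> 2 * card (E \<inter> P \<times> P) \<le> card E" for P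
  have "finite {P. light P}" using W unfolding light_def by simp
  moreover have "{} \<in> {P. light P}" unfolding light_def separated_def by simp
  ultimately obtain P where P: "light P" and maximal: "\<And>R. light R \<Longrightarrow> P \<subseteq> R \<Longrightarrow> P = R"
    using finite_has_maximal[of "{P. light P}"] by blast
  let ?R = "W - P"
  have "2 * card (E \<inter> ?R \<times> ?R) \<le> card E"
  proof (cases "?R = {}")
    case False
    define x where "x = Min ?R"
    have x: "x \<in> ?R" "\<And>v. v \<in> ?R \<Longrightarrow> x \<le> v" unfolding x_def using W False Min_in[of ?R] by auto
    let ?P' = "insert x P"
    have "\<not> light ?P'" using maximal[of ?P'] x(1) by blast
    moreover have "separated ?P' (W - ?P')"
      using P x unfolding light_def separated_def by (auto simp: order.strict_iff_order)
    ultimately have heavy: "card E < 2 * card (E \<inter> ?P' \<times> ?P')"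
      using P x(1) unfolding light_def by auto
    have "(E \<inter> ?R \<times> ?R) \<inter> (E \<inter> ?P' \<times> ?P') = {}" using E unfolding ordered_edges_def by fastforce
    then have "card (E \<inter> ?R \<times> ?R) + card (E \<inter> ?P' \<times> ?P') = card ((E \<inter> ?R \<times> ?R) \<union> (E \<inter> ?P' \<times> ?P'))"
      using E unfolding ordered_edges_def by (simp add: card_Un_disjoint)
    also have "\<dots> \<le> card E" using E unfolding ordered_edges_def by (intro card_mono) auto
    finally show ?thesis using heavy by linarith
  next
    case True
    show ?thesis unfolding True by simp
  qed
  then show thesis using P that[of P ?R] unfolding light_def by blast
qed

lemma copy_Un:
  assumes E: "ordered_edges E" "Field E \<subseteq> W1 \<union> W2" and W: "separated W1 W2" and V: "separated V1 V2"
    and \<phi>1: "embedding c W1 (E \<inter> W1 \<times> W1) V1 \<phi>1" and \<phi>2: "embedding c W2 (E \<inter> W2 \<times> W2) V2 \<phi>2"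
    and cross: "\<And>u v. u \<in> W1 \<Longrightarrow> v \<in> W2 \<Longrightarrow> c (\<phi>1 u) (\<phi>2 v)"
  shows "copy c (W1 \<union> W2) E (V1 \<union> V2)"
proof -
  define \<phi> where "\<phi> u = (if u \<in> W1 then \<phi>1 u else \<phi>2 u)" for u
  have \<phi>_W1: "\<phi> u = \<phi>1 u" if "u \<in> W1" for u using that unfolding \<phi>_def by simp
  have \<phi>_W2: "\<phi> u = \<phi>2 u" if "u \<in> W2" for u
    using that separated_imp_disjoint[OF W] unfolding \<phi>_def by auto
  have positions: "u \<in> W1 \<and> v \<in> W1 \<or> u \<in> W1 \<and> v \<in> W2 \<or> u \<in> W2 \<and> v \<in> W2"
    if "u \<in> W1 \<union> W2" "v \<in> W1 \<union> W2" "u < v" for u v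
    using that W unfolding separated_def by force
  have "embedding c (W1 \<union> W2) E (V1 \<union> V2) \<phi>"
  proof (rule embeddingI)
    have into: "\<phi> u \<in> V1" if "u \<in> W1" for u using embeddingD(2)[OF \<phi>1 that] \<phi>_W1[OF that] by simp
    have into': "\<phi> u \<in> V2" if "u \<in> W2" for u using embeddingD(2)[OF \<phi>2 that] \<phi>_W2[OF that] by simp
    show "\<phi> u \<in> V1 \<union> V2" if "u \<in> W1 \<union> W2" for u using that into into' by blast
    show "\<phi> u < \<phi> v" if uv: "u \<in> W1 \<union> W2" "v \<in> W1 \<union> W2" "u < v" for u v
      using positions[OF uv]
    proof (elim disjE conjE)
      assume "u \<in> W1" "v \<in> W2"
      then show ?thesis using V into into' unfolding separated_def by blast
    qed (use embeddingD(1)[OF \<phi>1 _ _ uv(3)] embeddingD(1)[OF \<phi>2 _ _ uv(3)] \<phi>_W1 \<phi>_W2 in auto)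
    show "c (\<phi> u) (\<phi> v)" if uv: "(u, v) \<in> E" for u v
    proof -
      have "u \<in> W1 \<union> W2" "v \<in> W1 \<union> W2" "u < v"
        using uv E unfolding ordered_edges_def Field_def by auto
      from positions[OF this] show ?thesis
        using uv cross embeddingD(3)[OF \<phi>1, of u v] embeddingD(3)[OF \<phi>2, of u v] \<phi>_W1 \<phi>_W2 by auto
    qed
  qed
  then show ?thesis unfolding copy_def by blast
qed

lemma ex_embeddings_without_edges_between:
  assumes B: "finite B" and AB: "A \<subseteq> V" "B \<subseteq> V" "sparse_between c \<epsilon> A B"
    and size: "s \<le> real (card A)" "2 * s \<le> real (card B)"
    and U1: "finite U1" "0 \<le> \<epsilon>" "2 * \<epsilon> * real (card U1) < 1"
    and copies: "on_large_subsets V s (copy (- c) U1 F1)" "on_large_subsets V s (copy (- c) U2 F2)"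
  obtains \<phi>1 \<phi>2 where "embedding (- c) U1 F1 A \<phi>1" "embedding (- c) U2 F2 B \<phi>2"
    "\<And>u v. u \<in> U1 \<Longrightarrow> v \<in> U2 \<Longrightarrow> \<not> c (\<phi>1 u) (\<phi>2 v)"
proof -
  obtain \<phi>1 where \<phi>1: "embedding (- c) U1 F1 A \<phi>1"
    using on_large_subsetsD[OF copies(1) AB(1) size(1)] unfolding copy_def by blast
  let ?X = "\<phi>1 ` U1" and ?B' = "{b\<in>B. \<forall>a\<in>\<phi>1 ` U1. \<not> c a b}"
  have "sparse_between c \<epsilon> ?X B" using AB(3) \<phi>1 unfolding sparse_between_def embedding_def by blast
  moreover have "2 * \<epsilon> * real (card ?X) \<le> 2 * \<epsilon> * real (card U1)"
    using U1(2) card_image_le[OF U1(1), of \<phi>1] by (intro mult_left_mono) auto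
  then have "2 * \<epsilon> * real (card ?X) < real 0 + 1" using U1(3) by simp
  ultimately have "real (card B) \<le> 2 * real (card {b\<in>B. card {a\<in>?X. c a b} \<le> 0})"
    using U1(1) B by (intro sparse_between_low_degrees) auto
  also have "{b\<in>B. card {a\<in>?X. c a b} \<le> 0} = ?B'" using U1(1) by auto
  finally have "s \<le> real (card ?B')" using size(2) by linarith
  moreover have "?B' \<subseteq> V" using AB(2) by blast
  ultimately obtain \<phi>2 where \<phi>2: "embedding (- c) U2 F2 ?B' \<phi>2"
    using on_large_subsetsD[OF copies(2)] unfolding copy_def by blast
  then have "embedding (- c) U2 F2 B \<phi>2" "\<And>u v. u \<in> U1 \<Longrightarrow> v \<in> U2 \<Longrightarrow> \<not> c (\<phi>1 u) (\<phi>2 v)"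
    unfolding embedding_def by blast+
  with \<phi>1 show thesis by (rule that)
qed

lemma copy_if_halves_copied:
  fixes \<epsilon> t s :: real
  assumes c: "symp c" and V: "finite V" and pair: "sparse_pair c \<epsilon> n t V" "0 < n"
    and E: "ordered_edges E" "Field E \<subseteq> W1 \<union> W2" and W: "finite (W1 \<union> W2)" "separated W1 W2"
    and \<epsilon>: "0 \<le> \<epsilon>" "2 * \<epsilon> * real (card (W1 \<union> W2)) < 1" and t: "real n * s \<le> t" "2 * s \<le> t"
    and copies: "on_large_subsets V s (copy (- c) W1 (E \<inter> W1 \<times> W1))"
      "on_large_subsets V s (copy (- c) W2 (E \<inter> W2 \<times> W2))"
  shows "copy (- c) (W1 \<union> W2) E V"
proof -
  obtain A B where AB: "A \<subseteq> V" "B \<subseteq> V" "separated A B \<or> separated B A" "t \<le> real n * real (card A)"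
    "t \<le> real (card B)" "sparse_between c \<epsilon> A B" using pair(1) unfolding sparse_pair_def by blast
  have "finite B" using AB(2) V finite_subset by blast
  have "real n * s \<le> real n * real (card A)" using t(1) AB(4) by linarith
  then have size: "s \<le> real (card A)" "2 * s \<le> real (card B)" using pair(2) t(2) AB(5) by auto
  have small: "finite U" "2 * \<epsilon> * real (card U) < 1" if "U \<subseteq> W1 \<union> W2" for U
  proof -
    show "finite U" using that W(1) by (rule finite_subset)
    have "2 * \<epsilon> * real (card U) \<le> 2 * \<epsilon> * real (card (W1 \<union> W2))"
      using \<epsilon>(1) card_mono[OF W(1) that] by (intro mult_left_mono) auto
    then show "2 * \<epsilon> * real (card U) < 1" using \<epsilon>(2) by linarith
  qed
  note place = ex_embeddings_without_edges_between[OF \<open>finite B\<close> AB(1,2,6) size small(1) \<epsilon>(1) small(2)]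
  from AB(3) have "copy (- c) (W1 \<union> W2) E (A \<union> B)"
  proof
    assume "separated A B"
    obtain \<phi>1 \<phi>2
      where \<phi>: "embedding (- c) W1 (E \<inter> W1 \<times> W1) A \<phi>1" "embedding (- c) W2 (E \<inter> W2 \<times> W2) B \<phi>2"
      "\<And>u v. u \<in> W1 \<Longrightarrow> v \<in> W2 \<Longrightarrow> \<not> c (\<phi>1 u) (\<phi>2 v)" using place[OF _ _ copies] by blast
    show ?thesis by (rule copy_Un[OF E W(2) \<open>separated A B\<close> \<phi>(1,2)]) (simp add: \<phi>(3))
  next
    assume "separated B A"
    obtain \<phi>2 \<phi>1
      where \<phi>: "embedding (- c) W2 (E \<inter> W2 \<times> W2) A \<phi>2" "embedding (- c) W1 (E \<inter> W1 \<times> W1) B \<phi>1"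
      "\<And>u v. u \<in> W2 \<Longrightarrow> v \<in> W1 \<Longrightarrow> \<not> c (\<phi>2 u) (\<phi>1 v)" using place[OF _ _ copies(2,1)] by blast
    then have "(- c) (\<phi>1 u) (\<phi>2 v)" if "u \<in> W1" "v \<in> W2" for u v using that sympD[OF c] by auto
    then have "copy (- c) (W1 \<union> W2) E (B \<union> A)" by (rule copy_Un[OF E W(2) \<open>separated B A\<close> \<phi>(2,1)])
    then show ?thesis by (simp add: Un_commute)
  qed
  then show ?thesis using AB(1,2) by (elim copy_mono) blast
qed

lemma strict_mono_on_extend_with_gaps:
  fixes J :: "'a::linorder \<Rightarrow> nat"
  assumes W: "finite W" "W0 \<subseteq> W" "card W \<le> n"
    and J: "strict_mono_on W0 J" "\<And>u. u \<in> W0 \<Longrightarrow> J u \<in> {1..s}"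
  obtains g where "strict_mono_on W g" "\<And>u. u \<in> W0 \<Longrightarrow> g u = J u * (n + 1)" "\<And>u. u \<in> W \<Longrightarrow> g u < (s + 1) * (n + 1)"
proof -
  define K where "K w = Max (insert 0 (J ` {u\<in>W0. u \<le> w}))" for w
  define r where "r w = (if w \<in> W0 then 0 else rank W w + 1)" for w
  have fin: "finite (insert 0 (J ` {u\<in>W0. u \<le> w}))" for w
    using finite_subset[OF W(2,1)] by simp
  have K_mono: "K u \<le> K v" if "u \<le> v" for u v
    unfolding K_def using that fin by (intro Max_mono) auto
  have K_le: "K w \<le> s" for w unfolding K_def using fin J(2) by auto
  have K_less: "K u < J v" if "v \<in> W0" "u < v" for u v
    unfolding K_def using fin J(2)[OF that(1)] that J(1) by (auto simp: strict_mono_on_def)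
  have K_eq: "K v = J v" if "v \<in> W0" for v
    unfolding K_def using fin that J(1) by (intro Max_eqI) (auto simp: strict_mono_on_leD)
  have r_le: "r w \<le> n" if "w \<in> W" for w
    using rank_less_card[OF W(1) that] W(3) unfolding r_def by simp
  define g where "g w = K w * (n + 1) + r w" for w
  show thesis
  proof
    show "g u = J u * (n + 1)" if "u \<in> W0" for u using that K_eq unfolding g_def r_def by simp
    show "g u < (s + 1) * (n + 1)" if "u \<in> W" for u
    proof -
      have "K u * (n + 1) \<le> s * (n + 1)" using K_le by (rule mult_right_mono) simp
      then show ?thesis using r_le[OF that] unfolding g_def by simp
    qed
    show "strict_mono_on W g"
    proof (rule strict_mono_onI)
      fix u v assume uv: "u \<in> W" "v \<in> W" "u < v"
      show "g u < g v"
      proof (cases "v \<in> W0")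
        case True
        then have "(K u + 1) * (n + 1) \<le> K v * (n + 1)"
          using K_less[OF True uv(3)] K_eq[OF True] by (intro mult_right_mono) auto
        then show ?thesis using r_le[OF uv(1)] unfolding g_def by simp
      next
        case False
        have "K u * (n + 1) \<le> K v * (n + 1)" using K_mono uv(3) by (intro mult_right_mono) auto
        moreover have "r u < r v"
          using False rank_strict_mono[OF W(1) uv(1,3)] unfolding r_def by simp
        ultimately show ?thesis unfolding g_def by linarith
      qed
    qed
  qed
qed

lemma copy_from_every_nth:
  fixes e :: "nat \<Rightarrow> 'b::linorder" and W :: "'a::linorder set"
  assumes e: "strict_mono_on {..<N} e" "e ` {..<N} \<subseteq> V" and N: "(s + 1) * (n + 1) \<le> N"
    and W: "finite W" "card W \<le> n" "W0 \<subseteq> W" and E: "Field E \<subseteq> W0"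
    and copy: "copy c W0 E ((\<lambda>j. e (j * (n + 1))) ` {1..s})"
  shows "copy c W E V"
proof -
  define pos where "pos j = j * (n + 1)" for j
  have pos: "pos j < N" if "j \<in> {1..s}" for j
  proof -
    have "j * (n + 1) < (s + 1) * (n + 1)" using that by (intro mult_strict_right_mono) auto
    then show ?thesis using N unfolding pos_def by linarith
  qed
  obtain \<phi> where \<phi>: "embedding c W0 E ((\<lambda>j. e (pos j)) ` {1..s}) \<phi>"
    using copy unfolding copy_def pos_def by blast
  then have "\<phi> ` W0 \<subseteq> (\<lambda>j. e (pos j)) ` {1..s}" unfolding embedding_def by blast
  then have "\<forall>u\<in>W0. \<exists>j\<in>{1..s}. \<phi> u = e (pos j)" by auto
  then obtain J where J: "\<And>u. u \<in> W0 \<Longrightarrow> J u \<in> {1..s}" "\<And>u. u \<in> W0 \<Longrightarrow> \<phi> u = e (pos (J u))" by metis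
  have "J u < J v" if uv: "u \<in> W0" "v \<in> W0" "u < v" for u v
  proof (rule ccontr)
    assume "\<not> J u < J v"
    then have "pos (J v) \<le> pos (J u)" unfolding pos_def by (intro mult_right_mono) auto
    then have "\<phi> v \<le> \<phi> u" using e(1) pos J uv by (auto simp: strict_mono_on_leD)
    then show False using embeddingD(1)[OF \<phi> uv] by simp
  qed
  then have J_mono: "strict_mono_on W0 J" by (rule strict_mono_onI)
  obtain g where g: "strict_mono_on W g" "\<And>u. u \<in> W0 \<Longrightarrow> g u = J u * (n + 1)"
      "\<And>u. u \<in> W \<Longrightarrow> g u < (s + 1) * (n + 1)"
    using strict_mono_on_extend_with_gaps[OF W(1,3,2) J_mono J(1)] by blast
  have g_less: "g u < N" if "u \<in> W" for u using g(3)[OF that] N by linarith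
  have "embedding c W E V (e \<circ> g)"
  proof (rule embeddingI)
    show "(e \<circ> g) u \<in> V" if "u \<in> W" for u using e(2) g_less[OF that] by auto
    show "(e \<circ> g) u < (e \<circ> g) v" if "u \<in> W" "v \<in> W" "u < v" for u v
      using strict_mono_onD[OF g(1) that] g_less that(1,2) e(1) by (simp add: strict_mono_on_def)
    show "c ((e \<circ> g) u) ((e \<circ> g) v)" if "(u, v) \<in> E" for u v
    proof -
      have "u \<in> W0" "v \<in> W0" using that E unfolding Field_def by auto
      then show ?thesis using embeddingD(3)[OF \<phi> that] by (simp add: g(2) J(2) pos_def)
    qed
  qed
  then show ?thesis unfolding copy_def by blast
qed

lemma ex_thin_subset:
  fixes V :: "'b::wellorder set"
  assumes V: "finite V" "(s + 1) * (n + 1) \<le> card V"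
  obtains V' where "V' \<subseteq> V" "card V' = s"
    "\<And>c W0 (W :: 'a::linorder set) E. finite W \<Longrightarrow> card W \<le> n \<Longrightarrow> W0 \<subseteq> W \<Longrightarrow> Field E \<subseteq> W0 \<Longrightarrow>
      copy c W0 E V' \<Longrightarrow> copy c W E V"
proof -
  obtain e where e: "bij_betw e {..<card V} V" "strict_mono_on {..<card V} e"
    using ex_bij_betw_strict_mono_card[OF V(1)] by blast
  let ?e = "\<lambda>j. e (j * (n + 1))"
  have pos: "(\<lambda>j. j * (n + 1)) ` {1..s} \<subseteq> {..<card V}"
  proof clarify
    fix j assume "j \<in> {1..s}"
    then have "j * (n + 1) < (s + 1) * (n + 1)" by (intro mult_strict_right_mono) auto
    then show "j * (n + 1) < card V" using V(2) by linarith
  qed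
  have "inj_on (e \<circ> (\<lambda>j. j * (n + 1))) {1..s}"
  proof (rule comp_inj_on)
    show "inj_on (\<lambda>j. j * (n + 1)) {1..s}" by (rule inj_onI) (simp only: mult_cancel2, simp)
    show "inj_on e ((\<lambda>j. j * (n + 1)) ` {1..s})"
      using bij_betw_imp_inj_on[OF e(1)] pos by (rule inj_on_subset)
  qed
  then have inj: "inj_on ?e {1..s}" unfolding comp_def .
  have image: "e ` {..<card V} = V" by (rule bij_betw_imp_surj_on[OF e(1)])
  show thesis
  proof
    show "?e ` {1..s} \<subseteq> V" using pos image by blast
    show "card (?e ` {1..s}) = s" by (simp only: card_image[OF inj] card_atLeastAtMost diff_Suc_1)
  qed (rule copy_from_every_nth[OF e(2) equalityD1[OF image] V(2)])
qed

lemma on_large_subsets_copy_isolated: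
  fixes V :: "'b::wellorder set" and r :: real
  assumes V: "finite V" and U: "finite U" "card U \<le> n" "Field F \<subseteq> U" and r: "1 \<le> r"
    and copies: "on_large_subsets V r (copy c (Field F) F)"
  shows "on_large_subsets V (3 * (real n + 1) * r) (copy c U F)"
  unfolding on_large_subsets_def
proof (intro allI impI)
  fix X assume X: "X \<subseteq> V" "3 * (real n + 1) * r \<le> real (card X)"
  define s where "s = nat \<lceil>r\<rceil>"
  have s: "r \<le> real s" "real s + 1 \<le> 3 * r" unfolding s_def using r by linarith+
  have "real ((s + 1) * (n + 1)) = (real s + 1) * (real n + 1)" by (simp add: algebra_simps)
  also have "\<dots> \<le> (3 * r) * (real n + 1)" using s(2) by (rule mult_right_mono) simp
  finally have "real ((s + 1) * (n + 1)) \<le> real (card X)" using X(2) by (simp only: mult_ac)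
  then have "(s + 1) * (n + 1) \<le> card X" by (simp only: of_nat_le_iff)
  then obtain X' where X': "X' \<subseteq> X" "card X' = s" "copy c (Field F) F X' \<Longrightarrow> copy c U F X"
    using ex_thin_subset[OF finite_subset[OF X(1) V], of s n] U by (metis order_refl)
  moreover have "copy c (Field F) F X'"
    using X(1) X'(1,2) s(1) by (intro on_large_subsetsD[OF copies]) auto
  ultimately show "copy c U F X" by blast
qed

lemma copy_by_halving:
  fixes V :: "'b::wellorder set" and E :: "('a::linorder \<times> 'a) set" and f :: real
  assumes c: "symp c" and V: "finite V" and n: "0 < n"
    and pair: "sparse_pair c (1 / (4 * real n)) n (6 * real n * (real n + 1) * exp f) V"
    and E: "ordered_edges E" "card (Field E) \<le> n" and f: "0 \<le> f"
    and halves: "\<And>E' :: ('a \<times> 'a) set. ordered_edges E' \<Longrightarrow> 2 * card E' \<le> card E \<Longrightarrow>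
      on_large_subsets V (exp f) (copy (- c) (Field E') E')"
  shows "copy (- c) (Field E) E V"
proof -
  have finite_Field: "finite (Field E)" by (rule ordered_edges_finite_Field[OF E(1)])
  obtain W1 W2 where W: "Field E = W1 \<union> W2" "separated W1 W2"
    "2 * card (E \<inter> W1 \<times> W1) \<le> card E" "2 * card (E \<inter> W2 \<times> W2) \<le> card E"
    by (rule split_edges[OF E(1) finite_Field])
  define s where "s = 3 * (real n + 1) * exp f"
  have half: "on_large_subsets V s (copy (- c) U (E \<inter> U \<times> U))"
    if U: "U \<subseteq> Field E" "2 * card (E \<inter> U \<times> U) \<le> card E" for U
    unfolding s_def
  proof (rule on_large_subsets_copy_isolated[OF V])
    show "finite U" by (rule finite_subset[OF U(1) finite_Field])
    show "card U \<le> n" using card_mono[OF finite_Field U(1)] E(2) by linarith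
    show "Field (E \<inter> U \<times> U) \<subseteq> U" by (auto simp: Field_def)
    show "1 \<le> exp f" using f by simp
    have "ordered_edges (E \<inter> U \<times> U)" by (rule ordered_edges_subset[OF E(1)]) blast
    then show "on_large_subsets V (exp f) (copy (- c) (Field (E \<inter> U \<times> U)) (E \<inter> U \<times> U))"
      using U(2) by (rule halves)
  qed
  let ?t = "6 * real n * (real n + 1) * exp f"
  have "0 \<le> s" "1 \<le> real n" unfolding s_def using n by auto
  then have "s \<le> real n * s" using mult_right_mono[of 1 "real n" s] by simp
  moreover have "?t = 2 * (real n * s)" unfolding s_def by simp
  ultimately have s: "real n * s \<le> ?t" "2 * s \<le> ?t" using \<open>0 \<le> s\<close> by linarith+
  have "2 * (1 / (4 * real n)) * real (card (Field E)) < 1"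
    using E(2) n by (simp add: field_simps)
  then show ?thesis
    using copy_if_halves_copied[OF c V pair n E(1) _ _ W(2) _ _ s] half[of W1] half[of W2] W finite_Field by auto
qed

section \<open>Large cliques in the absence of a copy\<close>

definition high_degree :: "('a \<times> 'a) set \<Rightarrow> real \<Rightarrow> 'a set" where
  "high_degree E D = {u. D < real (card (nbrs E u))}"

definition core_size :: "('a \<times> 'a) set \<Rightarrow> real \<Rightarrow> nat" where
  "core_size E D = 4 * card (high_degree E D) + 2"

lemma high_degree_subset_Field:
  assumes "0 \<le> D" shows "high_degree E D \<subseteq> Field E"
proof
  fix u assume "u \<in> high_degree E D"
  then have "card (nbrs E u) \<noteq> 0" using assms unfolding high_degree_def by auto
  then have "nbrs E u \<noteq> {}" by auto
  then show "u \<in> Field E" unfolding nbrs_def Field_def by auto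
qed

lemma core_size_le:
  assumes E: "finite E" and D: "0 < D"
  shows "real (core_size E D) \<le> 8 * real (card E) / D + 2"
proof -
  let ?S = "high_degree E D"
  have fin: "finite ?S"
    using high_degree_subset_Field[of D E] D finite_Field[OF E] finite_subset by fastforce
  have "real (card ?S) * D = (\<Sum>u\<in>?S. D)" by simp
  also have "\<dots> \<le> (\<Sum>u\<in>?S. real (card (nbrs E u)))" unfolding high_degree_def by (intro sum_mono) auto
  also have "\<dots> \<le> 2 * real (card E)" using sum_degrees_le[OF E fin] by (simp flip: of_nat_sum)
  finally have "real (card ?S) \<le> 2 * real (card E) / D" using D by (simp add: field_simps)
  then show ?thesis unfolding core_size_def by simp
qed

lemma one_le_power_mult_exp_ln_inverse:
  fixes \<epsilon> D :: real
  assumes "0 < \<epsilon>" "\<epsilon> \<le> 1" "real d \<le> D"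
  shows "1 \<le> \<epsilon> ^ d * exp (D * ln (1 / \<epsilon>))"
proof -
  have "\<epsilon> ^ d = exp (real d * ln \<epsilon>)" using assms(1) by (simp add: exp_of_nat_mult)
  then have "\<epsilon> ^ d * exp (D * ln (1 / \<epsilon>)) = exp ((D - real d) * ln (1 / \<epsilon>))"
    using assms(1) by (simp add: ln_div algebra_simps flip: exp_add)
  then show ?thesis using assms by simp
qed

lemma copy_or_sparse_pair_if_cliques:
  fixes \<epsilon> t h D :: real and V :: "'b::wellorder set"
  assumes c: "symp c" and V: "finite V" and E: "ordered_edges E" "card (Field E) \<le> n" and n: "0 < n"
    and D: "0 < D" and \<epsilon>: "0 < \<epsilon>" "\<epsilon> \<le> 1" and t: "1 \<le> t" and h: "0 \<le> h"
    and cliques: "on_large_subsets V (exp h) (has_clique c (core_size E D))"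
    and size: "108 * real (core_size E D) * real n * exp (3 * h + D * ln (1 / \<epsilon>)) * t \<le> real (card V)"
  shows "copy c (Field E) E V \<or> sparse_pair c \<epsilon> n t V"
proof -
  let ?S = "high_degree E D"
  define k where "k = 2 * card ?S + 1"
  have core: "core_size E D = 2 * k" unfolding core_size_def k_def by simp
  define d where "d = nat \<lfloor>D\<rfloor>"
  define x where "x = exp (D * ln (1 / \<epsilon>))"
  define M where "M = nat \<lceil>exp h\<rceil> + 1"
  define s where "s = nat \<lceil>t * x\<rceil>"
  have "1 \<le> exp h" using h by simp
  then have M: "1 < M" "exp h \<le> real M" "real M \<le> 3 * exp h" unfolding M_def by linarith+
  have "1 \<le> x" unfolding x_def using D \<epsilon> by simp
  then have "1 \<le> t * x" using t mult_mono[of 1 t 1 x] by simp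
  then have s: "t * x \<le> real s" "real s \<le> 2 * (t * x)" unfolding s_def by linarith+
  have "t \<le> t * (\<epsilon> ^ d * x)"
    using t mult_left_mono[OF one_le_power_mult_exp_ln_inverse[OF \<epsilon>, of d D], of t] D
    unfolding x_def d_def by simp
  also have "\<dots> = (t * x) * \<epsilon> ^ d" by simp
  also have "\<dots> \<le> real s * \<epsilon> ^ d" using s(1) \<epsilon> by (intro mult_right_mono) auto
  finally have t_le: "t \<le> real s * \<epsilon> ^ d" .
  have "real (M * (4 * k * M\<^sup>2 * (n * s))) = 2 * real (core_size E D) * real n * real M ^ 3 * real s"
    unfolding core by (simp add: power2_eq_square power3_eq_cube)
  also have "\<dots> \<le> 2 * real (core_size E D) * real n * (3 * exp h) ^ 3 * (2 * (t * x))"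
    using M(3) s(2) \<open>1 \<le> t * x\<close> by (intro mult_mono power_mono) auto
  also have "\<dots> = 108 * real (core_size E D) * real n * (exp h ^ 3 * x) * t"
    by (simp add: power_mult_distrib)
  also have "exp h ^ 3 * x = exp (3 * h + D * ln (1 / \<epsilon>))"
    unfolding x_def by (simp add: exp_add flip: exp_of_nat_mult)
  finally have "real (M * (4 * k * M\<^sup>2 * (n * s))) \<le> real (card V)" using size by linarith
  then have large: "M * (4 * k * M\<^sup>2 * (n * s)) \<le> card V" by (simp only: of_nat_le_iff)
  have "0 < s" using s(1) \<open>1 \<le> t * x\<close> by (cases s) auto
  obtain x Y where "fat_clique c k (n * s) V x Y"
  proof (rule ex_fat_clique[OF V large])
    show "0 < k" "0 < n * s" "1 < M" using n M(1) \<open>0 < s\<close> unfolding k_def by auto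
    show "has_clique c (2 * k) X" if "X \<subseteq> V" "card X = M" for X
      using on_large_subsetsD[OF cliques that(1)] that(2) M(2) core by simp
  qed blast
  moreover have "card (nbrs E u) \<le> d" if "u \<in> Field E - ?S" for u
    using that unfolding high_degree_def d_def by (simp add: not_less le_nat_floor)
  moreover have "?S \<subseteq> Field E" "0 < t" using high_degree_subset_Field[of D E] D t by auto
  ultimately show ?thesis
    using copy_or_sparse_pair_if_fat_clique[OF c E(1) ordered_edges_finite_Field[OF E(1)] order_refl E(2)
        _ _ \<epsilon> _ t_le V] unfolding k_def by blast
qed

text \<open>All sizes are measured by their logarithms: \<open>h\<close>, \<open>g\<close> and \<open>f\<close> are the exponents from which on
  a vertex set contains a core in colour \<open>c\<close>, a clique of size \<open>k\<close> and a clique of size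
  \<open>2 * k - \<rho>\<close> in the other colour, and \<open>p\<close> is the cost of the pigeonhole argument.\<close>

lemma clique_growth_step:
  fixes h D \<epsilon> p g f :: real and V :: "'b::wellorder set"
  assumes c: "symp c" and V: "finite V" and E: "ordered_edges E" "card (Field E) \<le> n" and n: "0 < n"
    and no_copy: "\<not> copy c (Field E) E V"
    and D: "0 < D" and \<epsilon>: "0 < \<epsilon>" "\<epsilon> \<le> 1" and nonneg: "0 \<le> h" "0 \<le> p" "0 \<le> g"
    and cores: "on_large_subsets V (exp h) (has_clique c (core_size E D))"
    and cliques: "on_large_subsets V (exp g) (has_clique (- c) k)"
    and \<rho>: "2 * \<epsilon> * real k < real \<rho> + 1" "real (\<Sum>i\<le>\<rho>. k choose i) \<le> exp p"
    and f: "ln (216 * real (core_size E D) * real n ^ 2) + 3 * h + D * ln (1 / \<epsilon>) + p + g \<le> f"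
  shows "on_large_subsets V (exp f) (has_clique (- c) (2 * k - \<rho>))"
  unfolding on_large_subsets_def
proof (intro allI impI)
  fix X assume X: "X \<subseteq> V" "exp f \<le> real (card X)"
  let ?q = "real (core_size E D)"
  define t where "t = 2 * real n * exp (p + g)"
  have finite_X: "finite X" using X(1) V by (rule finite_subset)
  have pg: "1 \<le> exp (p + g)" "exp g \<le> exp (p + g)" using nonneg by auto
  have n1: "1 \<le> real n" using n by simp
  have "1 * 1 \<le> real n * exp (p + g)" using n1 pg(1) by (intro mult_mono) auto
  then have t1: "1 \<le> t" unfolding t_def by simp
  have "108 * ?q * real n * exp (3 * h + D * ln (1 / \<epsilon>)) * t
      = (216 * ?q * real n ^ 2) * exp (3 * h + D * ln (1 / \<epsilon>) + p + g)"
    unfolding t_def by (simp add: exp_add power2_eq_square)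
  also have "216 * ?q * real n ^ 2 = exp (ln (216 * ?q * real n ^ 2))"
    using n by (simp add: core_size_def)
  also have "exp (ln (216 * ?q * real n ^ 2)) * exp (3 * h + D * ln (1 / \<epsilon>) + p + g) \<le> exp f"
    using f by (simp flip: exp_add)
  finally have size: "108 * ?q * real n * exp (3 * h + D * ln (1 / \<epsilon>)) * t \<le> real (card X)"
    using X(2) by linarith
  have "copy c (Field E) E X \<or> sparse_pair c \<epsilon> n t X"
    by (rule copy_or_sparse_pair_if_cliques[OF c finite_X E n D \<epsilon> t1 nonneg(1) _ size])
      (rule on_large_subsets_mono[OF cores X(1) order_refl])
  then have pair: "sparse_pair c \<epsilon> n t X" using no_copy copy_mono X(1) by blast
  show "has_clique (- c) (2 * k - \<rho>) X"
  proof (rule clique_doubling[OF c finite_X pair n _ \<rho>])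
    show "on_large_subsets X (exp g) (has_clique (- c) k)"
      by (rule on_large_subsets_mono[OF cliques X(1) order_refl])
    have "real n * exp g \<le> real n * exp (p + g)" using pg(2) by (rule mult_left_mono) simp
    moreover have "0 \<le> real n * exp (p + g)" by simp
    ultimately show "real n * exp g \<le> t" unfolding t_def mult.assoc by linarith
    have "1 * exp (p + g) \<le> real n * exp (p + g)" using n1 by (rule mult_right_mono) simp
    then show "2 * exp p * exp g \<le> t" unfolding t_def by (simp add: exp_add)
  qed
qed

definition clique_exponent :: "real \<Rightarrow> nat \<Rightarrow> real" where
  "clique_exponent A k = 360 * (real k + sqrt (real k) * A)"

lemma clique_exponent_nonneg: "0 \<le> A \<Longrightarrow> 0 \<le> clique_exponent A k"
  unfolding clique_exponent_def by simp

lemma clique_exponent_two_thirds: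
  assumes "2 \<le> k" "0 \<le> A"
  shows "clique_exponent A (k - (k + 1) div 3) \<le> 11/12 * clique_exponent A k"
proof -
  let ?k' = "k - (k + 1) div 3"
  have k': "real ?k' \<le> 5/6 * real k"
  proof -
    have "k \<le> 3 * ((k + 1) div 3) + 1" by linarith
    then show ?thesis using assms(1) by linarith
  qed
  then have "sqrt (real ?k') \<le> sqrt (121/144 * real k)" by (intro real_sqrt_le_mono) auto
  also have "\<dots> = 11/12 * sqrt (real k)" by (simp add: real_sqrt_mult real_sqrt_divide)
  finally have "sqrt (real ?k') * A \<le> 11/12 * sqrt (real k) * A"
    using assms(2) by (intro mult_right_mono) auto
  then show ?thesis using k' unfolding clique_exponent_def by simp
qed

lemma binomial_le_exp:
  assumes "0 < k" "k \<le> n"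
  shows "real (n choose k) \<le> exp (real k * (1 + ln (real n / real k)))"
proof -
  define x where "x = real k / real n"
  have n0: "0 < real n" "0 < real k" using assms by auto
  have x0: "0 < x" unfolding x_def using n0 by simp
  have "real (n choose k) * x ^ k \<le> (\<Sum>i\<le>n. real (n choose i) * x ^ i)"
    using assms x0 by (intro member_le_sum) auto
  also have "\<dots> = (x + 1) ^ n" using binomial_ring[of x 1 n] by simp
  also have "\<dots> \<le> exp x ^ n"
    using x0 exp_ge_add_one_self[of x] by (intro power_mono) (auto simp: add.commute)
  also have "\<dots> = exp (real k)" unfolding x_def using n0 by (simp flip: exp_of_nat_mult)
  finally have "real (n choose k) \<le> exp (real k) * (real n / real k) ^ k"
    unfolding x_def using n0 by (simp add: field_simps)
  also have "(real n / real k) ^ k = exp (real k * ln (real n / real k))"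
    using n0 by (simp add: exp_of_nat_mult)
  finally show ?thesis by (simp add: algebra_simps flip: exp_add)
qed

lemma ln_le_if_le_two_power:
  fixes x :: real
  assumes "0 < x" "x \<le> 2 ^ n" shows "ln x \<le> real n"
proof -
  have "ln x \<le> ln (2 ^ n)" using assms by (intro ln_mono) auto
  also have "\<dots> = real n * ln 2" by (rule ln_realpow)
  also have "\<dots> \<le> real n * 1" using ln_2_less_1 by (intro mult_left_mono) auto
  finally show ?thesis by simp
qed

lemma binomial_core_le:
  fixes A :: real
  assumes k: "2 \<le> k" and A: "0 \<le> A" and q: "real q \<le> 8 * A ^ 3 / sqrt (real k) + 2"
  shows "real (q + k choose q) \<le> exp (5 * (real k + sqrt (real k) * A))"
proof -
  define z where "z = A / sqrt (real k)"
  have z: "0 \<le> z" "real k * z = sqrt (real k) * A" "real k * z ^ 3 = A ^ 3 / sqrt (real k)"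
    unfolding z_def using A k by (auto simp: power_divide power3_eq_cube field_simps)
  have "real (q + k) \<le> real k * (8 * (1 + z) ^ 3)"
  proof -
    have "real (q + k) \<le> 8 * (real k * z ^ 3) + 2 * real k" using q k z(3) by simp
    also have "\<dots> \<le> real k * (8 * (1 + z ^ 3))" by (simp add: algebra_simps)
    also have "\<dots> \<le> real k * (8 * (1 + z) ^ 3)"
      using z(1) by (intro mult_left_mono) (simp_all add: power3_eq_cube algebra_simps)
    finally show ?thesis .
  qed
  then have ratio: "real (q + k) / real k \<le> 8 * (1 + z) ^ 3" using k by (simp add: field_simps)
  have "ln (real (q + k) / real k) \<le> ln (8 * (1 + z) ^ 3)" using ratio k by (intro ln_mono) auto
  also have "\<dots> = ln 8 + 3 * ln (1 + z)" using z(1) by (simp add: ln_mult ln_realpow)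
  also have "\<dots> \<le> 3 + 3 * z"
    using ln_add_one_self_le_self[OF z(1)] ln_le_if_le_two_power[of 8 3] by simp
  finally have "real k * (1 + ln (real (q + k) / real k)) \<le> real k * (4 + 3 * z)"
    by (intro mult_left_mono) auto
  also have "\<dots> = 4 * real k + 3 * (sqrt (real k) * A)"
    unfolding z(2)[symmetric] by (simp add: algebra_simps)
  also have "\<dots> \<le> 5 * (real k + sqrt (real k) * A)" using A by simp
  finally have exponent: "real k * (1 + ln (real (q + k) / real k)) \<le> 5 * (real k + sqrt (real k) * A)" .
  have "real (q + k choose q) = real (q + k choose k)"
    by (simp add: binomial_symmetric[of q "q + k"])
  also have "\<dots> \<le> exp (real k * (1 + ln (real (q + k) / real k)))"
    using k by (intro binomial_le_exp) auto
  also have "\<dots> \<le> exp (5 * (real k + sqrt (real k) * A))"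
    using exponent by (simp only: exp_le_cancel_iff)
  finally show ?thesis .
qed

lemma ln_core_factor_le:
  fixes A :: real
  assumes A: "1 \<le> A" and k: "1 \<le> real k" and q: "0 < q" "real q \<le> 8 * A ^ 3 / sqrt (real k) + 2"
  shows "ln (216 * real q * (2 * A ^ 4) ^ 2) \<le> 14 + 11 * A"
proof -
  have "8 * A ^ 3 / sqrt (real k) \<le> 8 * A ^ 3 / 1" using A k by (intro divide_left_mono) auto
  then have "real q \<le> 10 * A ^ 3" using q(2) one_le_power[OF A, of 3] by linarith
  then have "216 * real q * (2 * A ^ 4) ^ 2 \<le> 216 * (10 * A ^ 3) * (2 * A ^ 4) ^ 2"
    by (intro mult_right_mono mult_left_mono) auto
  also have "\<dots> = 8640 * A ^ 11" by (simp add: eval_nat_numeral)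
  finally have "ln (216 * real q * (2 * A ^ 4) ^ 2) \<le> ln (8640 * A ^ 11)"
    using A q(1) by (intro ln_mono) auto
  also have "\<dots> = ln 8640 + 11 * ln A" using A by (simp add: ln_mult ln_realpow)
  also have "\<dots> \<le> 14 + 11 * A" using ln_le_if_le_two_power[of 8640 14] ln_bound[of A] A by simp
  finally show ?thesis .
qed

lemma clique_exponent_step:
  fixes A :: real
  assumes k: "2 \<le> k" and A: "1 \<le> A" and q: "0 < q" "real q \<le> 8 * A ^ 3 / sqrt (real k) + 2"
  shows "ln (216 * real q * (2 * A ^ 4) ^ 2) + 3 * (5 * (real k + sqrt (real k) * A)) + sqrt (real k) * A * ln 8
    + real k + clique_exponent A (k - (k + 1) div 3) \<le> clique_exponent A k"
proof -
  define w where "w = sqrt (real k) * A"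
  have w: "A \<le> w" unfolding w_def using k A mult_right_mono[of 1 "sqrt (real k)" A] by simp
  have "ln (216 * real q * (2 * A ^ 4) ^ 2) \<le> 14 + 11 * A"
    using ln_core_factor_le[OF A _ q] k by simp
  moreover have "w * ln 8 \<le> w * 3"
    using w A ln_le_if_le_two_power[of 8 3] by (intro mult_left_mono) auto
  moreover have "clique_exponent A (k - (k + 1) div 3) \<le> 11/12 * clique_exponent A k"
    using A by (intro clique_exponent_two_thirds[OF k]) simp
  moreover have "clique_exponent A k = 360 * (real k + w)" unfolding clique_exponent_def w_def ..
  moreover have "2 \<le> real k" using k by simp
  ultimately show ?thesis using w A unfolding w_def[symmetric] by argo
qed

lemma on_large_subsets_has_core:
  assumes c: "symp c" and V: "finite V" and no_clique: "\<not> has_clique (- c) k V"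
    and k: "2 \<le> k" and A: "0 \<le> A" and q: "real q \<le> 8 * A ^ 3 / sqrt (real k) + 2"
  shows "on_large_subsets V (exp (5 * (real k + sqrt (real k) * A))) (has_clique c q)"
  unfolding on_large_subsets_def
proof (intro allI impI)
  fix X assume X: "X \<subseteq> V" "exp (5 * (real k + sqrt (real k) * A)) \<le> real (card X)"
  have "q + k choose q \<le> card X" using binomial_core_le[OF k A q] X(2) by simp
  then show "has_clique c q X"
    using erdos_szekeres_clique[OF c finite_subset[OF X(1) V]] no_clique has_clique_mono X(1)
    by blast
qed

lemma edge_count_eq_root_power:
  assumes "ordered_edges E" "E \<noteq> {}"
  shows "1 \<le> root 4 (real (card E))" "real (card E) = root 4 (real (card E)) ^ 4" "0 < card E"
  using assms by (auto simp: ordered_edges_def Suc_le_eq card_gt_0_iff real_root_pow_pos2)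

lemma card_Field_le_edges: "ordered_edges E \<Longrightarrow> card (Field E) \<le> 2 * card E"
  unfolding ordered_edges_def by (blast intro: card_Field_le)

lemma two_thirds_doubling:
  fixes k :: nat
  assumes "2 \<le> k" shows "k - (k + 1) div 3 < k" "k \<le> 2 * (k - (k + 1) div 3) - (k - (k + 1) div 3) div 4"
proof -
  define k' where "k' = k - (k + 1) div 3"
  have "3 * ((k + 1) div 3) \<le> k + 1" "4 * (k' div 4) \<le> k'" "1 \<le> (k + 1) div 3"
    using assms by linarith+
  moreover have "k = 2 \<or> k = 3 \<or> 4 \<le> k" using assms by linarith
  ultimately show "k - (k + 1) div 3 < k" "k \<le> 2 * (k - (k + 1) div 3) - (k - (k + 1) div 3) div 4"
    unfolding k'_def by (elim disjE; simp)+
qed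

lemma sum_binomial_le_exp:
  assumes "\<rho> \<le> k" shows "real (\<Sum>i\<le>\<rho>. k choose i) \<le> exp (real k)"
proof -
  have "(\<Sum>i\<le>\<rho>. k choose i) \<le> 2 ^ k"
    unfolding choose_row_sum[symmetric] using assms by (intro sum_mono2) auto
  then have "real (\<Sum>i\<le>\<rho>. k choose i) \<le> real (2 ^ k)" by (simp only: of_nat_le_iff)
  also have "\<dots> \<le> exp 1 ^ k" using exp_ge_add_one_self[of 1] by (simp add: power_mono)
  also have "\<dots> = exp (real k)" by (simp flip: exp_of_nat_mult)
  finally show ?thesis .
qed

text \<open>If there were no clique of size \<open>k\<close> in colour \<open>- c\<close>, then the Erdos-Szekeres bound would
  provide cores in colour \<open>c\<close>, with which cliques of about \<open>2/3\<close> of the size can be enlarged to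
  size \<open>k\<close>.\<close>

lemma has_clique_from_two_thirds:
  fixes V :: "'b::wellorder set"
  assumes c: "symp c" and V: "finite V" and E: "ordered_edges E" "E \<noteq> {}"
    and no_copy: "\<not> copy c (Field E) E V"
    and A: "A = root 4 (real (card E))" and k: "2 \<le> k" and k': "k' = k - (k + 1) div 3"
    and cliques: "on_large_subsets V (exp (clique_exponent A k')) (has_clique (- c) k')"
    and size: "exp (clique_exponent A k) \<le> real (card V)"
  shows "has_clique (- c) k V"
proof (rule ccontr)
  assume no_clique: "\<not> has_clique (- c) k V"
  have A1: "1 \<le> A" and A4: "real (card E) = A ^ 4"
    unfolding A by (rule edge_count_eq_root_power[OF E])+
  define w where "w = sqrt (real k) * A"
  have w: "0 < w" unfolding w_def using k A1 by simp
  let ?q = "core_size E w"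
  have "real ?q \<le> 8 * A ^ 4 / w + 2"
    using core_size_le[of E w] E(1) w A4 unfolding ordered_edges_def by simp
  also have "8 * A ^ 4 / w = 8 * A ^ 3 / sqrt (real k)"
    unfolding w_def using A1 k by (simp add: field_simps eval_nat_numeral)
  finally have q: "real ?q \<le> 8 * A ^ 3 / sqrt (real k) + 2" .
  have "on_large_subsets V (exp (clique_exponent A k)) (has_clique (- c) (2 * k' - k' div 4))"
  proof (rule clique_growth_step[OF c V E(1) card_Field_le_edges[OF E(1)] _ no_copy w _ _ _ _ _ _ cliques])
    show "on_large_subsets V (exp (5 * (real k + w))) (has_clique c ?q)"
      unfolding w_def
      by (rule on_large_subsets_has_core[OF c V no_clique k _ q[unfolded w_def]]) (use A1 in simp)
    show "2 * (1/8) * real k' < real (k' div 4) + 1" by linarith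
    have "real (\<Sum>i\<le>k' div 4. k' choose i) \<le> exp (real k')" by (rule sum_binomial_le_exp) simp
    also have "\<dots> \<le> exp (real k)" using k' by simp
    finally show "real (\<Sum>i\<le>k' div 4. k' choose i) \<le> exp (real k)" .
    show "ln (216 * real ?q * real (2 * card E) ^ 2) + 3 * (5 * (real k + w)) + w * ln (1 / (1/8)) + real k
        + clique_exponent A k' \<le> clique_exponent A k"
      using clique_exponent_step[OF k A1 _ q] A4 unfolding w_def k' by (simp add: core_size_def)
  qed (use w A1 edge_count_eq_root_power(3)[OF E] clique_exponent_nonneg in auto)
  then have "has_clique (- c) (2 * k' - k' div 4) V"
    by (rule on_large_subsetsD[OF _ order_refl size])
  moreover have "k \<le> 2 * k' - k' div 4" unfolding k' by (rule two_thirds_doubling(2)[OF k])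
  ultimately show False using no_clique has_clique_le by blast
qed

lemma on_large_subsets_has_clique_if_no_copy:
  fixes V :: "'b::wellorder set"
  assumes c: "symp c" and V: "finite V" and E: "ordered_edges E" "E \<noteq> {}"
    and no_copy: "\<not> copy c (Field E) E V"
  shows "on_large_subsets V (exp (clique_exponent (root 4 (real (card E))) k)) (has_clique (- c) k)"
proof (induction k rule: less_induct)
  case (less k)
  show ?case
    unfolding on_large_subsets_def
  proof (intro allI impI)
    fix X assume X: "X \<subseteq> V" "exp (clique_exponent (root 4 (real (card E))) k) \<le> real (card X)"
    show "has_clique (- c) k X"
    proof (cases "2 \<le> k")
      case False
      have "0 < real (card X)" using X(2) by (rule less_le_trans[OF exp_gt_zero])
      then show ?thesis using False by (intro has_clique_at_most_1) auto
    next
      case True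
      have "\<not> copy c (Field E) E X" using no_copy copy_mono X(1) by blast
      then show ?thesis
      proof (rule has_clique_from_two_thirds[OF c finite_subset[OF X(1) V] E _ refl True refl _ X(2)])
        show "on_large_subsets X (exp (clique_exponent (root 4 (real (card E))) (k - (k + 1) div 3)))
            (has_clique (- c) (k - (k + 1) div 3))"
          by (rule on_large_subsets_mono[OF less.IH[OF two_thirds_doubling(1)[OF True]] X(1) order_refl])
      qed
    qed
  qed
qed

section \<open>Growing a clique\<close>

lemma sum_binomial_le: "(\<Sum>i\<le>\<rho>. k choose i) \<le> (k + 1) ^ \<rho>"
proof -
  have "(\<Sum>i\<le>\<rho>. k choose i) \<le> (\<Sum>i\<le>\<rho>. (\<rho> choose i) * k ^ i)"
  proof (rule sum_mono)
    fix i assume "i \<in> {..\<rho>}"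
    then have "1 \<le> (\<rho> choose i)" by (simp add: Suc_le_eq)
    moreover have "k choose i \<le> k ^ i"
      using binomial_le_pow[of i k] by (cases "i \<le> k") (simp_all add: binomial_eq_0)
    ultimately have "1 * (k choose i) \<le> (\<rho> choose i) * k ^ i" by (rule mult_le_mono)
    then show "k choose i \<le> (\<rho> choose i) * k ^ i" by simp
  qed
  also have "\<dots> = (k + 1) ^ \<rho>" using binomial[of k 1 \<rho>] by simp
  finally show ?thesis .
qed

locale copy_free_colouring =
  fixes c :: "'b::wellorder \<Rightarrow> 'b \<Rightarrow> bool" and V :: "'b set" and E1 E2 :: "('a::linorder \<times> 'a) set"
  assumes symp: "symp c" and finite_V: "finite V"
    and E1: "ordered_edges E1" "E1 \<noteq> {}" "\<not> copy (- c) (Field E1) E1 V"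
    and E2: "ordered_edges E2" "E2 \<noteq> {}" "\<not> copy c (Field E2) E2 V"
begin

lemma clique_growth:
  fixes D \<epsilon> g Y :: real
  assumes D: "0 < D" and \<epsilon>: "0 < \<epsilon>" "\<epsilon> \<le> 1/4" and g: "0 \<le> g"
    and cliques: "on_large_subsets V (exp g) (has_clique (- c) k)" and j: "2 * j \<le> 3 * k + 1"
    and Y: "ln (216 * real (core_size E2 D) * real (2 * card E2) ^ 2)
      + 3 * clique_exponent (root 4 (real (card E1))) (core_size E2 D) + D * ln (1 / \<epsilon>)
      + 2 * \<epsilon> * real k * ln (real k + 1) \<le> Y"
  shows "on_large_subsets V (exp (g + Y)) (has_clique (- c) j)"
proof -
  define \<rho> where "\<rho> = nat \<lfloor>2 * \<epsilon> * real k\<rfloor>"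
  have "0 \<le> 2 * \<epsilon> * real k" using \<epsilon> by simp
  then have \<rho>: "real \<rho> \<le> 2 * \<epsilon> * real k" "2 * \<epsilon> * real k < real \<rho> + 1" unfolding \<rho>_def by linarith+
  have "on_large_subsets V (exp (g + Y)) (has_clique (- c) (2 * k - \<rho>))"
  proof (rule clique_growth_step[OF symp finite_V E2(1) _ _ E2(3) D \<epsilon>(1) _ _ _ g _ cliques \<rho>(2)])
    show "card (Field E2) \<le> 2 * card E2" by (rule card_Field_le_edges[OF E2(1)])
    show "0 < 2 * card E2" using edge_count_eq_root_power(3)[OF E2(1,2)] by simp
    show "on_large_subsets V (exp (clique_exponent (root 4 (real (card E1))) (core_size E2 D))) (has_clique c (core_size E2 D))"
      using on_large_subsets_has_clique_if_no_copy[OF symp_Compl[OF symp] finite_V E1] by simp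
    have "real (\<Sum>i\<le>\<rho>. k choose i) \<le> real ((k + 1) ^ \<rho>)"
      using sum_binomial_le by (simp only: of_nat_le_iff)
    also have "\<dots> = exp (real \<rho> * ln (real k + 1))" by (simp add: exp_of_nat_mult add.commute)
    also have "\<dots> \<le> exp (2 * \<epsilon> * real k * ln (real k + 1))"
      using \<rho>(1) mult_right_mono[of "real \<rho>"] by simp
    finally show "real (\<Sum>i\<le>\<rho>. k choose i) \<le> exp (2 * \<epsilon> * real k * ln (real k + 1))" .
  qed (use \<epsilon> Y clique_exponent_nonneg in auto)
  moreover have "j \<le> 2 * k - \<rho>"
  proof -
    have "2 * \<epsilon> * real k \<le> 1/2 * real k" using \<epsilon> by (intro mult_right_mono) auto
    then have "2 * \<rho> \<le> k" using \<rho>(1) by linarith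
    then show ?thesis using j by linarith
  qed
  ultimately show ?thesis
    using has_clique_le by (elim on_large_subsets_mono[OF _ order_refl order_refl]) blast
qed

lemma clique_growth_iterate:
  fixes D \<epsilon> g Y \<kappa> :: real
  assumes D: "0 < D" and \<epsilon>: "0 < \<epsilon>" "\<epsilon> \<le> 1/4" and g: "0 \<le> g" and \<kappa>: "0 < \<kappa>"
    and cliques: "on_large_subsets V (exp g) (has_clique (- c) (nat \<lceil>\<kappa>\<rceil>))" and Y: "0 \<le> Y"
      "\<And>k. k \<le> T \<Longrightarrow> ln (216 * real (core_size E2 D) * real (2 * card E2) ^ 2)
      + 3 * clique_exponent (root 4 (real (card E1))) (core_size E2 D) + D * ln (1 / \<epsilon>)
      + 2 * \<epsilon> * real k * ln (real k + 1) \<le> Y"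
  shows "on_large_subsets V (exp (g + real j * Y)) (has_clique (- c) (min T (nat \<lceil>\<kappa> * (3/2) ^ j\<rceil>)))"
proof (induction j)
  case 0
  show ?case
  proof (rule on_large_subsets_mono[OF cliques])
    show "has_clique (- c) (min T (nat \<lceil>\<kappa> * (3/2) ^ 0\<rceil>)) X" if "has_clique (- c) (nat \<lceil>\<kappa>\<rceil>) X" for X
      by (rule has_clique_le[OF that]) simp
  qed auto
next
  case (Suc j)
  define k where "k = min T (nat \<lceil>\<kappa> * (3/2) ^ j\<rceil>)"
  define i where "i = min T (nat \<lceil>\<kappa> * (3/2) ^ Suc j\<rceil>)"
  have "2 * i \<le> 3 * k + 1"
  proof (cases "k = T")
    case True
    then show ?thesis unfolding i_def by simp
  next
    case False
    then have "\<kappa> * (3/2) ^ j \<le> real k"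
      unfolding k_def by (simp add: min_def split: if_splits) linarith
    moreover have "0 \<le> \<kappa> * (3/2) ^ Suc j" using \<kappa> by simp
    then have "real (nat \<lceil>\<kappa> * (3/2) ^ Suc j\<rceil>) < \<kappa> * (3/2) ^ Suc j + 1" by linarith
    then have "real i < \<kappa> * (3/2) ^ Suc j + 1" unfolding i_def by linarith
    moreover have "\<kappa> * (3/2) ^ Suc j = 3/2 * (\<kappa> * (3/2) ^ j)" by simp
    ultimately show ?thesis by linarith
  qed
  moreover have "0 \<le> g + real j * Y" using g Y(1) by simp
  moreover have "k \<le> T" unfolding k_def by simp
  ultimately have "on_large_subsets V (exp (g + real j * Y + Y)) (has_clique (- c) i)"
    using clique_growth[OF D \<epsilon> _ _ _ Y(2)] Suc.IH unfolding k_def by blast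
  moreover have "g + real j * Y + Y = g + real (Suc j) * Y" by (simp add: algebra_simps)
  ultimately show ?case unfolding i_def by metis
qed

end

section \<open>Halving the smaller graph\<close>

lemma four_power4_le_exp:
  fixes x :: real
  assumes "10000 \<le> x" shows "4 * x ^ 4 \<le> exp x"
proof -
  have "10000\<^sup>2 \<le> x\<^sup>2" using assms by (intro power_mono) auto
  then have "10000\<^sup>2 * x ^ 4 \<le> x\<^sup>2 * x ^ 4" by (rule mult_right_mono) simp
  also have "\<dots> = 6 ^ 6 * (x / 6) ^ 6" by (simp add: power_divide flip: power_add)
  also have "(x / 6) ^ 6 \<le> (1 + x / real 6) ^ 6" using assms by (intro power_mono) auto
  also have "(1 + x / real 6) ^ 6 \<le> exp x"
    using assms by (intro exp_ge_one_plus_x_over_n_power_n) auto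
  finally have "100000000 * x ^ 4 \<le> 46656 * exp x" by simp
  moreover have "0 \<le> x ^ 4" by simp
  ultimately show ?thesis by linarith
qed

text \<open>Here \<open>A\<close> and \<open>B\<close> are the fourth roots of the numbers of edges of the two graphs, and \<open>L\<close> is
  the logarithm of the total number of edges. The clique is grown to the size needed for placing
  the vertices of the first graph whose degree exceeds \<open>G / L\<close>; the vertices of the second graph
  of degree more than \<open>8 * B\<^sup>2 / r\<close> are placed in cliques of the other colour, which balances their
  number against the cost \<open>(B\<^sup>2 / r) * ln L\<close> of the greedy embedding.\<close>

locale balanced_sizes =
  fixes A B L G r :: real
  assumes B_ge_1: "1 \<le> B" and B_le_A: "B \<le> A" and A_le: "A \<le> B * L" and L_ge: "10000 \<le> L"
    and exp_L: "exp L = A ^ 4 + B ^ 4" and G: "G = A * B" and r: "r = sqrt (ln L)"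
begin

lemma A_ge_1: "1 \<le> A"
  using B_ge_1 B_le_A by simp

lemma G_ge_1: "1 \<le> G"
  unfolding G using A_ge_1 B_ge_1 mult_mono[of 1 A 1 B] by simp

lemma B_le_G: "B \<le> G"
  unfolding G using A_ge_1 B_ge_1 mult_right_mono[of 1 A B] by simp

lemma B_square_le_G: "B\<^sup>2 \<le> G"
  unfolding G power2_eq_square using B_le_A B_ge_1 by (intro mult_right_mono) auto

lemma ln_L_ge_8: "8 \<le> ln L"
proof -
  have "exp (8::real) = exp 1 ^ 8" by (simp flip: exp_of_nat_mult)
  also have "\<dots> \<le> 3 ^ 8" using exp_le by (intro power_mono) auto
  finally have "exp 8 \<le> L" using L_ge by simp
  then show ?thesis using L_ge by (subst ln_ge_iff) auto
qed

lemma r_square: "r\<^sup>2 = ln L"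
  unfolding r using ln_L_ge_8 by simp

lemma r_ge_2: "2 \<le> r"
  unfolding r using ln_L_ge_8 by (intro real_le_rsqrt) simp

lemma G_le_G_r: "2 * G \<le> G * r"
  using r_ge_2 G_ge_1 mult_left_mono[of 2 r G] by (simp add: mult.commute)

lemma G_le_G_r_cubed: "8 * G \<le> G * r ^ 3"
  using power_mono[OF r_ge_2, of 3] G_ge_1 mult_left_mono[of 8 "r ^ 3" G]
  by (simp add: mult.commute)

lemma L_le_G: "L \<le> G"
proof -
  have "B ^ 4 \<le> A ^ 4" using B_le_A B_ge_1 by (intro power_mono) auto
  then have "4 * L ^ 4 \<le> 2 * A ^ 4" using four_power4_le_exp[OF L_ge] exp_L by linarith
  moreover have "0 \<le> A ^ 4" by simp
  ultimately have "L ^ 4 \<le> A ^ 4" by linarith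
  then have "L \<le> A"
    using A_ge_1 by (intro power_le_imp_le_base[of L 3]) (simp_all add: eval_nat_numeral)
  also have "A \<le> G" unfolding G using A_ge_1 B_ge_1 mult_left_mono[of 1 B A] by simp
  finally show ?thesis .
qed

lemma G_le_exp_half_L: "G \<le> exp (L / 2)"
proof -
  have "G \<le> A\<^sup>2" unfolding G power2_eq_square using B_le_A A_ge_1 by (intro mult_left_mono) auto
  moreover have "(A\<^sup>2)\<^sup>2 \<le> (exp (L / 2))\<^sup>2"
    using exp_L B_ge_1 by (simp flip: power_mult exp_of_nat_mult)
  then have "A\<^sup>2 \<le> exp (L / 2)" by (rule power2_le_imp_le) simp
  ultimately show ?thesis by linarith
qed

lemma small_core_le:
  assumes "x \<le> 8 * B ^ 4 / (8 * B\<^sup>2 / r) + 2" shows "x \<le> 2 * (B\<^sup>2 * r)"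
proof -
  have "8 * B ^ 4 / (8 * B\<^sup>2 / r) = B\<^sup>2 * r"
    using B_ge_1 r_ge_2 by (simp add: field_simps eval_nat_numeral)
  moreover have "1 * 2 \<le> B\<^sup>2 * r" using B_ge_1 r_ge_2 by (intro mult_mono) auto
  ultimately show ?thesis using assms by linarith
qed

lemma large_core_le:
  assumes "x \<le> 8 * A ^ 4 / (G / L) + 2" shows "x \<le> 9 * (G * L ^ 3)"
proof -
  have "A\<^sup>2 \<le> (B * L)\<^sup>2" using A_le A_ge_1 by (intro power_mono) auto
  then have "A\<^sup>2 * A\<^sup>2 * L \<le> A\<^sup>2 * (B * L)\<^sup>2 * L"
    using L_ge by (intro mult_right_mono mult_left_mono) auto
  also have "\<dots> = G * L ^ 3 * G" unfolding G by (simp add: eval_nat_numeral)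
  finally have "8 * A ^ 4 / (G / L) \<le> 8 * (G * L ^ 3)"
    using G_ge_1 by (simp add: divide_le_eq flip: power_add)
  moreover have "1 * 2 \<le> G * L ^ 3"
    using G_ge_1 L_ge power_increasing[of 1 3 L] by (intro mult_mono) auto
  ultimately show ?thesis using assms by linarith
qed

lemma B_square_r_le: "B\<^sup>2 * r \<le> G * r"
  using B_square_le_G r_ge_2 by (intro mult_right_mono) auto

lemma clique_exponent_small_core_le:
  assumes "real q \<le> 2 * (B\<^sup>2 * r)" shows "clique_exponent A q \<le> 1080 * (G * r)"
proof -
  have "2 * (B\<^sup>2 * r) \<le> r * (B\<^sup>2 * r)" using r_ge_2 by (intro mult_right_mono) auto
  then have "real q \<le> (B * r)\<^sup>2" using assms by (simp add: power2_eq_square mult_ac)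
  then have "sqrt (real q) \<le> B * r" using B_ge_1 r_ge_2 by (intro real_le_lsqrt) auto
  then have "sqrt (real q) * A \<le> (B * r) * A" using A_ge_1 by (intro mult_right_mono) auto
  also have "(B * r) * A = G * r" unfolding G by simp
  finally have "real q + sqrt (real q) * A \<le> 3 * (G * r)" using assms B_square_r_le by linarith
  then show ?thesis unfolding clique_exponent_def by simp
qed

lemma ln_small_core_factor_le:
  assumes q: "0 < q" "real q \<le> 2 * (B\<^sup>2 * r)" shows "ln (216 * real q * (2 * B ^ 4)\<^sup>2) \<le> 20 * (G * r)"
proof -
  have "216 * real q * (2 * B ^ 4)\<^sup>2 \<le> 216 * (2 * (B\<^sup>2 * r)) * (2 * B ^ 4)\<^sup>2"
    using q(2) by (intro mult_right_mono mult_left_mono) auto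
  also have "\<dots> = 1728 * B ^ 10 * r" by (simp add: eval_nat_numeral)
  finally have "ln (216 * real q * (2 * B ^ 4)\<^sup>2) \<le> ln (1728 * B ^ 10 * r)"
    using q(1) B_ge_1 by (intro ln_mono) auto
  also have "\<dots> = ln 1728 + 10 * ln B + ln r" using B_ge_1 r_ge_2 by (simp add: ln_mult ln_realpow)
  also have "\<dots> \<le> 11 + 10 * B + r"
    using ln_le_if_le_two_power[of 1728 11] ln_bound[of B] ln_bound[of r] B_ge_1 r_ge_2 by simp
  also have "\<dots> \<le> 20 * (G * r)"
    using B_le_G G_le_G_r G_ge_1 r_ge_2 mult_right_mono[of 1 G r] by linarith
  finally show ?thesis .
qed

lemma Suc_le_exp_if_large_core:
  assumes "x \<le> 9 * (G * L ^ 3)" shows "x + 1 \<le> exp (3 * L / 2)"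
proof -
  have "L ^ 3 \<ge> 1" using L_ge by (intro one_le_power) simp
  then have "1 * 1 \<le> G * L ^ 3" using G_ge_1 by (intro mult_mono) auto
  then have "x + 1 \<le> G * (10 * L ^ 3)" using assms by linarith
  also have "\<dots> \<le> exp (L / 2) * exp L"
  proof (rule mult_mono[OF G_le_exp_half_L])
    have "10 * L ^ 3 \<le> L * L ^ 3" using L_ge by (intro mult_right_mono) auto
    also have "\<dots> = 1 * L ^ 4" by (simp add: eval_nat_numeral)
    also have "\<dots> \<le> 4 * L ^ 4" by (intro mult_right_mono) auto
    also have "\<dots> \<le> exp L" by (rule four_power4_le_exp[OF L_ge])
    finally show "10 * L ^ 3 \<le> exp L" .
  qed (use L_ge in auto)
  also have "\<dots> = exp (3 * L / 2)" by (simp flip: exp_add)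
  finally show ?thesis .
qed

lemma pattern_cost_le:
  assumes "real k \<le> 9 * (G * L ^ 3)" shows "2 * (1 / L ^ 5) * real k * ln (real k + 1) \<le> G * r"
proof -
  have "ln (real k + 1) \<le> ln (exp (3 * L / 2))"
    using Suc_le_exp_if_large_core[OF assms] by (intro ln_mono) auto
  then have "ln (real k + 1) \<le> 2 * L" using L_ge by simp
  then have "2 * (1 / L ^ 5) * real k * ln (real k + 1) \<le> 2 * (1 / L ^ 5) * (9 * (G * L ^ 3)) * (2 * L)"
    using assms L_ge by (intro mult_mono) auto
  also have "\<dots> = 36 * G / L" using L_ge by (simp add: field_simps eval_nat_numeral)
  also have "\<dots> \<le> G" using L_ge G_ge_1 by (simp add: field_simps)
  finally show ?thesis using G_le_G_r G_ge_1 by linarith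
qed

lemma round_cost_le:
  assumes q: "0 < q" "real q \<le> 2 * (B\<^sup>2 * r)" and k: "real k \<le> 9 * (G * L ^ 3)"
  shows "ln (216 * real q * (2 * B ^ 4)\<^sup>2) + 3 * clique_exponent A q + 8 * B\<^sup>2 / r * ln (1 / (1 / L ^ 5))
    + 2 * (1 / L ^ 5) * real k * ln (real k + 1) \<le> 3400 * (G * r)"
proof -
  have "ln (1 / (1 / L ^ 5)) = 5 * r\<^sup>2" unfolding r_square using L_ge by (simp add: ln_realpow)
  then have "8 * B\<^sup>2 / r * ln (1 / (1 / L ^ 5)) = 40 * (B\<^sup>2 * r)"
    using r_ge_2 by (simp add: power2_eq_square)
  then show ?thesis
    using ln_small_core_factor_le[OF q] clique_exponent_small_core_le[OF q(2)] B_square_r_le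
      pattern_cost_le[OF k] G_ge_1 G_le_G_r by linarith
qed

lemma start_exponent_le: "clique_exponent B (nat \<lceil>G\<rceil>) \<le> 1440 * G"
proof -
  have k: "real (nat \<lceil>G\<rceil>) \<le> 2 * G" using G_ge_1 by linarith
  have "sqrt (real (nat \<lceil>G\<rceil>)) * B = sqrt (real (nat \<lceil>G\<rceil>) * B\<^sup>2)"
    using B_ge_1 by (simp add: real_sqrt_mult)
  also have "\<dots> \<le> sqrt ((2 * G) * G)"
    using k B_square_le_G G_ge_1 by (intro real_sqrt_le_mono mult_mono) auto
  also have "\<dots> \<le> 2 * G" using G_ge_1 by (intro real_le_lsqrt) (auto simp: power2_eq_square)
  finally have "real (nat \<lceil>G\<rceil>) + sqrt (real (nat \<lceil>G\<rceil>)) * B \<le> 4 * G" using k by linarith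
  then show ?thesis unfolding clique_exponent_def by simp
qed

lemma growth_reaches_core:
  assumes "real q \<le> 9 * (G * L ^ 3)" shows "q \<le> nat \<lceil>G * (3/2) ^ nat \<lceil>11 * ln L\<rceil>\<rceil>"
proof -
  let ?J = "nat \<lceil>11 * ln L\<rceil>"
  have "2/3 \<le> exp (- 1/3 :: real)" using exp_ge_add_one_self[of "-1/3"] by simp
  then have e: "exp (1/3) \<le> (3/2 :: real)" by (simp add: exp_minus field_simps)
  have "9 * L ^ 3 \<le> exp 1 ^ 4 * exp (ln L) ^ 3"
  proof (rule mult_mono)
    have "(9::real) \<le> 2 ^ 4" by simp
    also have "\<dots> \<le> exp 1 ^ 4" using exp_ge_add_one_self[of 1] by (intro power_mono) auto
    finally show "(9::real) \<le> exp 1 ^ 4" .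
  qed (use L_ge in auto)
  also have "\<dots> = exp (4 + 3 * ln L)" by (simp add: exp_add flip: exp_of_nat_mult)
  also have "\<dots> \<le> exp (real ?J * (1/3))"
  proof -
    have "11 * ln L \<le> real ?J" by linarith
    then have "4 + 3 * ln L \<le> real ?J * (1/3)" using ln_L_ge_8 by linarith
    then show ?thesis by (simp only: exp_le_cancel_iff)
  qed
  also have "\<dots> = exp (1/3) ^ ?J" by (rule exp_of_nat_mult)
  also have "\<dots> \<le> (3/2) ^ ?J" using e by (intro power_mono) auto
  finally have "G * (9 * L ^ 3) \<le> G * (3/2) ^ ?J" using G_ge_1 by (intro mult_left_mono) auto
  then show ?thesis using assms by linarith
qed

lemma total_growth_cost_le: "1440 * G + real (nat \<lceil>11 * ln L\<rceil>) * (3400 * (G * r)) \<le> 41000 * (G * r ^ 3)"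
proof -
  have "real (nat \<lceil>11 * ln L\<rceil>) \<le> 12 * r\<^sup>2" unfolding r_square using ln_L_ge_8 by linarith
  then have "real (nat \<lceil>11 * ln L\<rceil>) * (3400 * (G * r)) \<le> 12 * r\<^sup>2 * (3400 * (G * r))"
    using G_ge_1 r_ge_2 by (intro mult_right_mono) auto
  also have "\<dots> = 40800 * (G * r ^ 3)" by (simp add: eval_nat_numeral)
  finally show ?thesis using G_le_G_r_cubed G_ge_1 by linarith
qed

lemma halving_factor_le:
  assumes q: "real q \<le> 9 * (G * L ^ 3)" and n: "real n = 2 * exp L"
  shows "108 * real q * real n * (6 * real n * (real n + 1)) \<le> exp (9 * L)"
proof -
  define M where "M = exp L"
  have M: "16 \<le> M" unfolding M_def using exp_ge_add_one_self[of L] L_ge by linarith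
  have nM: "real n = 2 * M" "real n + 1 \<le> 3 * M" using n M unfolding M_def by linarith+
  have "real q \<le> exp (3 * L / 2)" using Suc_le_exp_if_large_core[OF q] by linarith
  also have "\<dots> \<le> exp (2 * L)" using L_ge by (subst exp_le_cancel_iff) linarith
  also have "\<dots> = M ^ 2" unfolding M_def by (simp flip: exp_of_nat_mult)
  finally have qM: "real q \<le> M ^ 2" .
  have "108 * real q * real n * (6 * real n * (real n + 1)) = 648 * real q * (real n * real n) * (real n + 1)"
    by simp
  also have "\<dots> \<le> 648 * M ^ 2 * (2 * M * (2 * M)) * (3 * M)"
    unfolding nM(1) using qM nM M by (intro mult_mono mult_right_mono) auto
  also have "\<dots> = 7776 * M ^ 5" by (simp add: eval_nat_numeral)
  also have "\<dots> \<le> M ^ 4 * M ^ 5" using power_mono[OF M, of 4] M by (intro mult_right_mono) auto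
  also have "\<dots> = M ^ 9" by (simp flip: power_add)
  also have "\<dots> = exp (9 * L)" unfolding M_def by (simp flip: exp_of_nat_mult)
  finally show ?thesis .
qed

lemma halving_size_le:
  assumes q: "real q \<le> 9 * (G * L ^ 3)" and n: "real n = 2 * exp L"
  shows "108 * real q * real n * exp (3 * (41000 * (G * r ^ 3)) + G / L * ln (1 / (1 / (4 * real n))))
      * (6 * real n * (real n + 1) * exp f) \<le> exp (f + 125000 * (G * r ^ 3))"
proof -
  have "8 \<le> exp L" using exp_ge_add_one_self[of L] L_ge by linarith
  then have "8 * exp L \<le> exp L * exp L" by (rule mult_right_mono) simp
  then have "ln (4 * real n) \<le> ln (exp L * exp L)" unfolding n by (intro ln_mono) auto
  also have "\<dots> = 2 * L" by (simp flip: exp_add)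
  finally have "G / L * ln (4 * real n) \<le> G / L * (2 * L)"
    using G_ge_1 L_ge by (intro mult_left_mono) auto
  also have "\<dots> = 2 * G" using L_ge by simp
  finally have "G / L * ln (1 / (1 / (4 * real n))) \<le> 2 * G" by simp
  then have exponent: "3 * (41000 * (G * r ^ 3)) + G / L * ln (1 / (1 / (4 * real n))) + f + 9 * L
      \<le> f + 125000 * (G * r ^ 3)"
    using L_le_G G_le_G_r_cubed G_ge_1 by linarith
  let ?e = "3 * (41000 * (G * r ^ 3)) + G / L * ln (1 / (1 / (4 * real n)))"
  have "108 * real q * real n * exp ?e * (6 * real n * (real n + 1) * exp f)
      = (108 * real q * real n * (6 * real n * (real n + 1))) * exp (?e + f)"
    by (simp add: exp_add)
  also have "\<dots> \<le> exp (9 * L) * exp (?e + f)"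
    using halving_factor_le[OF q n] by (rule mult_right_mono) simp
  also have "\<dots> \<le> exp (f + 125000 * (G * r ^ 3))" using exponent by (simp flip: exp_add)
  finally show ?thesis .
qed

end

context copy_free_colouring
begin

lemma on_large_subsets_has_large_core:
  assumes balanced: "balanced_sizes (root 4 (real (card E1))) (root 4 (real (card E2))) L G r"
  shows "on_large_subsets V (exp (41000 * (G * r ^ 3))) (has_clique (- c) (core_size E1 (G / L)))"
proof -
  let ?A = "root 4 (real (card E1))" and ?B = "root 4 (real (card E2))"
  interpret balanced_sizes ?A ?B L G r by (rule balanced)
  have fin: "finite E1" "finite E2" using E1(1) E2(1) unfolding ordered_edges_def by auto
  note edges = edge_count_eq_root_power(2)[OF E1(1,2)] edge_count_eq_root_power(2)[OF E2(1,2)]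
  let ?D = "8 * ?B\<^sup>2 / r"
  have D: "0 < ?D" using B_ge_1 r_ge_2 by simp
  have q2: "real (core_size E2 ?D) \<le> 2 * (?B\<^sup>2 * r)"
    using core_size_le[OF fin(2) D]
    unfolding edges(2)[symmetric] by (intro small_core_le) (simp flip: edges(2))
  have q1: "real (core_size E1 (G / L)) \<le> 9 * (G * L ^ 3)"
    using core_size_le[OF fin(1), of "G / L"] G_ge_1 L_ge
    by (intro large_core_le) (simp flip: edges(1))
  let ?q1 = "core_size E1 (G / L)" and ?J = "nat \<lceil>11 * ln L\<rceil>"
  have "on_large_subsets V (exp (1440 * G + real ?J * (3400 * (G * r)))) (has_clique (- c) (min ?q1 (nat \<lceil>G * (3/2) ^ ?J\<rceil>)))"
  proof (rule clique_growth_iterate[OF D])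
    have "1 \<le> L ^ 4" "4 \<le> L" using L_ge by (auto intro: one_le_power)
    then have "1 * 4 \<le> L ^ 4 * L" by (intro mult_mono) auto
    then show "0 < 1 / L ^ 5" "1 / L ^ 5 \<le> 1/4"
      using L_ge by (auto simp: eval_nat_numeral field_simps)
    show "0 \<le> 1440 * G" "0 < G" "0 \<le> 3400 * (G * r)" using G_ge_1 r_ge_2 by auto
    show "on_large_subsets V (exp (1440 * G)) (has_clique (- c) (nat \<lceil>G\<rceil>))"
    proof (rule on_large_subsets_mono)
      show "on_large_subsets V (exp (clique_exponent ?B (nat \<lceil>G\<rceil>))) (has_clique (- c) (nat \<lceil>G\<rceil>))"
        by (rule on_large_subsets_has_clique_if_no_copy[OF symp finite_V E2])
    qed (use start_exponent_le in auto)
    show "ln (216 * real (core_size E2 ?D) * (real (2 * card E2))\<^sup>2) + 3 * clique_exponent ?A (core_size E2 ?D)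
        + ?D * ln (1 / (1 / L ^ 5)) + 2 * (1 / L ^ 5) * real k * ln (real k + 1) \<le> 3400 * (G * r)"
      if "k \<le> ?q1" for k
    proof -
      have "real k \<le> 9 * (G * L ^ 3)" using that q1 by linarith
      then show ?thesis using round_cost_le[OF _ q2] by (simp add: core_size_def flip: edges(2))
    qed
  qed
  then show ?thesis
    using growth_reaches_core[OF q1] total_growth_cost_le
    by (elim on_large_subsets_mono) (auto simp: min_def)
qed

lemma sparse_pair_if_balanced:
  assumes balanced: "balanced_sizes (root 4 (real (card E1))) (root 4 (real (card E2))) L G r"
    and f: "0 \<le> f" and size: "exp (f + 125000 * (G * r ^ 3)) \<le> real (card V)"
    and n: "n = 2 * (card E1 + card E2)"
  shows "sparse_pair (- c) (1 / (4 * real n)) n (6 * real n * (real n + 1) * exp f) V"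
proof -
  interpret balanced_sizes "root 4 (real (card E1))" "root 4 (real (card E2))" L G r
    by (rule balanced)
  note edges = edge_count_eq_root_power[OF E1(1,2)] edge_count_eq_root_power[OF E2(1,2)]
  have finite_E1: "finite E1" using E1(1) unfolding ordered_edges_def by simp
  have n_eq: "real n = 2 * exp L" and n_pos: "0 < n"
    unfolding n exp_L using edges(2,3,5) by simp_all
  have GL: "0 < G / L" using G_ge_1 L_ge by simp
  have q: "real (core_size E1 (G / L)) \<le> 9 * (G * L ^ 3)"
    using core_size_le[OF finite_E1 GL] by (intro large_core_le) (simp flip: edges(2))
  have "copy (- c) (Field E1) E1 V \<or> sparse_pair (- c) (1 / (4 * real n)) n (6 * real n * (real n + 1) * exp f) V"
  proof (rule copy_or_sparse_pair_if_cliques[OF symp_Compl[OF symp] finite_V E1(1) _ n_pos GL])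
    show "card (Field E1) \<le> n" using card_Field_le_edges[OF E1(1)] unfolding n by simp
    show "0 < 1 / (4 * real n)" "1 / (4 * real n) \<le> 1" using n_pos by auto
    have "1 * 1 * 1 \<le> (6 * real n) * (real n + 1) * exp f" using n_pos f by (intro mult_mono) auto
    then show "1 \<le> 6 * real n * (real n + 1) * exp f" by simp
    show "0 \<le> 41000 * (G * r ^ 3)" using G_ge_1 r_ge_2 by simp
    show "on_large_subsets V (exp (41000 * (G * r ^ 3))) (has_clique (- c) (core_size E1 (G / L)))"
      by (rule on_large_subsets_has_large_core[OF balanced])
    show "108 * real (core_size E1 (G / L)) * real n
        * exp (3 * (41000 * (G * r ^ 3)) + G / L * ln (1 / (1 / (4 * real n))))
        * (6 * real n * (real n + 1) * exp f) \<le> real (card V)"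
      using halving_size_le[OF q n_eq, of f] size by linarith
  qed
  then show ?thesis using E1(3) by blast
qed

end

lemma arrows_if_smaller_halved:
  fixes V :: "'b::wellorder set" and E1 E2 :: "('a::linorder \<times> 'a) set" and f L G r :: real
  assumes c: "symp c" and V: "finite V" and E1: "ordered_edges E1" "E1 \<noteq> {}"
    and E2: "ordered_edges E2" "E2 \<noteq> {}"
    and balanced: "balanced_sizes (root 4 (real (card E1))) (root 4 (real (card E2))) L G r"
    and f: "0 \<le> f" and size: "exp (f + 125000 * (G * r ^ 3)) \<le> real (card V)"
    and halves: "\<And>E' :: ('a \<times> 'a) set. ordered_edges E' \<Longrightarrow> 2 * card E' \<le> card E2 \<Longrightarrow>
      on_large_subsets V (exp f) (arrows c E1 E')"
  shows "arrows c E1 E2 V"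
proof (rule ccontr)
  assume "\<not> arrows c E1 E2 V"
  then have no_copy: "\<not> copy (- c) (Field E1) E1 V" "\<not> copy c (Field E2) E2 V"
    unfolding arrows_def by auto
  interpret copy_free_colouring c V E1 E2 by standard (use c V E1 E2 no_copy in auto)
  define n where "n = 2 * (card E1 + card E2)"
  have "0 < n" unfolding n_def using edge_count_eq_root_power(3)[OF E2(1,2)] by simp
  have "copy (- (- c)) (Field E2) E2 V"
  proof (rule copy_by_halving[OF symp_Compl[OF c] V \<open>0 < n\<close> sparse_pair_if_balanced[OF balanced f size n_def] E2(1) _ f])
    show "card (Field E2) \<le> n" using card_Field_le_edges[OF E2(1)] unfolding n_def by simp
    show "on_large_subsets V (exp f) (copy (- (- c)) (Field E') E')"
      if E': "ordered_edges E'" "2 * card E' \<le> card E2" for E' :: "('a \<times> 'a) set"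
    proof (rule on_large_subsets_mono[OF halves[OF E'] order_refl order_refl])
      show "copy (- (- c)) (Field E') E' X" if "X \<subseteq> V" "arrows c E1 E' X" for X
        using that copy_mono[of "- c" "Field E1" E1 X V] no_copy(1) unfolding arrows_def by auto
    qed
  qed
  then show False using no_copy(2) by simp
qed

section \<open>Halving the larger graph\<close>

lemma ex_degeneracy_bound:
  assumes "1 \<le> m"
  obtains d where "2 * m \<le> d * d" "real d \<le> 3 * sqrt (real m)"
proof
  let ?d = "nat \<lceil>sqrt (2 * real m)\<rceil>"
  have "2 * real m = (sqrt (2 * real m))\<^sup>2" by simp
  also have "\<dots> \<le> (real ?d)\<^sup>2"
  proof (rule power_mono)
    show "sqrt (2 * real m) \<le> real ?d" by linarith
  qed simp
  finally have "real (2 * m) \<le> real (?d * ?d)" by (simp add: power2_eq_square)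
  then show "2 * m \<le> ?d * ?d" by (simp only: of_nat_le_iff)
  have "sqrt (2 * real m) \<le> sqrt (4 * real m)" by (intro real_sqrt_le_mono) simp
  then have "sqrt (2 * real m) \<le> 2 * sqrt (real m)" by (simp add: real_sqrt_mult)
  moreover have "1 \<le> sqrt (real m)" using assms by simp
  ultimately show "real ?d \<le> 3 * sqrt (real m)" by linarith
qed

lemma greedy_size_le:
  fixes L f b :: real
  assumes L: "2 \<le> L" and n: "real n \<le> 2 * exp L" and b: "1 \<le> b" and d: "real d \<le> 3 * sqrt b"
  shows "12 * (real n)\<^sup>2 * (real n + 1) * (4 * real n) ^ d * exp f \<le> exp (f + 16 * sqrt b * L)"
proof -
  define M where "M = exp L"
  have "exp 1 ^ 2 \<le> M" unfolding M_def using L by (simp flip: exp_of_nat_mult)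
  moreover have "2 ^ 2 \<le> (exp 1 :: real) ^ 2"
    using exp_ge_add_one_self[of 1] by (intro power_mono) auto
  ultimately have M: "4 \<le> M" by simp
  have nM: "real n \<le> 2 * M" "real n + 1 \<le> 3 * M" using n M unfolding M_def by linarith+
  have "4 * real n \<le> M ^ 3"
  proof -
    have "4 * 4 \<le> M * M" using M by (intro mult_mono) auto
    then have "8 * M \<le> M * M * M" using M by (intro mult_right_mono) auto
    then show ?thesis using nM(1) by (simp add: power3_eq_cube)
  qed
  then have exponential: "(4 * real n) ^ d \<le> (M ^ 3) ^ d" by (intro power_mono) auto
  have "12 * (real n)\<^sup>2 * (real n + 1) \<le> 12 * (2 * M)\<^sup>2 * (3 * M)"
    using nM M by (intro mult_mono power_mono) auto
  also have "\<dots> = 144 * M ^ 3" by (simp add: eval_nat_numeral)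
  also have "\<dots> \<le> M ^ 4 * M ^ 3" using power_mono[OF M, of 4] M by (intro mult_right_mono) auto
  finally have "(12 * (real n)\<^sup>2 * (real n + 1)) * (4 * real n) ^ d \<le> (M ^ 4 * M ^ 3) * (M ^ 3) ^ d"
    using exponential by (rule mult_mono) (use M in auto)
  also have "\<dots> = M ^ (7 + 3 * d)" by (simp add: power_add flip: power_mult)
  also have "\<dots> = exp (real (7 + 3 * d) * L)" unfolding M_def by (rule exp_of_nat_mult[symmetric])
  also have "\<dots> \<le> exp (16 * sqrt b * L)"
  proof -
    have "real (7 + 3 * d) \<le> 16 * sqrt b" using d real_sqrt_ge_one[OF b] by linarith
    then show ?thesis using L by (simp add: mult_right_mono)
  qed
  finally show ?thesis by (simp add: exp_add mult.commute[of _ "exp f"])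
qed

lemma arrows_if_larger_halved:
  fixes V :: "'b::wellorder set" and E1 E2 :: "('a::linorder \<times> 'a) set" and f L :: real
  assumes c: "symp c" and V: "finite V" and E1: "ordered_edges E1"
    and E2: "ordered_edges E2" "E2 \<noteq> {}"
    and L: "2 \<le> L" "real (card E1 + card E2) \<le> exp L" and f: "0 \<le> f"
    and size: "exp (f + 16 * sqrt (real (card E2)) * L) \<le> real (card V)"
    and halves: "\<And>E' :: ('a \<times> 'a) set. ordered_edges E' \<Longrightarrow> 2 * card E' \<le> card E1 \<Longrightarrow>
      on_large_subsets V (exp f) (arrows c E' E2)"
  shows "arrows c E1 E2 V"
proof (cases "copy c (Field E2) E2 V")
  case False
  define n where "n = 2 * (card E1 + card E2)"
  have b: "1 \<le> card E2" using edge_count_eq_root_power(3)[OF E2] by simp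
  have n: "0 < n" "real n \<le> 2 * exp L" unfolding n_def using b L(2) by auto
  have Field_le: "card (Field E1) \<le> n" "card (Field E2) \<le> n"
    unfolding n_def using card_Field_le_edges[OF E1] card_Field_le_edges[OF E2(1)] by auto
  obtain d where d: "2 * card E2 \<le> d * d" "real d \<le> 3 * sqrt (real (card E2))"
    by (rule ex_degeneracy_bound[OF b])
  define t where "t = 6 * real n * (real n + 1) * exp f"
  define s where "s = nat \<lceil>t * (4 * real n) ^ d\<rceil>"
  have "1 * 1 * 1 \<le> (6 * real n) * (real n + 1) * exp f" using n(1) f by (intro mult_mono) auto
  then have t: "1 \<le> t" unfolding t_def by simp
  have "1 * 1 \<le> t * (4 * real n) ^ d" using t n(1) by (intro mult_mono one_le_power) auto
  then have s: "t * (4 * real n) ^ d \<le> real s" "real s \<le> 2 * (t * (4 * real n) ^ d)"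
    unfolding s_def by linarith+
  have "copy c (Field E2) E2 V \<or> sparse_pair c (1 / (4 * real n)) n t V"
  proof (rule copy_or_sparse_pair[OF c E2(1) ordered_edges_finite_Field[OF E2(1)] order_refl Field_le(2) d(1) _ _ _ _ V])
    show "0 < 1 / (4 * real n)" "1 / (4 * real n) \<le> 1" "0 < t" using n(1) t by auto
    show "t \<le> real s * (1 / (4 * real n)) ^ d"
      using s(1) n(1) by (simp add: power_one_over field_simps)
    have "real (n * s) \<le> real n * (2 * (t * (4 * real n) ^ d))"
      using s(2) by (simp add: mult_left_mono)
    also have "\<dots> = 12 * (real n)\<^sup>2 * (real n + 1) * (4 * real n) ^ d * exp f"
      unfolding t_def by (simp add: power2_eq_square)
    also have "\<dots> \<le> real (card V)" using greedy_size_le[OF L(1) n(2) _ d(2), of f] b size by simp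
    finally show "n * s \<le> card V" by (simp only: of_nat_le_iff)
  qed
  then have pair: "sparse_pair c (1 / (4 * real n)) n t V" using False by blast
  have "copy (- c) (Field E1) E1 V"
  proof (rule copy_by_halving[OF c V n(1) pair[unfolded t_def] E1 Field_le(1) f])
    show "on_large_subsets V (exp f) (copy (- c) (Field E') E')"
      if E': "ordered_edges E'" "2 * card E' \<le> card E1" for E' :: "('a \<times> 'a) set"
    proof (rule on_large_subsets_mono[OF halves[OF E'] order_refl order_refl])
      show "copy (- c) (Field E') E' X" if "X \<subseteq> V" "arrows c E' E2 X" for X
        using that False copy_mono unfolding arrows_def by blast
    qed
  qed
  then show ?thesis unfolding arrows_def by blast
qed (simp add: arrows_def)

section \<open>The recursion\<close>

definition loglog :: "real \<Rightarrow> real" where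
  "loglog x = ln (max (exp 1) (ln x))"

definition ramsey_exponent :: "real \<Rightarrow> real \<Rightarrow> real" where
  "ramsey_exponent a b = 1500000 * (root 4 (a * b) * sqrt (loglog (a + b)) ^ 3)"

lemma loglog_ge_1: "1 \<le> loglog x"
  unfolding loglog_def by (subst ln_ge_iff) (auto simp: less_max_iff_disj)

lemma loglog_mono:
  assumes "0 < x" "x \<le> y" shows "loglog x \<le> loglog y"
proof -
  have "max (exp 1) (ln x) \<le> max (exp 1) (ln y)" using ln_mono[OF assms(2,1)] by auto
  then show ?thesis unfolding loglog_def by (intro ln_mono) (auto simp: less_max_iff_disj)
qed

lemma ramsey_exponent_commute: "ramsey_exponent a b = ramsey_exponent b a"
  unfolding ramsey_exponent_def by (simp add: mult.commute add.commute)

lemma ramsey_exponent_nonneg: "0 \<le> a \<Longrightarrow> 0 \<le> b \<Longrightarrow> 0 \<le> ramsey_exponent a b"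
  unfolding ramsey_exponent_def using loglog_ge_1[of "a + b"] by simp

lemma ramsey_exponent_mono:
  assumes "0 \<le> a'" "a' \<le> a" "0 < b" shows "ramsey_exponent a' b \<le> ramsey_exponent a b"
proof -
  have "root 4 (a' * b) \<le> root 4 (a * b)" using assms by (simp add: mult_right_mono)
  moreover have "sqrt (loglog (a' + b)) ^ 3 \<le> sqrt (loglog (a + b)) ^ 3"
    using assms loglog_ge_1[of "a' + b"] by (intro power_mono real_sqrt_le_mono loglog_mono) auto
  ultimately show ?thesis
    unfolding ramsey_exponent_def
    using assms loglog_ge_1[of "a' + b"] by (intro mult_left_mono mult_mono) auto
qed

lemma ramsey_exponent_halve:
  assumes "0 \<le> a" "0 < b"
  shows "ramsey_exponent (a / 2) b + 225000 * (root 4 (a * b) * sqrt (loglog (a + b)) ^ 3) \<le> ramsey_exponent a b"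
proof -
  have "root 4 (1/2) \<le> root 4 ((17/20) ^ 4 :: real)"
    by (subst real_root_le_iff) (simp_all add: power_divide)
  also have "\<dots> = 17/20" by (rule real_root_power_cancel) auto
  finally have half: "root 4 (1/2) \<le> (17/20 :: real)" .
  have "root 4 (a / 2 * b) = root 4 (1/2) * root 4 (a * b)" by (simp flip: real_root_mult)
  also have "\<dots> \<le> 17/20 * root 4 (a * b)" using half assms by (intro mult_right_mono) auto
  finally have "root 4 (a / 2 * b) \<le> 17/20 * root 4 (a * b)" .
  moreover have "sqrt (loglog (a / 2 + b)) ^ 3 \<le> sqrt (loglog (a + b)) ^ 3"
    using assms loglog_ge_1[of "a / 2 + b"] by (intro power_mono real_sqrt_le_mono loglog_mono) auto
  ultimately have "root 4 (a / 2 * b) * sqrt (loglog (a / 2 + b)) ^ 3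
      \<le> (17/20 * root 4 (a * b)) * sqrt (loglog (a + b)) ^ 3"
    using assms loglog_ge_1[of "a / 2 + b"] by (intro mult_mono) auto
  then show ?thesis unfolding ramsey_exponent_def by simp
qed

lemma balanced_sizes_if_expensive:
  fixes a b :: real
  assumes b: "1 \<le> b" "b \<le> a"
    and expensive: "10000 * (root 4 (a * b) * sqrt (loglog (a + b)) ^ 3) < sqrt b * max (exp 1) (ln (a + b))"
  shows "balanced_sizes (root 4 a) (root 4 b) (ln (a + b)) (root 4 (a * b)) (sqrt (loglog (a + b)))"
proof -
  define L where "L = max (exp 1) (ln (a + b))"
  define A B where "A = root 4 a" and "B = root 4 b"
  have B: "1 \<le> B" "B \<le> A" unfolding A_def B_def using b by auto
  have G: "root 4 (a * b) = A * B" unfolding A_def B_def by (rule real_root_mult)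
  have "sqrt b = sqrt ((B\<^sup>2)\<^sup>2)"
    unfolding B_def using b by (simp add: real_root_pow_pos2 flip: power_mult)
  then have "sqrt b = B * B" using B by (simp add: power2_eq_square)
  then have "10000 * (A * B * sqrt (loglog (a + b)) ^ 3) < B * B * L"
    using expensive unfolding G L_def by simp
  moreover have "A * B * 1 \<le> A * B * sqrt (loglog (a + b)) ^ 3"
    using B loglog_ge_1[of "a + b"] by (intro mult_left_mono one_le_power) auto
  ultimately have "(10000 * A) * B < (B * L) * B" by (simp add: mult_ac)
  then have AL: "10000 * A < B * L" using B by (elim mult_right_less_imp_less) simp
  have "exp 1 \<le> L" unfolding L_def by simp
  then have "0 < L" by (rule less_le_trans[OF exp_gt_zero])
  then have "B * L \<le> A * L" using B by (intro mult_right_mono) auto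
  then have "10000 * A < L * A" using AL by (simp only: mult.commute[of A L])
  then have L: "10000 < L" using B by simp
  have loglog: "loglog (a + b) = ln L" unfolding loglog_def L_def ..
  have L_eq: "ln (a + b) = L"
    using L exp_le unfolding L_def by (auto simp: max_def split: if_splits)
  show ?thesis
  proof
    show "1 \<le> root 4 b" "root 4 b \<le> root 4 a" using B unfolding A_def B_def by auto
    show "root 4 a \<le> root 4 b * ln (a + b)" using AL B unfolding L_eq A_def B_def by linarith
    show "10000 \<le> ln (a + b)" using L L_eq by simp
    show "exp (ln (a + b)) = root 4 a ^ 4 + root 4 b ^ 4" using b by (simp add: real_root_pow_pos2)
    show "root 4 (a * b) = root 4 a * root 4 b" by (rule real_root_mult)
    show "sqrt (loglog (a + b)) = sqrt (ln (ln (a + b)))" unfolding loglog L_eq ..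
  qed
qed

lemma arrows_if_cheap:
  fixes V :: "'b::wellorder set" and E1 E2 :: "('a::linorder \<times> 'a) set"
  assumes c: "symp c" and V: "finite V" and E1: "ordered_edges E1"
    and E2: "ordered_edges E2" "E2 \<noteq> {}"
    and ab: "a = real (card E1)" "b = real (card E2)"
    and cheap: "sqrt b * max (exp 1) (ln (a + b)) \<le> 10000 * (root 4 (a * b) * sqrt (loglog (a + b)) ^ 3)"
    and size: "exp (ramsey_exponent a b) \<le> real (card V)"
    and halves: "\<And>E' :: ('a \<times> 'a) set. ordered_edges E' \<Longrightarrow> 2 * card E' \<le> card E1 \<Longrightarrow>
      on_large_subsets V (exp (ramsey_exponent (a / 2) b)) (arrows c E' E2)"
  shows "arrows c E1 E2 V"
proof (rule arrows_if_larger_halved[OF c V E1 E2])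
  let ?L = "max (exp 1) (ln (a + b))" and ?cost = "root 4 (a * b) * sqrt (loglog (a + b)) ^ 3"
  have b: "0 < b" using edge_count_eq_root_power(3)[OF E2] ab by simp
  have "2 \<le> exp (1::real)" using exp_ge_add_one_self[of 1] by simp
  then show "2 \<le> ?L" by simp
  have "a + b = exp (ln (a + b))" using ab b by simp
  also have "\<dots> \<le> exp ?L" by simp
  finally show "real (card E1 + card E2) \<le> exp ?L" using ab by simp
  show "0 \<le> ramsey_exponent (a / 2) b" using ab by (intro ramsey_exponent_nonneg) auto
  have "ramsey_exponent (a / 2) b + 225000 * ?cost \<le> ramsey_exponent a b"
    using ab(1) b by (intro ramsey_exponent_halve) auto
  moreover have "0 \<le> ?cost" using ab loglog_ge_1[of "a + b"] by simp
  ultimately have "ramsey_exponent (a / 2) b + 16 * sqrt b * ?L \<le> ramsey_exponent a b"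
    using cheap unfolding mult.assoc by linarith
  then show "exp (ramsey_exponent (a / 2) b + 16 * sqrt (real (card E2)) * ?L) \<le> real (card V)"
    using size unfolding ab by (meson exp_le_cancel_iff order_trans)
qed (rule halves)

lemma arrows_if_expensive:
  fixes V :: "'b::wellorder set" and E1 E2 :: "('a::linorder \<times> 'a) set"
  assumes c: "symp c" and V: "finite V" and E1: "ordered_edges E1" "E1 \<noteq> {}"
    and E2: "ordered_edges E2" "E2 \<noteq> {}"
    and ab: "a = real (card E1)" "b = real (card E2)" "b \<le> a"
    and expensive: "10000 * (root 4 (a * b) * sqrt (loglog (a + b)) ^ 3) < sqrt b * max (exp 1) (ln (a + b))"
    and size: "exp (ramsey_exponent a b) \<le> real (card V)"
    and halves: "\<And>E' :: ('a \<times> 'a) set. ordered_edges E' \<Longrightarrow> 2 * card E' \<le> card E2 \<Longrightarrow>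
      on_large_subsets V (exp (ramsey_exponent a (b / 2))) (arrows c E1 E')"
  shows "arrows c E1 E2 V"
proof (rule arrows_if_smaller_halved[OF c V E1 E2])
  let ?cost = "root 4 (a * b) * sqrt (loglog (a + b)) ^ 3"
  have b: "1 \<le> b" using edge_count_eq_root_power(3)[OF E2] ab by simp
  show "balanced_sizes (root 4 (real (card E1))) (root 4 (real (card E2)))
      (ln (a + b)) (root 4 (a * b)) (sqrt (loglog (a + b)))"
    using balanced_sizes_if_expensive[OF b ab(3) expensive] unfolding ab(1,2) .
  show "0 \<le> ramsey_exponent a (b / 2)" using ab by (intro ramsey_exponent_nonneg) auto
  have "ramsey_exponent a (b / 2) + 225000 * ?cost \<le> ramsey_exponent a b"
    using ramsey_exponent_halve[of b a] b ab(3)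
    by (simp add: ramsey_exponent_commute[of a] mult.commute[of a] add.commute[of a])
  moreover have "0 \<le> ?cost" using b ab(3) loglog_ge_1[of "a + b"] by simp
  ultimately have "ramsey_exponent a (b / 2) + 125000 * ?cost \<le> ramsey_exponent a b" by linarith
  then show "exp (ramsey_exponent a (b / 2) + 125000 * ?cost) \<le> real (card V)"
    using size by (meson exp_le_cancel_iff order_trans)
qed (rule halves)

lemma arrows_step:
  fixes V :: "'b::wellorder set" and E1 E2 :: "('a::linorder \<times> 'a) set"
  assumes c: "symp c" and V: "finite V" and E: "ordered_edges E1" "ordered_edges E2"
    and le: "card E2 \<le> card E1"
    and size: "exp (ramsey_exponent (real (card E1)) (real (card E2))) \<le> real (card V)"
    and IH: "\<And>E1' E2' :: ('a \<times> 'a) set. ordered_edges E1' \<Longrightarrow> ordered_edges E2' \<Longrightarrow>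
      card E1' + card E2' < card E1 + card E2 \<Longrightarrow>
      on_large_subsets V (exp (ramsey_exponent (real (card E1')) (real (card E2')))) (arrows c E1' E2')"
  shows "arrows c E1 E2 V"
proof (cases "E2 = {}")
  case True
  then show ?thesis by (simp add: arrows_def copy_def embedding_def strict_mono_on_def)
next
  case False
  define a b where ab: "a = real (card E1)" "b = real (card E2)"
  have cards: "0 < card E1" "0 < card E2"
    using edge_count_eq_root_power(3)[OF E(2) False] le by auto
  note size = size[folded ab]
  show ?thesis
  proof (cases "sqrt b * max (exp 1) (ln (a + b)) \<le> 10000 * (root 4 (a * b) * sqrt (loglog (a + b)) ^ 3)")
    case True
    show ?thesis
    proof (rule arrows_if_cheap[OF c V E False ab True size])
      show "on_large_subsets V (exp (ramsey_exponent (a / 2) b)) (arrows c E' E2)"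
        if E': "ordered_edges E'" "2 * card E' \<le> card E1" for E' :: "('a \<times> 'a) set"
      proof (rule on_large_subsets_mono[OF IH[OF E'(1) E(2)] order_refl])
        show "card E' + card E2 < card E1 + card E2" using E'(2) cards by linarith
        show "exp (ramsey_exponent (real (card E')) (real (card E2))) \<le> exp (ramsey_exponent (a / 2) b)"
          using E'(2) cards unfolding ab by (simp add: ramsey_exponent_mono)
      qed
    qed
  next
    case expensive: False
    have "E1 \<noteq> {}" "b \<le> a" using cards le unfolding ab by auto
    then show ?thesis
    proof (rule arrows_if_expensive[OF c V E(1) _ E(2) False ab _ expensive[unfolded not_le] size])
      show "on_large_subsets V (exp (ramsey_exponent a (b / 2))) (arrows c E1 E')"
        if E': "ordered_edges E'" "2 * card E' \<le> card E2" for E' :: "('a \<times> 'a) set"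
      proof (rule on_large_subsets_mono[OF IH[OF E(1) E'(1)] order_refl])
        show "card E1 + card E' < card E1 + card E2" using E'(2) cards by linarith
        show "exp (ramsey_exponent (real (card E1)) (real (card E'))) \<le> exp (ramsey_exponent a (b / 2))"
          using E'(2) cards unfolding ab ramsey_exponent_commute[of "real (card E1)"]
          by (simp add: ramsey_exponent_mono)
      qed
    qed
  qed
qed

theorem on_large_subsets_arrows:
  fixes V :: "'b::wellorder set" and E1 E2 :: "('a::linorder \<times> 'a) set"
  assumes V: "finite V" and "symp c" "ordered_edges E1" "ordered_edges E2"
  shows "on_large_subsets V (exp (ramsey_exponent (real (card E1)) (real (card E2)))) (arrows c E1 E2)"
  using assms(2-)
proof (induction "card E1 + card E2" arbitrary: c E1 E2 rule: less_induct)
  case less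
  show ?case
    unfolding on_large_subsets_def
  proof (intro allI impI)
    fix X assume X: "X \<subseteq> V" "exp (ramsey_exponent (real (card E1)) (real (card E2))) \<le> real (card X)"
    have finite_X: "finite X" using X(1) V by (rule finite_subset)
    have IH: "on_large_subsets X (exp (ramsey_exponent (real (card E1')) (real (card E2')))) (arrows d E1' E2')"
      if "symp d" "ordered_edges E1'" "ordered_edges E2'" "card E1' + card E2' < card E1 + card E2"
      for d :: "'b \<Rightarrow> 'b \<Rightarrow> bool" and E1' E2' :: "('a \<times> 'a) set"
      by (rule on_large_subsets_mono[OF less.hyps[OF that(4,1-3)] X(1) order_refl])
    show "arrows c E1 E2 X"
    proof (cases "card E2 \<le> card E1")
      case True
      show ?thesis by (rule arrows_step[OF less.prems(1) finite_X less.prems(2,3) True X(2) IH[OF less.prems(1)]])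
    next
      case False
      have "arrows (- c) E2 E1 X"
      proof (rule arrows_step[OF symp_Compl[OF less.prems(1)] finite_X less.prems(3,2)])
        show "card E1 \<le> card E2" using False by simp
        show "exp (ramsey_exponent (real (card E2)) (real (card E1))) \<le> real (card X)"
          using X(2) by (simp add: ramsey_exponent_commute)
      qed (rule IH[OF symp_Compl[OF less.prems(1)]], simp_all)
      then show ?thesis by (simp only: arrows_Compl)
    qed
  qed
qed

section \<open>The bound on the ordered Ramsey number\<close>

definition edge_pairs :: "ograph \<Rightarrow> (nat \<times> nat) set" where
  "edge_pairs H = {(u, v). u < v \<and> {u, v} \<in> edges H}"

lemma edge_pairs_subset: "ordered_graph H \<Longrightarrow> edge_pairs H \<subseteq> verts H \<times> verts H"
  unfolding ordered_graph_def edge_pairs_def by auto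

lemma ordered_edges_edge_pairs: "ordered_graph H \<Longrightarrow> ordered_edges (edge_pairs H)"
  unfolding ordered_edges_def
  using finite_subset[OF edge_pairs_subset] by (auto simp: edge_pairs_def)

lemma edges_eq_image_edge_pairs:
  assumes "ordered_graph H" shows "edges H = (\<lambda>(u, v). {u, v}) ` edge_pairs H"
  using assms unfolding ordered_graph_def edge_pairs_def ordered_nsets_2_eq by fastforce

lemma Field_edge_pairs:
  assumes "ordered_graph H" "no_isolated_vertices H" shows "Field (edge_pairs H) = verts H"
proof
  show "Field (edge_pairs H) \<subseteq> verts H"
    using edge_pairs_subset[OF assms(1)] unfolding Field_def by auto
  show "verts H \<subseteq> Field (edge_pairs H)"
    using assms(2) unfolding no_isolated_vertices_def edges_eq_image_edge_pairs[OF assms(1)]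
    by (fastforce simp: Field_def)
qed

lemma card_edge_pairs:
  assumes "ordered_graph H" shows "card (edge_pairs H) = card (edges H)"
proof -
  have "inj_on (\<lambda>(u, v). {u, v}) (edge_pairs H)"
    unfolding edge_pairs_def by (auto simp: inj_on_def doubleton_eq_iff)
  then show ?thesis unfolding edges_eq_image_edge_pairs[OF assms] by (simp add: card_image)
qed

lemma contains_ordered_if_copy:
  assumes H: "ordered_graph H" and copy: "copy (\<lambda>x y. \<chi> {x, y} = k) (verts H) (edge_pairs H) {1..N}"
  shows "contains_ordered (colour_class N \<chi> k) H"
proof -
  obtain \<phi> where \<phi>: "embedding (\<lambda>x y. \<chi> {x, y} = k) (verts H) (edge_pairs H) {1..N} \<phi>"
    using copy unfolding copy_def by blast
  have image: "{\<phi> u, \<phi> v} \<in> edges (colour_class N \<chi> k)" if "(u, v) \<in> edge_pairs H" for u v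
  proof -
    have "u \<in> verts H" "v \<in> verts H" "u < v"
      using that edge_pairs_subset[OF H] unfolding edge_pairs_def by auto
    then show ?thesis
      using embeddingD(1)[OF \<phi>, of u v] embeddingD(2)[OF \<phi>, of u] embeddingD(2)[OF \<phi>, of v] embeddingD(3)[OF \<phi> that]
      unfolding colour_class_def by auto
  qed
  have "{\<phi> i, \<phi> j} \<in> edges (colour_class N \<chi> k)" if ij: "{i, j} \<in> edges H" for i j
  proof -
    obtain u v where "(u, v) \<in> edge_pairs H" "{i, j} = {u, v}"
      using ij unfolding edges_eq_image_edge_pairs[OF H] by auto
    then show ?thesis using image[of u v] by (auto simp: doubleton_eq_iff insert_commute)
  qed
  moreover have "\<phi> ` verts H \<subseteq> verts (colour_class N \<chi> k)" "strict_mono_on (verts H) \<phi>"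
    using \<phi> unfolding embedding_def colour_class_def by auto
  ultimately show ?thesis unfolding contains_ordered_def by blast
qed

theorem ordered_ramsey_le_exp_ramsey_exponent:
  assumes H1: "ordered_graph H1" "no_isolated_vertices H1"
    and H2: "ordered_graph H2" "no_isolated_vertices H2"
  shows "ordered_ramsey H1 H2 \<le> nat \<lceil>exp (ramsey_exponent (real (card (edges H1))) (real (card (edges H2))))\<rceil>"
    (is "_ \<le> ?N")
proof -
  have "contains_ordered (colour_class ?N \<chi> Red) H1 \<or> contains_ordered (colour_class ?N \<chi> Blue) H2" for \<chi>
  proof -
    let ?c = "\<lambda>x y. \<chi> {x, y} = Blue"
    have "symp ?c" by (auto simp: symp_def insert_commute)
    then have "arrows ?c (edge_pairs H1) (edge_pairs H2) {1..?N}"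
    proof (rule on_large_subsetsD[OF on_large_subsets_arrows[OF finite_atLeastAtMost] order_refl])
      show "exp (ramsey_exponent (real (card (edge_pairs H1))) (real (card (edge_pairs H2)))) \<le> real (card {1..?N})"
        unfolding card_edge_pairs[OF H1(1)] card_edge_pairs[OF H2(1)] card_atLeastAtMost by simp
    qed (use ordered_edges_edge_pairs H1(1) H2(1) in auto)
    moreover have "- ?c = (\<lambda>x y. \<chi> {x, y} = Red)" by (auto simp: fun_eq_iff intro: colour.exhaust)
    ultimately show ?thesis
      unfolding arrows_def Field_edge_pairs[OF H1] Field_edge_pairs[OF H2]
      using contains_ordered_if_copy H1(1) H2(1) by metis
  qed
  then show ?thesis unfolding ordered_ramsey_def by (intro Least_le) blast
qed

lemma one_64th_le_powr_three_halves:
  fixes x :: real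
  assumes "1/16 \<le> x" shows "1/64 \<le> x powr (3/2)"
proof -
  have "1/64 = ((1/4) powr 2) powr (3/2 :: real)"
    by (simp only: powr_powr) (simp add: powr_numeral power_divide)
  also have "\<dots> \<le> x powr (3/2)"
    using assms by (intro powr_mono2) (auto simp: powr_numeral power_divide)
  finally show ?thesis .
qed

text \<open>If there are two edges in total, then \<open>ln (ln 2)\<close> is negative; the library extends \<open>ln\<close> as
  an even function, so that the power is that of the absolute value.\<close>

lemma one_64th_le_powr_ln_ln:
  assumes "2 \<le> m" shows "1/64 \<le> ln (ln (real m)) powr (3/2)"
proof (cases "m = 2")
  case True
  have "2 \<le> exp (15/16 :: real)"
    using exp_lower_Taylor_quadratic[of "15/16"] by (simp add: power2_eq_square)
  then have "ln 2 \<le> ln (exp (15/16 :: real))" by (intro ln_mono) auto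
  then have "1/16 \<le> - ln (ln (2::real))" using ln_le_minus_one[of "ln 2 :: real"] by simp
  then have "1/64 \<le> (- ln (ln (2::real))) powr (3/2)" by (rule one_64th_le_powr_three_halves)
  also have "\<dots> = ln (ln (2::real)) powr (3/2)"
    by (simp only: powr_def ln_minus neg_equal_0_iff_equal)
  finally show ?thesis using True by simp
next
  case False
  have "(1/3 :: real) \<le> (1 + (- 16/15) / real 32) ^ 32" by (simp add: power_divide)
  also have "\<dots> \<le> exp (- 16/15)" by (rule exp_ge_one_plus_x_over_n_power_n) auto
  finally have "exp (16/15) \<le> (3::real)" by (simp add: exp_minus field_simps)
  also have "3 \<le> real m" using False assms by simp
  finally have ln_m: "16/15 \<le> ln (real m)" using assms by (subst ln_ge_iff) auto
  have "1/16 \<le> - ln (15/16 :: real)" using ln_le_minus_one[of "15/16 :: real"] by simp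
  also have "\<dots> = ln (16/15)" by (simp add: ln_div)
  also have "\<dots> \<le> ln (ln (real m))" using ln_m by (intro ln_mono) auto
  finally show ?thesis by (rule one_64th_le_powr_three_halves)
qed

lemma loglog_le_powr_ln_ln:
  assumes "2 \<le> m"
  shows "1500001 * sqrt (loglog (real m)) ^ 3 \<le> 10 ^ 8 * ln (ln (real m)) powr (3/2)"
proof (cases "exp 1 \<le> ln (real m)")
  case True
  then have loglog: "loglog (real m) = ln (ln (real m))" unfolding loglog_def by simp
  have "sqrt (loglog (real m)) ^ 3 = (loglog (real m) powr (1/2)) powr 3"
    using loglog_ge_1[of "real m"] by (simp add: powr_half_sqrt powr_numeral)
  also have "\<dots> = ln (ln (real m)) powr (3/2)" unfolding loglog by (simp add: powr_powr)
  finally show ?thesis by simp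
next
  case False
  then have "loglog (real m) = 1" unfolding loglog_def by simp
  then show ?thesis using one_64th_le_powr_ln_ln[OF assms] by simp
qed

lemma ceiling_exp_ramsey_exponent_le:
  "real (nat \<lceil>exp (ramsey_exponent (real m1) (real m2))\<rceil>)
    \<le> exp (10 ^ 8 * (real m1 * real m2) powr (1/4) * (ln (ln (real (m1 + m2)))) powr (3/2))"
proof (cases "m1 = 0 \<or> m2 = 0")
  case True
  then show ?thesis by (auto simp: ramsey_exponent_def)
next
  case False
  define G where "G = root 4 (real m1 * real m2)"
  define l where "l = sqrt (loglog (real m1 + real m2)) ^ 3"
  have "1 * 1 \<le> real m1 * real m2" using False by (intro mult_mono) auto
  then have "1 \<le> G" unfolding G_def by (simp only: real_root_ge_1_iff zero_less_numeral mult_1)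
  moreover have "G = (real m1 * real m2) powr (1/4)"
    unfolding G_def by (simp add: root_powr_inverse)
  ultimately have G: "1 \<le> G" "G = (real m1 * real m2) powr (1/4)" .
  have "1 \<le> l" unfolding l_def using loglog_ge_1 by (intro one_le_power) simp
  then have "1 * 1 \<le> G * l" using G(1) by (intro mult_mono) auto
  then have "ramsey_exponent (real m1) (real m2) + 1 \<le> G * (1500001 * l)"
    unfolding ramsey_exponent_def G_def[symmetric] l_def[symmetric] by simp
  also have "\<dots> \<le> G * (10 ^ 8 * ln (ln (real (m1 + m2))) powr (3/2))"
    using loglog_le_powr_ln_ln[of "m1 + m2"] False G(1)
    unfolding l_def by (intro mult_left_mono) auto
  finally have exponent: "ramsey_exponent (real m1) (real m2) + 1
      \<le> 10 ^ 8 * (real m1 * real m2) powr (1/4) * ln (ln (real (m1 + m2))) powr (3/2)"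
    unfolding G(2) by (simp add: mult_ac)
  have "1 \<le> exp (ramsey_exponent (real m1) (real m2))" using ramsey_exponent_nonneg by simp
  then have "real (nat \<lceil>exp (ramsey_exponent (real m1) (real m2))\<rceil>) \<le> 2 * exp (ramsey_exponent (real m1) (real m2))"
    by linarith
  also have "\<dots> \<le> exp 1 * exp (ramsey_exponent (real m1) (real m2))"
    using exp_ge_add_one_self[of 1] by (intro mult_right_mono) auto
  also have "\<dots> \<le> exp (10 ^ 8 * (real m1 * real m2) powr (1/4) * ln (ln (real (m1 + m2))) powr (3/2))"
    using exponent by (simp add: add.commute flip: exp_add)
  finally show ?thesis .
qed

theorem theorem2p1:
  fixes H1 H2 :: ograph and m1 m2 :: nat
  assumes "ordered_graph H1" and "ordered_graph H2"
    and "no_isolated_vertices H1" and "no_isolated_vertices H2"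
    and "card (edges H1) = m1" and "card (edges H2) = m2"
  shows "real (ordered_ramsey H1 H2) \<le>
    exp (10 ^ 8 * (real m1 * real m2) powr (1/4) * (ln (ln (real (m1 + m2)))) powr (3/2))"
proof -
  have "real (ordered_ramsey H1 H2) \<le> real (nat \<lceil>exp (ramsey_exponent (real m1) (real m2))\<rceil>)"
    using ordered_ramsey_le_exp_ramsey_exponent[OF assms(1,3,2,4)]
    unfolding assms(5,6) by (simp only: of_nat_le_iff)
  also have "\<dots> \<le> exp (10 ^ 8 * (real m1 * real m2) powr (1/4) * (ln (ln (real (m1 + m2)))) powr (3/2))"
    by (rule ceiling_exp_ramsey_exponent_le)
  finally show ?thesis .
qed

end
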